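(* Suppose $1<q<\infty$, $\gamma>0$, $\alpha\in\mathbb{R}$ and $0<p<\infty$, and let $k$ be a nonnegative integer such that $pk+\alpha>-1$. Then for any holomorphic function $f$ on $\mathbb{B}_n$, $f\in\mathcal{A}^p_\alpha$ if and only if $A^{\gamma,q}_{\mathcal{R}^{k+1}}(f)$ is in $L^p(\mathbb{B}_n,dv_\alpha)$, where $$A^{\gamma,q}_{\mathcal{R}^{k+1}}(f)(z)=\left(\int_{D(z,\gamma)}\left|(1-|w|^2)^{k+1}\mathcal{R}^{k+1}f(w)\right|^q d\tau(w)\right)^{1/q},\qquad z\in\mathbb{B}_n.$$ Moreover, $$\|f-f(0)\|_{p,\alpha}\approx\left(\int_{\mathbb{B}_n}|A^{\gamma,q}_{\mathcal{R}^{k+1}}(f)|^p\,dv_\alpha\right)^{1/p},$$ where the constants implied by $\approx$ depend only on $q,\gamma,\alpha,p,k$ and $n$.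
   Context: Fix a positive integer $n$. $\mathbb{B}_n=\{z\in\mathbb{C}^n:|z|<1\}$ is the open unit ball, and $\mathcal{H}(\mathbb{B}_n)$ is the space of holomorphic functions on $\mathbb{B}_n$. $dv$ is Lebesgue measure on $\mathbb{B}_n$ normalized to be a probability measure. For $\alpha\in\mathbb{R}$, $dv_\alpha(z)=c_\alpha(1-|z|^2)^\alpha dv(z)$, with $c_\alpha=1$ if $\alpha\le-1$ and $c_\alpha=\Gamma(n+\alpha+1)/[n!\,\Gamma(\alpha+1)]$ if $\alpha>-1$. The invariant measure is $d\tau(z)=(1-|z|^2)^{-(n+1)}dv(z)$. The radial derivative of $f\in\mathcal{H}(\mathbb{B}_n)$ is $\mathcal{R}f(z)=\sum_{j=1}^n z_j\frac{\partial f}{\partial z_j}(z)$, and $\mathcal{R}^k$ is its $k$-th iterate ($\mathcal{R}^0f=f$). For $0<p<\infty$ and $\alpha\in\mathbb{R}$, the generalized Bergman space $\mathcal{A}^p_\alpha$ is the space of all $f\in\mathcal{H}(\mathbb{B}_n)$ such that $(1-|z|^2)^m\mathcal{R}^mf\in L^p(\mathbb{B}_n,dv_\alpha)$, where $m$ is a fixed nonnegative integer with $pm+\alpha>-1$ (the space does not depend on the choice of $m$). Let $N$ be the smallest nonnegative integer with $pN+\alpha>-1$; the (quasi-)norm on $\mathcal{A}^p_\alpha$ is $$\|f\|_{p,\alpha}=|f(0)|+\left(\int_{\mathbb{B}_n}(1-|z|^2)^{pN}|\mathcal{R}^Nf(z)|^p\,dv_\alpha(z)\right)^{1/p}.$$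 For $z\in\mathbb{B}_n$, $\varphi_z$ is the standard involutive automorphism of $\mathbb{B}_n$, a biholomorphic self-map with $\varphi_z(0)=z$, $\varphi_z(z)=0$, $\varphi_z\circ\varphi_z=\mathrm{id}$. The Bergman metric is $\beta(z,w)=\frac12\log\frac{1+|\varphi_z(w)|}{1-|\varphi_z(w)|}$ and $D(z,\gamma)=\{w\in\mathbb{B}_n:\beta(z,w)<\gamma\}$. For nonnegative (possibly infinite) quantities, $X\approx Y$ means $C^{-1}Y\le X\le CY$ for some constant $C>0$ not depending on $f$. *)

theory Defs
  imports "HOL-Analysis.Analysis"
begin

text \<open>
  The space of \<open>n\<close>-tuples of complex numbers is \<^typ>\<open>complex ^ 'n\<close> with \<open>n = CARD('n)\<close>; its norm is
  the Euclidean one. Functions on the unit ball are total functions whose values outside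
  \<^term>\<open>ball 0 1\<close> never matter.
\<close>

definition holomorphic_Cn :: "(complex ^ 'n::finite \<Rightarrow> complex) \<Rightarrow> (complex ^ 'n) set \<Rightarrow> bool" where
  "holomorphic_Cn f S \<longleftrightarrow>
     (\<forall>z\<in>S. \<exists>a :: complex ^ 'n. (f has_derivative (\<lambda>h. \<Sum>j\<in>UNIV. a $ j * h $ j)) (at z))"

definition partial_deriv :: "'n::finite \<Rightarrow> (complex ^ 'n \<Rightarrow> complex) \<Rightarrow> complex ^ 'n \<Rightarrow> complex" where
  "partial_deriv j f z = deriv (\<lambda>t. f (\<chi> i. if i = j then t else z $ i)) (z $ j)"

definition radial_deriv :: "(complex ^ 'n::finite \<Rightarrow> complex) \<Rightarrow> complex ^ 'n \<Rightarrow> complex" where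
  "radial_deriv f z = (\<Sum>j\<in>UNIV. z $ j * partial_deriv j f z)"

definition ball_measure :: "(complex ^ 'n::finite) measure" where
  "ball_measure = restrict_space (uniform_measure lborel (ball 0 1)) (ball 0 1)"

definition weight_const :: "nat \<Rightarrow> real \<Rightarrow> real" where
  "weight_const n \<alpha> =
     (if \<alpha> \<le> -1 then 1 else Gamma (real n + \<alpha> + 1) / (fact n * Gamma (\<alpha> + 1)))"

definition weighted_measure :: "real \<Rightarrow> (complex ^ 'n::finite) measure" where
  "weighted_measure \<alpha> =
     density ball_measure (\<lambda>z. ennreal (weight_const CARD('n) \<alpha> * (1 - (norm z)\<^sup>2) powr \<alpha>))"

definition invariant_measure :: "(complex ^ 'n::finite) measure" where
  "invariant_measure =
     density ball_measure (\<lambda>z. ennreal ((1 - (norm z)\<^sup>2) powr (- (real CARD('n) + 1))))"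

text \<open>Powers with exponent \<open>a > 0\<close> on \<open>[0, \<infinity>]\<close>.\<close>

definition ennreal_powr :: "ennreal \<Rightarrow> real \<Rightarrow> ennreal" where
  "ennreal_powr x a = (if x = \<infinity> then \<infinity> else ennreal (enn2real x powr a))"

definition Lp_norm :: "'a measure \<Rightarrow> real \<Rightarrow> ('a \<Rightarrow> ennreal) \<Rightarrow> ennreal" where
  "Lp_norm M p g = ennreal_powr (\<integral>\<^sup>+z. ennreal_powr (g z) p \<partial>M) (1 / p)"

definition in_Lp :: "'a measure \<Rightarrow> real \<Rightarrow> ('a \<Rightarrow> ennreal) \<Rightarrow> bool" where
  "in_Lp M p g \<longleftrightarrow> g \<in> borel_measurable M \<and> Lp_norm M p g < \<infinity>"

definition in_Lp_complex :: "'a measure \<Rightarrow> real \<Rightarrow> ('a \<Rightarrow> complex) \<Rightarrow> bool" where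
  "in_Lp_complex M p g \<longleftrightarrow>
     g \<in> borel_measurable M \<and> Lp_norm M p (\<lambda>z. ennreal (cmod (g z))) < \<infinity>"

definition bergman_order :: "real \<Rightarrow> real \<Rightarrow> nat" where
  "bergman_order p \<alpha> = (LEAST N. p * real N + \<alpha> > -1)"

text \<open>
  The space does not depend on which \<open>m\<close> with \<open>p m + \<alpha> > -1\<close> is fixed; here \<open>m\<close> is the least one,
  the same as in the norm.
\<close>

definition bergman_space :: "real \<Rightarrow> real \<Rightarrow> (complex ^ 'n::finite \<Rightarrow> complex) set" where
  "bergman_space p \<alpha> =
     {f. holomorphic_Cn f (ball 0 1) \<and>
         in_Lp_complex (weighted_measure \<alpha>) p
           (\<lambda>z. of_real ((1 - (norm z)\<^sup>2) ^ bergman_order p \<alpha>)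
                  * (radial_deriv ^^ bergman_order p \<alpha>) f z)}"

definition bergman_norm :: "real \<Rightarrow> real \<Rightarrow> (complex ^ 'n::finite \<Rightarrow> complex) \<Rightarrow> ennreal" where
  "bergman_norm p \<alpha> f =
     ennreal (cmod (f 0)) +
     ennreal_powr
       (\<integral>\<^sup>+z. ennreal ((1 - (norm z)\<^sup>2) powr (p * real (bergman_order p \<alpha>))
                     * cmod ((radial_deriv ^^ bergman_order p \<alpha>) f z) powr p)
          \<partial>weighted_measure \<alpha>)
       (1 / p)"

definition herm :: "complex ^ 'n::finite \<Rightarrow> complex ^ 'n \<Rightarrow> complex" where
  "herm z w = (\<Sum>j\<in>UNIV. z $ j * cnj (w $ j))"

text \<open>
  The orthogonal projection of \<open>z\<close> onto the complex line spanned by \<open>a\<close>. Since division by zero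
  gives zero, it is the zero map for \<open>a = 0\<close>, so that \<open>ball_aut 0 z = - z\<close> below.
\<close>

definition line_proj :: "complex ^ 'n::finite \<Rightarrow> complex ^ 'n \<Rightarrow> complex ^ 'n" where
  "line_proj a z = (herm z a / herm a a) *s a"

definition ball_aut :: "complex ^ 'n::finite \<Rightarrow> complex ^ 'n \<Rightarrow> complex ^ 'n" where
  "ball_aut a z =
     (1 / (1 - herm z a)) *s
       (a - line_proj a z - of_real (sqrt (1 - (norm a)\<^sup>2)) *s (z - line_proj a z))"

definition bergman_metric :: "complex ^ 'n::finite \<Rightarrow> complex ^ 'n \<Rightarrow> real" where
  "bergman_metric z w = 1 / 2 * ln ((1 + norm (ball_aut z w)) / (1 - norm (ball_aut z w)))"

definition bergman_ball :: "complex ^ 'n::finite \<Rightarrow> real \<Rightarrow> (complex ^ 'n) set" where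
  "bergman_ball z \<gamma> = {w \<in> ball 0 1. bergman_metric z w < \<gamma>}"

definition area_fun ::
    "real \<Rightarrow> real \<Rightarrow> nat \<Rightarrow> (complex ^ 'n::finite \<Rightarrow> complex) \<Rightarrow> complex ^ 'n \<Rightarrow> ennreal" where
  "area_fun \<gamma> q k f z =
     ennreal_powr
       (\<integral>\<^sup>+w \<in> bergman_ball z \<gamma>.
          ennreal (cmod (of_real ((1 - (norm w)\<^sup>2) ^ k) * (radial_deriv ^^ k) f w) powr q)
          \<partial>invariant_measure)
       (1 / q)"

end

theory Submission
  imports Defs "HOL-Complex_Analysis.Conformal_Mappings"
begin

text \<open>
  Write \<open>A z = 1 - |z|\<^sup>2\<close>, \<open>n = CARD('n)\<close> and, for a holomorphic \<open>g\<close>,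
  \<open>E b g = \<integral> A\<^sup>b |g|\<^sup>p\<close>, integrated over the unit ball against Lebesgue measure. Up to constant
  factors the \<open>p\<close>-th power of the Bergman norm of \<open>f - f 0\<close> is \<open>E (\<alpha> + p N) (R\<^sup>N (f - f 0))\<close>, where
  \<open>R\<close> is the radial derivative and \<open>N\<close> the Bergman order, and both assertions follow from two
  comparisons.

  The first one is \<open>\<integral> (area function)\<^sup>p dv\<^sub>\<alpha> \<approx> E (\<alpha> + p (k + 1)) (R\<^sup>k\<^sup>+\<^sup>1 f)\<close> (\<open>area_energy\<close>). It is local:
  on one Bergman ball the values of \<open>A\<close> are comparable, the volume of the ball is of the order of \<open>A\<close> to the
  power \<open>n + 1\<close>, and \<open>|g|\<^sup>p\<close> at a point is at most a constant times its mean over the Bergman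
  ball around the point, for every exponent \<open>p > 0\<close> (\<open>submean_pball\<close>). With the exponent \<open>q\<close>
  this mean value inequality bounds the \<open>(k + 1)\<close>-st radial derivative by the area function; with the
  exponent \<open>p\<close> it bounds the area function by a local \<open>p\<close>-th mean of that derivative, and the
  integral of local means is estimated by Tonelli's theorem
  (\<open>fubini_pball_energy\<close>).

  The second one is \<open>E b g \<approx> E (b + p) (R g)\<close> for \<open>b > -1\<close> and \<open>g 0 = 0\<close>, applied once for each step
  from order \<open>N\<close> to order \<open>k + 1\<close> (\<open>energy_chain\<close>). That the right-hand side is dominated by the left
  (\<open>energy_radial_deriv_le\<close>) is a Cauchy estimate on a disc inside a Bergman ball. The converse
  (\<open>energy_le_radial_deriv\<close>) is a Hardy inequality: \<open>g\<close> is the integral of its derivative along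
  the ray from \<open>z / 2\<close> to \<open>z\<close>, plus a term near the centre. If the weight is lowered by a small
  exponent, then already the pointwise bound for the derivative by its local means along the ray is
  integrable, for small and for large \<open>p\<close> alike, and integrating over \<open>z\<close> reduces to
  the dilations \<open>z \<mapsto> u z\<close> of the ball.

  The geometry behind all this is elementary. The Bergman ball around \<open>z\<close> consists of the points \<open>w\<close>
  with \<open>\<delta> |1 - \<langle>z, w\<rangle>|\<^sup>2 < A z A w\<close>, where \<open>\<langle>z, w\<rangle>\<close> is the Hermitian form and \<open>\<delta>\<close> depends on the radius.
  Such a set is squeezed between two multiples of an explicit ellipsoid, whose volume is known as
  soon as Lebesgue measure is known to be invariant under unitary maps.
\<close>

section \<open>The Hermitian form\<close>

lemma herm_add_left: "herm (x + y) z = herm x z + herm y z"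
  by (simp add: herm_def distrib_right sum.distrib)

lemma herm_add_right: "herm x (y + z) = herm x y + herm x z"
  by (simp add: herm_def distrib_left sum.distrib)

lemma herm_diff_left: "herm (x - y) z = herm x z - herm y z"
  by (simp add: herm_def left_diff_distrib sum_subtractf)

lemma herm_diff_right: "herm x (y - z) = herm x y - herm x z"
  by (simp add: herm_def right_diff_distrib sum_subtractf)

lemma herm_smult_left: "herm (c *s x) z = c * herm x z"
  by (simp add: herm_def sum_distrib_left mult.assoc)

lemma herm_smult_right: "herm x (c *s z) = cnj c * herm x z"
  by (simp add: herm_def sum_distrib_left mult_ac)

lemma herm_zero [simp]: "herm 0 x = 0" "herm x 0 = 0"
  by (simp_all add: herm_def)

lemma cnj_herm: "cnj (herm x y) = herm y x"
  by (simp add: herm_def mult.commute)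

lemma norm_herm_commute: "cmod (herm x y) = cmod (herm y x)"
  by (metis cnj_herm complex_mod_cnj)

lemma Re_herm_commute: "Re (herm x y) = Re (herm y x)"
  by (metis cnj_herm cnj.sel(1))

lemmas herm_simps = herm_add_left herm_add_right herm_diff_left herm_diff_right
  herm_smult_left herm_smult_right

lemma norm_vec_sq: "(norm (z :: complex ^ 'n::finite))\<^sup>2 = (\<Sum>j\<in>UNIV. (cmod (z $ j))\<^sup>2)"
  by (simp add: norm_vec_def L2_set_def sum_nonneg)

lemma herm_self: "herm z z = of_real ((norm z)\<^sup>2)"
  by (simp add: herm_def norm_vec_sq complex_norm_square [symmetric] del: of_real_power)

lemma norm_sq_herm: "(norm z)\<^sup>2 = Re (herm z z)"
  by (simp add: herm_self)

lemma norm_smult_vec: "norm (c *s (x :: complex ^ 'n::finite)) = cmod c * norm x"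
proof -
  have "(norm (c *s x))\<^sup>2 = (cmod c * norm x)\<^sup>2"
    by (simp add: norm_vec_sq norm_mult power_mult_distrib sum_distrib_left)
  then show ?thesis
    by (metis abs_norm_cancel mult_nonneg_nonneg norm_ge_zero power2_eq_imp_eq)
qed

lemma norm_add_sq: "(norm (x + y))\<^sup>2 = (norm x)\<^sup>2 + 2 * Re (herm x y) + (norm y)\<^sup>2"
  using Re_herm_commute [of x y] by (simp add: norm_sq_herm herm_simps)

lemma norm_diff_sq: "(norm (x - y))\<^sup>2 = (norm x)\<^sup>2 - 2 * Re (herm x y) + (norm y)\<^sup>2"
  using Re_herm_commute [of x y] by (simp add: norm_sq_herm herm_simps)

lemma norm_herm_le: "cmod (herm x y) \<le> norm x * norm y"
proof -
  have "cmod (herm x y) \<le> (\<Sum>j\<in>UNIV. \<bar>cmod (x $ j)\<bar> * \<bar>cmod (y $ j)\<bar>)"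
    unfolding herm_def by (rule order_trans [OF norm_sum]) (simp add: norm_mult)
  also have "\<dots> \<le> norm x * norm y"
    unfolding norm_vec_def by (rule L2_set_mult_ineq)
  finally show ?thesis .
qed

lemma continuous_on_herm [continuous_intros]:
  "continuous_on S f \<Longrightarrow> continuous_on S g \<Longrightarrow> continuous_on S (\<lambda>x. herm (f x) (g x))"
  unfolding herm_def by (intro continuous_intros)

lemma continuous_on_smult_vec [continuous_intros]:
  fixes f :: "'a::topological_space \<Rightarrow> complex" and g :: "'a \<Rightarrow> complex ^ 'n::finite"
  assumes "continuous_on S f" "continuous_on S g"
  shows "continuous_on S (\<lambda>x. f x *s g x)"
  unfolding vector_scalar_mult_def using assms
  by (intro continuous_intros) auto

lemma of_real_smult_vec: "complex_of_real c *s (x :: complex ^ 'n::finite) = c *\<^sub>R x"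
  by (subst vec_eq_iff) (simp only: vector_smult_component vector_scaleR_component scaleR_conv_of_real [where 'a=complex] simp_thms)

section \<open>Bergman balls\<close>

text \<open>
  The distance to the sphere up to a factor two: \<open>1 - |z| \<le> defect z \<le> 2 (1 - |z|)\<close> in the ball.
\<close>

definition defect :: "complex ^ 'n::finite \<Rightarrow> real" where
  "defect z = 1 - (norm z)\<^sup>2"

text \<open>
  The Bergman ball around \<open>z\<close> whose pseudohyperbolic radius is \<open>sqrt (1 - \<delta>)\<close>, in the form in which its symmetry is
  evident: a small \<open>\<delta>\<close> means a large ball.
\<close>

definition pball :: "real \<Rightarrow> complex ^ 'n::finite \<Rightarrow> (complex ^ 'n) set" where
  "pball \<delta> z = {w \<in> ball 0 1. \<delta> * (cmod (1 - herm z w))\<^sup>2 < defect z * defect w}"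

lemma defect_pos: "z \<in> ball 0 1 \<Longrightarrow> 0 < defect z"
  by (simp add: defect_def power_less_one_iff)

lemma defect_pos_iff: "0 < defect z \<longleftrightarrow> z \<in> ball 0 1"
  by (simp add: defect_def power_less_one_iff)

lemma defect_le_1: "defect z \<le> 1"
  by (simp add: defect_def)

lemma continuous_on_defect [continuous_intros]:
  "continuous_on S f \<Longrightarrow> continuous_on S (\<lambda>x. defect (f x))"
  unfolding defect_def by (intro continuous_intros)

lemma norm_diff_sq_eq: "(norm (z - w))\<^sup>2 = 2 * Re (1 - herm z w) - defect z - defect w"
  by (simp add: norm_diff_sq defect_def)

lemma defect_le_2_herm:
  assumes "z \<in> ball 0 1" "w \<in> ball 0 1"
  shows "defect z \<le> 2 * cmod (1 - herm z w)" "defect w \<le> 2 * cmod (1 - herm z w)"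
    "(norm (z - w))\<^sup>2 \<le> 2 * cmod (1 - herm z w)"
  using norm_diff_sq_eq [of z w] complex_Re_le_cmod [of "1 - herm z w"]
    defect_pos [OF assms(1)] defect_pos [OF assms(2)] zero_le_power2 [of "norm (z - w)"] by linarith+

lemma norm_1_herm_commute: "cmod (1 - herm x y) = cmod (1 - herm y x)"
  by (metis cnj_herm complex_cnj_diff complex_cnj_one complex_mod_cnj)

text \<open>
  Up to constants this is the triangle inequality for the square root of \<open>|1 - \<langle>z, w\<rangle>|\<close>. The proof
  expands \<open>1 - \<langle>z, u\<rangle>\<close> around \<open>w\<close>.
\<close>

lemma norm_1_herm_triangle:
  assumes "z \<in> ball 0 1" "w \<in> ball 0 1" "u \<in> ball 0 1"
  shows "cmod (1 - herm z u) \<le> 2 * cmod (1 - herm z w) + 4 * cmod (1 - herm w u)"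
proof -
  define a b where "a = cmod (1 - herm z w)" and "b = cmod (1 - herm w u)"
  have eq: "1 - herm z u = (1 - herm z w) + herm (z - w) (w - u) + (1 - herm w u) - of_real (defect w)"
    by (simp add: herm_simps herm_self defect_def)
  \<comment> \<open>The middle term is controlled because \<open>|z - w|\<^sup>2\<close> is at most twice \<open>|1 - \<langle>z, w\<rangle>|\<close>.\<close>
  have "cmod (1 - herm z u) \<le> a + cmod (herm (z - w) (w - u)) + b + cmod (of_real (defect w))"
    unfolding eq a_def b_def by (intro norm_triangle_le_diff norm_triangle_le add_mono order_refl)
  also have "cmod (of_real (defect w)) \<le> 2 * b"
    using defect_le_2_herm [of w u] assms defect_pos [of w] by (simp add: b_def)
  also have "cmod (herm (z - w) (w - u)) \<le> norm (z - w) * norm (w - u)"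
    by (rule norm_herm_le)
  also have "\<dots> \<le> a + b"
  proof -
    have "2 * (norm (z - w) * norm (w - u)) \<le> (norm (z - w))\<^sup>2 + (norm (w - u))\<^sup>2"
      using sum_squares_bound [of "norm (z - w)" "norm (w - u)"] by simp
    also have "\<dots> \<le> 2 * a + 2 * b"
      using defect_le_2_herm [of z w] defect_le_2_herm [of w u] assms by (simp add: a_def b_def)
    finally show ?thesis by simp
  qed
  finally show ?thesis by (simp add: a_def b_def)
qed

lemma pball_sym: "z \<in> ball 0 1 \<Longrightarrow> w \<in> pball \<delta> z \<Longrightarrow> z \<in> pball \<delta> w"
  by (auto simp: pball_def norm_1_herm_commute mult.commute)

lemma pball_subset_ball: "pball \<delta> z \<subseteq> ball 0 1"
  by (auto simp: pball_def)

text \<open>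
  Comparability on Bergman balls: \<open>|1 - \<langle>z, w\<rangle>|\<close> dominates half of either defect, so the defining
  inequality forces all three quantities to be of the same size.
\<close>

lemma pball_defect:
  assumes z: "z \<in> ball 0 1" and w: "w \<in> pball \<delta> z" and \<delta>: "0 < \<delta>"
  shows "\<delta> / 4 * defect z \<le> defect w" "defect w \<le> 4 / \<delta> * defect z"
    "cmod (1 - herm z w) \<le> 2 / \<delta> * defect z"
proof -
  define x where "x = cmod (1 - herm z w)"
  have wb: "w \<in> ball 0 1" and lt: "\<delta> * x\<^sup>2 < defect z * defect w"
    using w by (auto simp: pball_def x_def)
  have A: "0 < defect z" "0 < defect w" using z wb defect_pos by auto
  have x: "defect z \<le> 2 * x" "defect w \<le> 2 * x" using defect_le_2_herm [OF z wb] by (auto simp: x_def)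
  have "(\<delta> / 4 * defect z) * defect z \<le> \<delta> * x\<^sup>2"
  proof -
    have "defect z * defect z \<le> 2 * x * (2 * x)" using x A by (intro mult_mono) auto
    then have "\<delta> / 4 * (defect z * defect z) \<le> \<delta> / 4 * (2 * x * (2 * x))" using \<delta> by (intro mult_left_mono) auto
    also have "\<dots> = \<delta> * x\<^sup>2" by (simp add: power2_eq_square)
    finally show ?thesis by (simp only: mult.assoc)
  qed
  then have "(\<delta> / 4 * defect z) * defect z \<le> defect w * defect z" using lt by (simp add: mult.commute)
  then show "\<delta> / 4 * defect z \<le> defect w" by (rule mult_right_le_imp_le [OF _ A(1)])
  have "(\<delta> / 4 * defect w) * defect w \<le> \<delta> * x\<^sup>2"
  proof -
    have "defect w * defect w \<le> 2 * x * (2 * x)" using x A by (intro mult_mono) auto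
    then have "\<delta> / 4 * (defect w * defect w) \<le> \<delta> / 4 * (2 * x * (2 * x))" using \<delta> by (intro mult_left_mono) auto
    also have "\<dots> = \<delta> * x\<^sup>2" by (simp add: power2_eq_square)
    finally show ?thesis by (simp only: mult.assoc)
  qed
  then have "(\<delta> / 4 * defect w) * defect w \<le> defect z * defect w" using lt by (simp add: mult.commute)
  then have "\<delta> / 4 * defect w \<le> defect z" by (rule mult_right_le_imp_le [OF _ A(2)])
  then show "defect w \<le> 4 / \<delta> * defect z" using \<delta> by (simp add: field_simps)
  have "\<delta> * x * x \<le> defect z * (2 * x)"
  proof -
    have "defect z * defect w \<le> defect z * (2 * x)" using x A by (intro mult_left_mono) auto
    then show ?thesis using lt by (simp add: power2_eq_square mult_ac)
  qed
  then have "(\<delta> * x) * x \<le> (2 * defect z) * x" by (simp add: mult_ac)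
  then have "\<delta> * x \<le> 2 * defect z" by (rule mult_right_le_imp_le) (use A x in linarith)
  then show "cmod (1 - herm z w) \<le> 2 / \<delta> * defect z" using \<delta> by (simp add: field_simps x_def)
qed

text \<open>
  A weak form of the triangle inequality for the Bergman metric, with an unspecified radius: all three points have comparable defects, hence the quasi-triangle inequality applies.
\<close>

lemma pball_trans:
  assumes "0 < \<delta>" "0 < \<delta>'"
  obtains \<delta>'' :: real where "0 < \<delta>''" "\<delta>'' < 1"
    "\<And>z w u :: complex ^ 'n::finite. z \<in> ball 0 1 \<Longrightarrow> w \<in> pball \<delta> z \<Longrightarrow> u \<in> pball \<delta>' w \<Longrightarrow> u \<in> pball \<delta>'' z"
proof -
  define K where "K = 2 * (2 / \<delta>) + 4 * (2 / \<delta>' * (4 / \<delta>))"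
  define L where "L = \<delta>' / 4 * (\<delta> / 4)"
  have K: "0 < K" and L: "0 < L" using assms by (auto simp: K_def L_def add_pos_pos)
  define e where "e = min (1/2) (L / (2 * K\<^sup>2))"
  have e: "0 < e" "e < 1" "e * K\<^sup>2 < L" using K L
    by (auto simp: e_def min_def field_simps)
  show ?thesis
  proof (rule that [OF e(1,2)])
    fix z w u :: "complex ^ 'n"
    assume z: "z \<in> ball 0 1" and w: "w \<in> pball \<delta> z" and u: "u \<in> pball \<delta>' w"
    have wb: "w \<in> ball 0 1" and ub: "u \<in> ball 0 1" using w u by (auto simp: pball_def)
    note 1 = pball_defect [OF z w assms(1)] and 2 = pball_defect [OF wb u assms(2)]
    have A: "0 < defect z" using z by (rule defect_pos)
    have "cmod (1 - herm z u) \<le> 2 * (2 / \<delta> * defect z) + 4 * (2 / \<delta>' * defect w)"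
      using norm_1_herm_triangle [OF z wb ub] 1(3) 2(3) by linarith
    also have "2 / \<delta>' * defect w \<le> 2 / \<delta>' * (4 / \<delta> * defect z)"
      using 1(2) assms by (intro mult_left_mono) auto
    finally have a: "cmod (1 - herm z u) \<le> K * defect z" by (simp add: K_def algebra_simps)
    have "L * defect z = \<delta>' / 4 * (\<delta> / 4 * defect z)" by (simp add: L_def)
    also have "\<dots> \<le> \<delta>' / 4 * defect w" using 1(1) assms by (intro mult_left_mono) auto
    also have "\<dots> \<le> defect u" by (rule 2(1))
    finally have b: "L * defect z \<le> defect u" .
    have "e * (cmod (1 - herm z u))\<^sup>2 \<le> e * (K * defect z)\<^sup>2"
      using a e by (intro mult_left_mono power_mono) auto
    also have "\<dots> = e * K\<^sup>2 * (defect z * defect z)" by (simp add: power2_eq_square)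
    also have "\<dots> < L * (defect z * defect z)" using e A by (intro mult_strict_right_mono) auto
    also have "\<dots> = defect z * (L * defect z)" by simp
    also have "\<dots> \<le> defect z * defect u" using b A by (intro mult_left_mono) auto
    finally show "u \<in> pball e z" using ub by (simp add: pball_def)
  qed
qed

text \<open>
  This identity gives Bergman balls their algebraic description. The numerator of \<open>ball_aut a w\<close> is the
  difference of a multiple of \<open>a\<close> and a vector orthogonal to \<open>a\<close>, so Pythagoras gives its norm.
\<close>

lemma norm_ball_aut:
  assumes a: "a \<in> ball 0 1" and w: "w \<in> ball 0 1"
  shows "1 - (norm (ball_aut a w))\<^sup>2 = defect a * defect w / (cmod (1 - herm a w))\<^sup>2"
proof -
  define x where "x = herm w a"
  define k where "k = herm w a / herm a a"
  define s where "s = sqrt (1 - (norm a)\<^sup>2)"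
  have s2: "s\<^sup>2 = 1 - (norm a)\<^sup>2" using a by (simp add: s_def power_le_one)
  have h1: "herm a w = cnj x" by (simp add: x_def cnj_herm)
  \<comment> \<open>For \<open>a = 0\<close> this holds because division by zero gives \<open>k = 0\<close>.\<close>
  have kh: "k * of_real ((norm a)\<^sup>2) = x"
    by (cases "a = 0") (simp_all add: k_def x_def herm_self)
  have kh': "cnj k * of_real ((norm a)\<^sup>2) = cnj x"
    using arg_cong [OF kh, of cnj] by simp
  have ne: "cmod (1 - herm a w) \<noteq> 0"
    using defect_le_2_herm(1) [OF a w] defect_pos [OF a] by auto
  define P where "P = a - k *s a"
  define Q where "Q = w - k *s a"
  have PQ: "herm P Q = 0"
  proof -
    have "herm P Q = cnj x - cnj k * of_real ((norm a)\<^sup>2) - k * (cnj x - cnj k * of_real ((norm a)\<^sup>2))"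
      by (simp only: P_def Q_def herm_simps herm_self h1) (simp add: algebra_simps)
    then show ?thesis by (simp only: kh') simp
  qed
  have aut: "ball_aut a w = (1 / (1 - x)) *s (P - of_real s *s Q)"
    by (simp add: ball_aut_def line_proj_def P_def Q_def k_def s_def x_def)
  have "(norm (P - of_real s *s Q))\<^sup>2 = (norm P)\<^sup>2 + s\<^sup>2 * (norm Q)\<^sup>2"
    by (simp add: norm_diff_sq herm_simps PQ norm_smult_vec power_mult_distrib)
  also have "(norm Q)\<^sup>2 = (norm w)\<^sup>2 - 2 * Re (cnj k * x) + (cmod k)\<^sup>2 * (norm a)\<^sup>2"
    by (simp add: Q_def norm_diff_sq herm_simps norm_smult_vec power_mult_distrib x_def)
  also have "cnj k * x = of_real ((cmod k)\<^sup>2 * (norm a)\<^sup>2)"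
    by (simp only: kh [symmetric] of_real_mult complex_norm_square) (simp add: mult_ac)
  also have "(norm P)\<^sup>2 = (norm a)\<^sup>2 - 2 * Re x + (cmod k)\<^sup>2 * (norm a)\<^sup>2"
  proof -
    have "Re (cnj k * complex_of_real ((norm a)\<^sup>2)) = Re x" by (simp only: kh') simp
    then show ?thesis
    by (simp add: P_def norm_diff_sq herm_simps norm_smult_vec power_mult_distrib herm_self)
  qed
  finally have "(norm (P - of_real s *s Q))\<^sup>2 = (norm a)\<^sup>2 - 2 * Re x + (cmod k)\<^sup>2 * (norm a)\<^sup>2 + (1 - (norm a)\<^sup>2) * ((norm w)\<^sup>2 - (cmod k)\<^sup>2 * (norm a)\<^sup>2)"
    by (simp add: s2 algebra_simps)
  also have "\<dots> = (norm a)\<^sup>2 - 2 * Re x + (norm w)\<^sup>2 - (norm a)\<^sup>2 * (norm w)\<^sup>2 + (cmod k * (norm a)\<^sup>2)\<^sup>2"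
    by (simp add: algebra_simps power2_eq_square)
  also have "cmod k * (norm a)\<^sup>2 = cmod x"
    unfolding kh [symmetric] by (simp add: norm_mult norm_power)
  moreover have "(cmod (1 - x))\<^sup>2 = 1 - 2 * Re x + (cmod x)\<^sup>2"
    unfolding cmod_power2 by (simp add: power2_eq_square algebra_simps)
  ultimately have N: "(norm (P - of_real s *s Q))\<^sup>2 = (cmod (1 - x))\<^sup>2 - defect a * defect w"
    by (simp add: defect_def algebra_simps)
  have x': "cmod (1 - x) = cmod (1 - herm a w)" by (simp add: x_def norm_1_herm_commute)
  have "(norm (ball_aut a w))\<^sup>2 = ((cmod (1 - x))\<^sup>2 - defect a * defect w) / (cmod (1 - x))\<^sup>2"
    by (simp only: aut norm_smult_vec power_mult_distrib N) (simp add: norm_divide power_divide)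
  then show ?thesis using ne by (simp add: x' diff_divide_distrib)
qed

text \<open>
  The bound on the metric says that \<open>|ball_aut z w|\<close> is less than \<open>tanh \<gamma>\<close>, which is the number \<open>r\<close> below.
\<close>

lemma bergman_ball_eq_pball:
  assumes "0 < \<gamma>"
  obtains \<delta> :: real where "0 < \<delta>" "\<delta> < 1"
    "\<And>z :: complex ^ 'n::finite. z \<in> ball 0 1 \<Longrightarrow> bergman_ball z \<gamma> = pball \<delta> z"
proof -
  define r where "r = (exp (2 * \<gamma>) - 1) / (exp (2 * \<gamma>) + 1)"
  have E: "exp (2 * \<gamma>) > 1" using assms by simp
  have r: "0 < r" unfolding r_def using E by (intro divide_pos_pos) linarith+
  have r1: "r < 1" unfolding r_def using E by (simp add: pos_divide_less_eq add_pos_pos)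
  note r = r r1
  show ?thesis
  proof (rule that [of "1 - r\<^sup>2"])
    show "0 < 1 - r\<^sup>2" "1 - r\<^sup>2 < 1" using r by (auto simp: power_less_one_iff)
    fix z :: "complex ^ 'n" assume z: "z \<in> ball 0 1"
    have "bergman_metric z w < \<gamma> \<longleftrightarrow> (1 - r\<^sup>2) * (cmod (1 - herm z w))\<^sup>2 < defect z * defect w"
      if w: "w \<in> ball 0 1" for w
    proof -
      define \<rho> where "\<rho> = norm (ball_aut z w)"
      have ne: "cmod (1 - herm z w) > 0"
        using defect_le_2_herm(1) [OF z w] defect_pos [OF z] by auto
      have eq: "1 - \<rho>\<^sup>2 = defect z * defect w / (cmod (1 - herm z w))\<^sup>2"
        unfolding \<rho>_def by (rule norm_ball_aut [OF z w])
      have "1 - \<rho>\<^sup>2 > 0" unfolding eq using ne z w by (simp add: defect_pos)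
      moreover have "0 \<le> \<rho>" by (simp add: \<rho>_def)
      ultimately have \<rho>: "0 \<le> \<rho>" "\<rho> < 1" by (simp_all add: power_less_one_iff)
      have "bergman_metric z w < \<gamma> \<longleftrightarrow> ln ((1 + \<rho>) / (1 - \<rho>)) < 2 * \<gamma>"
        by (simp add: bergman_metric_def \<rho>_def [symmetric] mult.commute)
      also have "\<dots> \<longleftrightarrow> (1 + \<rho>) / (1 - \<rho>) < exp (2 * \<gamma>)"
        using \<rho> by (subst exp_less_cancel_iff [symmetric]) simp
      also have "\<dots> \<longleftrightarrow> \<rho> < r"
        using \<rho> E by (simp add: r_def pos_less_divide_eq pos_divide_less_eq add_pos_pos) (auto simp: algebra_simps)
      also have "\<dots> \<longleftrightarrow> \<rho>\<^sup>2 < r\<^sup>2"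
        using \<rho> r by (meson less_imp_le power2_less_imp_less power_strict_mono zero_less_numeral)
      also have "\<dots> \<longleftrightarrow> 1 - r\<^sup>2 < 1 - \<rho>\<^sup>2" by auto
      also have "\<dots> \<longleftrightarrow> (1 - r\<^sup>2) * (cmod (1 - herm z w))\<^sup>2 < defect z * defect w"
        unfolding eq using ne by (simp add: pos_less_divide_eq)
      finally show ?thesis .
    qed
    then show "bergman_ball z \<gamma> = pball (1 - r\<^sup>2) z"
      by (auto simp: bergman_ball_def pball_def)
  qed
qed

section \<open>Ellipsoids\<close>

text \<open>
  The linear map that multiplies the line through \<open>z\<close> by \<open>defect z\<close> and its orthogonal complement
  by \<open>sqrt (defect z)\<close>, the orders of the semiaxes of a Bergman ball around \<open>z\<close>. The formula through \<open>1 + s\<close>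
  avoids dividing by the norm of \<open>z\<close>, so that the origin is no exception.
\<close>

definition ball_frame :: "complex ^ 'n::finite \<Rightarrow> complex ^ 'n \<Rightarrow> complex ^ 'n" where
  "ball_frame z u = (let s = sqrt (defect z) in of_real s *s (u - (herm u z / of_real (1 + s)) *s z))"

lemma ball_frame_herm:
  assumes z: "z \<in> ball 0 1"
  shows "herm (ball_frame z u) z = of_real (defect z) * herm u z"
proof -
  define s where "s = sqrt (defect z)"
  have s: "0 < s" "s\<^sup>2 = defect z" using defect_pos [OF z] by (auto simp: s_def)
  have n: "(norm z)\<^sup>2 = (1 - s) * (1 + s)" using s by (simp add: defect_def algebra_simps power2_eq_square)
  have "herm (ball_frame z u) z = of_real s * (herm u z - herm u z / of_real (1 + s) * of_real ((1 - s) * (1 + s)))"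
    by (simp only: ball_frame_def s_def [symmetric] Let_def herm_simps herm_self n)
  \<comment> \<open>The simplifier must keep the factor \<open>1 + s\<close> intact in order to cancel it.\<close>
  also have "of_real ((1 - s) * (1 + s)) = complex_of_real (1 - s) * of_real (1 + s)" by (rule of_real_mult)
  also have "herm u z / of_real (1 + s) * (complex_of_real (1 - s) * of_real (1 + s)) = herm u z * of_real (1 - s)"
    using s by (simp del: of_real_add of_real_diff)
  also have "complex_of_real s * (herm u z - herm u z * complex_of_real (1 - s)) = of_real (s\<^sup>2) * herm u z"
    by (simp add: algebra_simps power2_eq_square)
  finally show ?thesis by (simp add: s)
qed

lemma norm_ball_frame_le:
  assumes z: "z \<in> ball 0 1"
  shows "(norm (ball_frame z u)) \<le> 2 * sqrt (defect z) * norm u"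
proof -
  define s where "s = sqrt (defect z)"
  have s: "0 < s" using defect_pos [OF z] by (auto simp: s_def)
  have "norm ((herm u z / of_real (1 + s)) *s z) = cmod (herm u z) * norm z / (1 + s)"
    using s by (simp add: norm_smult_vec norm_divide del: of_real_add)
  also have "\<dots> \<le> cmod (herm u z) * norm z / 1"
    using s by (intro divide_left_mono) auto
  also have "\<dots> \<le> (norm u * norm z) * norm z" by (simp add: mult_right_mono norm_herm_le)
  also have "\<dots> \<le> norm u * 1 * 1" using z by (intro mult_mono) auto
  finally have "norm (u - (herm u z / of_real (1 + s)) *s z) \<le> norm u + norm u"
    by (intro order_trans [OF norm_triangle_ineq4]) auto
  then have "s * norm (u - (herm u z / of_real (1 + s)) *s z) \<le> s * (2 * norm u)"
    using s by (intro mult_left_mono) auto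
  moreover have "norm (ball_frame z u) = s * norm (u - (herm u z / of_real (1 + s)) *s z)"
    using s by (simp only: ball_frame_def s_def [symmetric] Let_def norm_smult_vec) simp
  ultimately show ?thesis by (simp add: s_def [symmetric] mult_ac)
qed

section \<open>Lebesgue measure under linear maps\<close>

lemma nn_integral_lborel_shift:
  fixes F :: "'a::euclidean_space \<Rightarrow> ennreal"
  assumes [measurable]: "F \<in> borel_measurable borel"
  shows "(\<integral>\<^sup>+x. F (c + x) \<partial>lborel) = (\<integral>\<^sup>+x. F x \<partial>lborel)"
proof -
  have "(\<integral>\<^sup>+x. F x \<partial>lborel) = (\<integral>\<^sup>+x. F x \<partial>distr lborel borel ((+) c))"
    by (simp only: lborel_distr_plus)
  also have "\<dots> = (\<integral>\<^sup>+x. F (c + x) \<partial>lborel)"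
    by (subst nn_integral_distr) auto
  finally show ?thesis by simp
qed

lemma emeasure_lborel_unit_ball:
  "emeasure lborel (ball (0::'a::euclidean_space) 1) \<noteq> 0"
  "emeasure lborel (ball (0::'a::euclidean_space) r) < \<infinity>"
proof -
  show "emeasure lborel (ball (0::'a::euclidean_space) r) < \<infinity>"
    by (rule emeasure_bounded_finite) simp
  show "emeasure lborel (ball (0::'a::euclidean_space) 1) \<noteq> 0"
    using open_not_negligible [of "ball (0::'a) 1"]
    by (auto simp: negligible_iff_null_sets null_sets_def emeasure_completion)
qed

text \<open>
  This is the uniqueness proof for Haar measure. Writing the integral of \<open>F (U x)\<close> times the volume of
  the unit ball as a double integral, one translates \<open>y\<close> by \<open>U x\<close> and then \<open>x\<close> by a preimage of \<open>y\<close>;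
  this moves \<open>y\<close> into the argument of \<open>F\<close>, where \<open>U\<close> is absorbed by translation invariance. The unit
  ball comes out unchanged because \<open>U\<close> is an isometry.
\<close>

lemma nn_integral_lborel_isometry:
  fixes F :: "'a::euclidean_space \<Rightarrow> ennreal" and U :: "'a \<Rightarrow> 'a"
  assumes lin: "linear U" and iso: "\<And>x. norm (U x) = norm x"
  assumes F [measurable]: "F \<in> borel_measurable borel"
  shows "(\<integral>\<^sup>+x. F (U x) \<partial>lborel) = (\<integral>\<^sup>+x. F x \<partial>lborel)"
proof -
  have "inj U"
    using lin iso by (metis linear_injective_0 norm_eq_zero)
  then have "surj U" using lin linear_inj_imp_surj by blast
  then obtain V where V: "\<And>y. U (V y) = y" by (metis surjD)
  have "continuous_on UNIV U" using lin by (simp add: linear_continuous_on linear_conv_bounded_linear)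
  then have U [measurable]: "U \<in> borel_measurable borel" by (rule borel_measurable_continuous_onI)
  have add: "U (x + y) = U x + U y" for x y using lin by (rule linear_add)
  define b :: "'a \<Rightarrow> ennreal" where "b = indicator (ball 0 1)"
  have b [measurable]: "b \<in> borel_measurable borel" unfolding b_def by (intro borel_measurable_indicator borel_open open_ball)
  have sym: "b (- U x) = b x" for x by (simp add: b_def indicator_def iso)
  let ?c = "\<integral>\<^sup>+y. b y \<partial>lborel"
  have "(\<integral>\<^sup>+x. F (U x) \<partial>lborel) * ?c = (\<integral>\<^sup>+x. F (U x) * ?c \<partial>lborel)"
    by (simp add: nn_integral_multc)
  also have "\<dots> = (\<integral>\<^sup>+x. F (U x) * (\<integral>\<^sup>+y. b (- U x + y) \<partial>lborel) \<partial>lborel)"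
    by (simp only: nn_integral_lborel_shift [OF b])
  also have "\<dots> = (\<integral>\<^sup>+x. (\<integral>\<^sup>+y. F (U x) * b (- U x + y) \<partial>lborel) \<partial>lborel)"
    by (simp add: nn_integral_cmult)
  also have "\<dots> = (\<integral>\<^sup>+y. (\<integral>\<^sup>+x. F (U x) * b (- U x + y) \<partial>lborel) \<partial>lborel)"
    by (rule lborel_pair.Fubini') measurable
  also have "\<dots> = (\<integral>\<^sup>+y. (\<integral>\<^sup>+x. F (U (V y + x)) * b (- U (V y + x) + y) \<partial>lborel) \<partial>lborel)"
  proof (rule nn_integral_cong)
    fix y
    have "(\<lambda>x. F (U x) * b (- U x + y)) \<in> borel_measurable borel" by measurable
    from nn_integral_lborel_shift [OF this, of "V y"]
    show "(\<integral>\<^sup>+x. F (U x) * b (- U x + y) \<partial>lborel) = (\<integral>\<^sup>+x. F (U (V y + x)) * b (- U (V y + x) + y) \<partial>lborel)"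
      by simp
  qed
  also have "\<dots> = (\<integral>\<^sup>+y. (\<integral>\<^sup>+x. F (U x + y) * b x \<partial>lborel) \<partial>lborel)"
    by (simp add: add V sym add.commute)
  also have "\<dots> = (\<integral>\<^sup>+x. (\<integral>\<^sup>+y. F (U x + y) * b x \<partial>lborel) \<partial>lborel)"
    by (rule lborel_pair.Fubini') measurable
  also have "\<dots> = (\<integral>\<^sup>+x. (\<integral>\<^sup>+y. F (U x + y) \<partial>lborel) * b x \<partial>lborel)"
    by (simp add: nn_integral_multc)
  also have "\<dots> = (\<integral>\<^sup>+y. F y \<partial>lborel) * ?c"
    by (simp add: nn_integral_lborel_shift nn_integral_cmult)
  finally have eq: "(\<integral>\<^sup>+x. F (U x) \<partial>lborel) * ?c = (\<integral>\<^sup>+y. F y \<partial>lborel) * ?c" .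
  have "?c = emeasure lborel (ball (0::'a) 1)" by (simp add: b_def)
  then have "?c \<noteq> 0" "?c < \<infinity>" using emeasure_lborel_unit_ball [where 'a='a] by auto
  with eq show ?thesis
    by (metis ennreal_mult_divide_eq infinity_ennreal_def less_irrefl)
qed

lemma nn_integral_lborel_scale:
  fixes F :: "'a::euclidean_space \<Rightarrow> ennreal"
  assumes c: "0 < c" and F [measurable]: "F \<in> borel_measurable borel"
  shows "(\<integral>\<^sup>+x. F x \<partial>lborel) = ennreal (c ^ DIM('a)) * (\<integral>\<^sup>+x. F (c *\<^sub>R x) \<partial>lborel)"
proof -
  have "(\<integral>\<^sup>+x. F x \<partial>lborel) = (\<integral>\<^sup>+x. F x \<partial>density (distr lborel borel (\<lambda>x. 0 + c *\<^sub>R x)) (\<lambda>_. \<bar>c\<bar> ^ DIM('a)))"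
    using c by (subst lborel_affine [of c 0]) auto
  also have "\<dots> = ennreal (c ^ DIM('a)) * (\<integral>\<^sup>+x. F (c *\<^sub>R x) \<partial>lborel)"
    using c by (subst nn_integral_density; (subst nn_integral_distr)?; simp add: nn_integral_cmult)
  finally show ?thesis .
qed

lemma norm_axis_vec: "norm (axis i c :: complex ^ 'n::finite) = cmod c"
proof -
  have "(norm (axis i c :: complex ^ 'n))\<^sup>2 = (cmod c)\<^sup>2"
    unfolding norm_vec_sq by (simp add: axis_def if_distrib [of norm] if_distrib [of "\<lambda>x. x ^ 2"] cong: if_cong)
  then show ?thesis by simp
qed

definition diag_map :: "'n::finite \<Rightarrow> real \<Rightarrow> complex ^ 'n \<Rightarrow> complex ^ 'n" where
  "diag_map i s x = (\<chi> j. (if j = i then of_real s * x $ j else x $ j))"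

lemma DIM_Cn: "DIM(complex ^ 'n::finite) = 2 * CARD('n)"
  by simp

text \<open>
  Over the reals the coordinate \<open>i\<close> consists of the two basis vectors in \<open>J\<close>, which is why the
  determinant is the square of \<open>s\<close>.
\<close>

lemma nn_integral_lborel_diag:
  fixes F :: "complex ^ 'n::finite \<Rightarrow> ennreal"
  assumes s: "0 < s" and F [measurable]: "F \<in> borel_measurable borel"
  shows "(\<integral>\<^sup>+x. F x \<partial>lborel) = ennreal (s\<^sup>2) * (\<integral>\<^sup>+x. F (diag_map i s x) \<partial>lborel)"
proof -
  define J where "J = {axis i (1::complex), axis i \<i>}"
  define c where "c = (\<lambda>j. if j \<in> J then s else 1)"
  define T where "T = (\<lambda>x::complex ^ 'n. 0 + (\<Sum>j\<in>Basis. (c j * (x \<bullet> j)) *\<^sub>R j))"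
  have JB: "J \<subseteq> Basis" by (auto simp: J_def Basis_vec_def Basis_complex_def)
  have T: "T x = diag_map i s x" for x
  proof (rule euclidean_eqI)
    fix b :: "complex ^ 'n" assume b: "b \<in> Basis"
    then obtain k e where be: "b = axis k e" "e \<in> {1, \<i>}" by (auto simp: Basis_vec_def Basis_complex_def)
    have "T x \<bullet> b = c b * (x \<bullet> b)"
      using b by (simp add: T_def inner_sum_left inner_Basis if_distrib cong: if_cong)
    also have "\<dots> = diag_map i s x \<bullet> b"
      using be by (auto simp: c_def J_def diag_map_def inner_axis axis_eq_axis inner_complex_def)
    finally show "T x \<bullet> b = diag_map i s x \<bullet> b" .
  qed
  have "(\<Prod>j\<in>Basis. \<bar>c j\<bar>) = (\<Prod>j\<in>J. \<bar>c j\<bar>)"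
    by (rule prod.mono_neutral_right) (use JB in \<open>auto simp: c_def\<close>)
  also have "\<dots> = s\<^sup>2"
    using s by (simp add: J_def c_def axis_eq_axis power2_eq_square)
  finally have P: "(\<Prod>j\<in>Basis. \<bar>c j\<bar>) = s\<^sup>2" .
  have [measurable]: "T \<in> borel_measurable borel" by (simp add: T_def)
  have "(\<integral>\<^sup>+x. F x \<partial>lborel) = (\<integral>\<^sup>+x. F x \<partial>density (distr lborel borel T) (\<lambda>_. s\<^sup>2))"
    using s unfolding T_def P [symmetric] by (subst lborel_affine_euclidean [of c 0]) (auto simp: c_def)
  also have "\<dots> = ennreal (s\<^sup>2) * (\<integral>\<^sup>+x. F (T x) \<partial>lborel)"
    by (subst nn_integral_density; (subst nn_integral_distr)?; simp add: nn_integral_cmult)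
  finally show ?thesis by (simp add: T)
qed

text \<open>
  The complex Householder reflection in the hyperplane orthogonal to \<open>v\<close>.
\<close>

definition reflect :: "complex ^ 'n::finite \<Rightarrow> complex ^ 'n \<Rightarrow> complex ^ 'n" where
  "reflect v x = x - (2 * herm x v / herm v v) *s v"

lemma herm_reflect: "herm (reflect v x) (reflect v y) = herm x y"
proof (cases "v = 0")
  case False
  then have "herm v v \<noteq> 0" by (simp add: herm_self)
  moreover have "cnj (herm v v) = herm v v" by (rule cnj_herm)
  moreover have "cnj (herm y v) = herm v y" by (rule cnj_herm)
  ultimately show ?thesis by (simp add: reflect_def herm_simps field_simps)
qed (simp add: reflect_def)

lemma norm_reflect: "norm (reflect v x) = norm x"
  using herm_reflect [of v x x] by (metis norm_sq_herm norm_ge_zero power2_eq_imp_eq)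

lemma reflect_add: "reflect v (x + y) = reflect v x + reflect v y"
  by (simp add: reflect_def herm_simps vec_eq_iff add_divide_distrib algebra_simps)

lemma reflect_smult: "reflect v (c *s x) = c *s reflect v x"
  by (simp add: reflect_def herm_simps vec_eq_iff algebra_simps)

lemma reflect_diff: "reflect v (x - y) = reflect v x - reflect v y"
  by (simp add: reflect_def herm_simps vec_eq_iff diff_divide_distrib algebra_simps)

lemma linear_reflect: "linear (reflect v)"
  by (rule linearI) (simp_all add: reflect_add reflect_smult flip: of_real_smult_vec)

text \<open>
  The reality of the Hermitian product is needed since a reflection cannot change the phase of \<open>x\<close>
  relative to \<open>y\<close>.
\<close>

lemma reflect_swap:
  assumes "norm x = norm y" "Im (herm x y) = 0"
  shows "reflect (x - y) x = y"
proof (cases "x = y")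
  case False
  define v where "v = x - y"
  have v: "herm v v \<noteq> 0" using False by (simp add: herm_self v_def)
  have yx: "herm y x = herm x y" using assms(2) by (metis cnj_herm complex_cnj complex_eq_iff cnj.sel neg_equal_zero)
  have "herm v v = 2 * herm x v"
  proof -
    have "herm x x = herm y y" by (simp only: herm_self assms(1))
    then show ?thesis by (simp add: v_def herm_simps yx)
  qed
  then have "reflect v x = x - v" using v by (simp add: reflect_def)
  then show ?thesis by (simp add: v_def)
qed (simp add: reflect_def)

lemma ball_frame_reflect: "ball_frame (reflect v w) (reflect v u) = reflect v (ball_frame w u)"
  by (simp add: ball_frame_def Let_def defect_def norm_reflect herm_reflect reflect_smult reflect_diff)

lemma ball_frame_axis:
  assumes "axis i c \<in> ball 0 1"
  shows "ball_frame (axis i c) u = sqrt (defect (axis i c)) *\<^sub>R diag_map i (sqrt (defect (axis i c))) u"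
proof -
  define s where "s = sqrt (defect (axis i c))"
  have s: "0 < s" "s\<^sup>2 = defect (axis i c)" using defect_pos [OF assms] by (auto simp: s_def)
  have n: "c * cnj c = of_real ((1 - s) * (1 + s))"
  proof -
    have "(cmod c)\<^sup>2 = (1 - s) * (1 + s)"
      using s(2) by (simp add: defect_def norm_axis_vec algebra_simps power2_eq_square [of s])
    then show ?thesis by (simp only: complex_norm_square [symmetric])
  qed
  have h: "herm u (axis i c) = u $ i * cnj c"
    by (simp add: herm_def axis_def if_distrib if_distribR cong: if_cong)
  have "u $ i * cnj c / of_real (1 + s) * c = u $ i * (c * cnj c) / of_real (1 + s)" by simp
  also have "\<dots> = u $ i * of_real (1 - s)" unfolding n using s by (simp del: of_real_add of_real_diff)
  finally have k: "u $ i * cnj c / of_real (1 + s) * c = u $ i * of_real (1 - s)" .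
  have "u - (u $ i * cnj c / of_real (1 + s)) *s axis i c = diag_map i s u"
    unfolding vec_eq_iff using k by (auto simp: diag_map_def axis_def algebra_simps)
  then show ?thesis
    by (simp only: ball_frame_def s_def [symmetric] Let_def h of_real_smult_vec)
qed

text \<open>
  The determinant of \<open>ball_frame z\<close> over the reals is \<open>defect z ^ (n + 1)\<close>: a reflection carries \<open>z\<close> to a
  multiple of a coordinate vector, and there the map is diagonal.
\<close>

lemma nn_integral_ball_frame:
  fixes F :: "complex ^ 'n::finite \<Rightarrow> ennreal"
  assumes z: "z \<in> ball 0 1" and F [measurable]: "F \<in> borel_measurable borel"
  shows "(\<integral>\<^sup>+x. F x \<partial>lborel) = ennreal (defect z ^ (CARD('n) + 1)) * (\<integral>\<^sup>+u. F (z + ball_frame z u) \<partial>lborel)"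
proof -
  obtain i :: 'n where True by simp
  \<comment> \<open>The phase of \<open>c\<close> makes the Hermitian product of \<open>z\<close> and \<open>w\<close> real, as a reflection requires.\<close>
  define c where "c = of_real (norm z) * (if z $ i = 0 then 1 else sgn (z $ i))"
  define w where "w = axis i c"
  define v where "v = z - w"
  have nc: "cmod c = norm z" by (simp add: c_def norm_mult norm_sgn)
  then have nw: "norm z = norm w" by (simp add: w_def norm_axis_vec)
  have "herm z w = z $ i * cnj c"
    by (simp add: herm_def w_def axis_def if_distrib if_distribR cong: if_cong)
  also have "Im \<dots> = 0"
    by (simp add: c_def sgn_div_norm complex_mult_cnj mult.commute scaleR_conv_of_real)
  finally have R: "reflect v z = w" unfolding v_def using nw by (intro reflect_swap) auto
  have RR: "reflect v (reflect v x) = x" for x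
  proof (cases "v = 0")
    case False
    then have "herm v v \<noteq> 0" by (simp add: herm_self)
    then show ?thesis by (simp add: reflect_def herm_simps vec_eq_iff field_simps)
  qed (simp add: reflect_def)
  have wb: "w \<in> ball 0 1" using z nw by simp
  define s where "s = sqrt (defect z)"
  have s: "0 < s" "s\<^sup>2 = defect z" using defect_pos [OF z] by (auto simp: s_def)
  have dw: "defect w = defect z" by (simp add: defect_def nw)
  have frame: "ball_frame z u = reflect v (s *\<^sub>R diag_map i s (reflect v u))" for u
  proof -
    have "ball_frame z u = ball_frame (reflect v w) (reflect v (reflect v u))"
      using R RR by metis
    also have "\<dots> = reflect v (ball_frame w (reflect v u))" by (rule ball_frame_reflect)
    also have "ball_frame w (reflect v u) = s *\<^sub>R diag_map i s (reflect v u)"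
      using ball_frame_axis [of i c "reflect v u"] wb by (simp add: w_def [symmetric] dw s_def)
    finally show ?thesis .
  qed
  have cont: "continuous_on UNIV (reflect v)"
    using linear_reflect [of v] by (simp add: linear_continuous_on linear_linear)
  have mR [measurable]: "reflect v \<in> borel_measurable borel"
    using cont by (rule borel_measurable_continuous_onI)
  have "continuous_on UNIV (diag_map i s)" unfolding diag_map_def
    by (intro continuous_on_vec_lambda) (rename_tac j, case_tac "j = i", auto intro!: continuous_intros)
  then have mD [measurable]: "diag_map i s \<in> borel_measurable borel"
    by (rule borel_measurable_continuous_onI)
  note iso = nn_integral_lborel_isometry [OF linear_reflect norm_reflect]
  have "(\<integral>\<^sup>+x. F x \<partial>lborel) = (\<integral>\<^sup>+x. F (z + x) \<partial>lborel)"
    by (simp add: nn_integral_lborel_shift)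
  also have "\<dots> = (\<integral>\<^sup>+x. F (z + reflect v x) \<partial>lborel)"
    by (subst iso [of "\<lambda>x. F (z + x)"]) auto
  also have "\<dots> = ennreal (s ^ DIM(complex ^ 'n)) * (\<integral>\<^sup>+x. F (z + reflect v (s *\<^sub>R x)) \<partial>lborel)"
    using s by (subst nn_integral_lborel_scale [of s]) auto
  also have "(\<integral>\<^sup>+x. F (z + reflect v (s *\<^sub>R x)) \<partial>lborel)
      = ennreal (s\<^sup>2) * (\<integral>\<^sup>+x. F (z + reflect v (s *\<^sub>R diag_map i s x)) \<partial>lborel)"
    using s by (subst nn_integral_lborel_diag [of s _ i]) auto
  also have "(\<integral>\<^sup>+x. F (z + reflect v (s *\<^sub>R diag_map i s x)) \<partial>lborel)
      = (\<integral>\<^sup>+x. F (z + reflect v (s *\<^sub>R diag_map i s (reflect v x))) \<partial>lborel)"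
    by (subst iso [of "\<lambda>x. F (z + reflect v (s *\<^sub>R diag_map i s x))"]) auto
  also have "\<dots> = (\<integral>\<^sup>+x. F (z + ball_frame z x) \<partial>lborel)" by (simp only: frame)
  also have "ennreal (s ^ DIM(complex ^ 'n)) * (ennreal (s\<^sup>2) * (\<integral>\<^sup>+x. F (z + ball_frame z x) \<partial>lborel))
     = ennreal (s ^ DIM(complex ^ 'n) * s\<^sup>2) * (\<integral>\<^sup>+x. F (z + ball_frame z x) \<partial>lborel)"
    using s by (simp add: ennreal_mult' mult.assoc)
  also have "s ^ DIM(complex ^ 'n) * s\<^sup>2 = defect z ^ (CARD('n) + 1)"
    by (simp add: DIM_Cn power_mult s(2) del: DIM_cart)
  finally show ?thesis .
qed

text \<open>
  A bound for the inverse of \<open>ball_frame z\<close>, read off from the components of the image along \<open>z\<close> and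
  orthogonal to it.
\<close>

lemma norm_le_ball_frame:
  assumes z: "z \<in> ball 0 1"
  shows "norm u \<le> norm (ball_frame z u) / sqrt (defect z) + cmod (herm (ball_frame z u) z) / defect z"
proof -
  define s where "s = sqrt (defect z)"
  have s: "0 < s" "s\<^sup>2 = defect z" using defect_pos [OF z] by (auto simp: s_def)
  define y where "y = (herm u z / of_real (1 + s)) *s z"
  have "norm (ball_frame z u) = s * norm (u - y)"
    using s by (simp only: ball_frame_def s_def [symmetric] Let_def y_def [symmetric] norm_smult_vec) simp
  then have 1: "norm (u - y) = norm (ball_frame z u) / s" using s by simp
  have "norm y = cmod (herm u z) * norm z / (1 + s)"
    using s by (simp add: y_def norm_smult_vec norm_divide del: of_real_add)
  also have "\<dots> \<le> cmod (herm u z) * 1 / 1"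
    using s z by (intro frac_le mult_left_mono) auto
  also have "\<dots> = cmod (herm (ball_frame z u) z) / defect z"
    using defect_pos [OF z] by (simp add: ball_frame_herm [OF z] norm_mult)
  finally have 2: "norm y \<le> cmod (herm (ball_frame z u) z) / defect z" .
  have "norm u \<le> norm (u - y) + norm y" using norm_triangle_ineq [of "u - y" y] by simp
  with 1 2 show ?thesis by (simp add: s_def)
qed

lemma open_pball: "open (pball \<delta> z)"
  unfolding pball_def
  by (intro open_Collect_conj open_Collect_less continuous_intros | simp)+

lemma sets_pball [measurable]: "pball \<delta> z \<in> sets borel"
  using open_pball by (rule borel_open)

text \<open>
  The Bergman ball is contained in \<open>z + ball_frame z (ball 0 R)\<close> with \<open>R\<close> depending only on \<open>\<delta>\<close>, so
  the determinant of \<open>ball_frame z\<close> bounds its volume.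
\<close>

lemma emeasure_pball_le:
  assumes \<delta>: "0 < \<delta>"
  obtains C :: real where "0 < C"
    "\<And>z :: complex ^ 'n::finite. z \<in> ball 0 1 \<Longrightarrow> emeasure lborel (pball \<delta> z) \<le> ennreal (C * defect z ^ (CARD('n) + 1))"
proof -
  define R where "R = sqrt (4 / \<delta>) + (1 + 2 / \<delta>) + 1"
  have R: "0 < R" using \<delta> by (auto simp: R_def intro!: add_pos_nonneg add_nonneg_pos)
  define C where "C = measure lborel (ball (0 :: complex ^ 'n) R)"
  have emC: "emeasure lborel (ball (0 :: complex ^ 'n) R) = ennreal C"
    using emeasure_lborel_unit_ball(2) [where 'a="complex ^ 'n" and r=R] by (simp add: C_def emeasure_eq_ennreal_measure)
  have C0: "0 \<le> C" by (simp add: C_def)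
  show ?thesis
  proof (rule that [of "C + 1"])
    show "0 < C + 1" using C0 by simp
    fix z :: "complex ^ 'n" assume z: "z \<in> ball 0 1"
    have A: "0 < defect z" using z by (rule defect_pos)
    have sub: "norm u < R" if u: "z + ball_frame z u \<in> pball \<delta> z" for u
    proof -
      define t where "t = ball_frame z u"
      have ub: "z + t \<in> ball 0 1" using u pball_subset_ball unfolding t_def by blast
      have h: "cmod (1 - herm z (z + t)) \<le> 2 / \<delta> * defect z"
        using pball_defect(3) [OF z u \<delta>] by (simp add: t_def)
      have "(norm t)\<^sup>2 \<le> 2 * cmod (1 - herm z (z + t))"
        using defect_le_2_herm(3) [OF z ub] by simp
      also have "\<dots> \<le> 4 / \<delta> * defect z" using h by simp
      finally have "(norm t)\<^sup>2 \<le> 4 / \<delta> * defect z" .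
      then have "norm t \<le> sqrt (4 / \<delta>) * sqrt (defect z)"
        by (simp only: real_sqrt_mult [symmetric] real_le_rsqrt)
      then have 1: "norm t / sqrt (defect z) \<le> sqrt (4 / \<delta>)"
        using A by (simp add: pos_divide_le_eq)
      have "herm z t = of_real (defect z) - (1 - herm z (z + t))"
        by (simp add: herm_simps herm_self defect_def)
      then have "cmod (herm z t) \<le> defect z + 2 / \<delta> * defect z"
        using norm_triangle_ineq4 [of "of_real (defect z)" "1 - herm z (z + t)"] h A by simp
      then have "cmod (herm t z) / defect z \<le> 1 + 2 / \<delta>"
        using A by (simp add: norm_herm_commute [of t z] pos_divide_le_eq algebra_simps)
      then show ?thesis using norm_le_ball_frame [OF z, of u] 1 by (simp add: t_def R_def)
    qed
    have "emeasure lborel (pball \<delta> z) = (\<integral>\<^sup>+x. indicator (pball \<delta> z) x \<partial>lborel)" by simp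
    also have "\<dots> = ennreal (defect z ^ (CARD('n) + 1)) * (\<integral>\<^sup>+u. indicator (pball \<delta> z) (z + ball_frame z u) \<partial>lborel)"
      by (rule nn_integral_ball_frame [OF z]) simp
    also have "(\<integral>\<^sup>+u. indicator (pball \<delta> z) (z + ball_frame z u) \<partial>lborel) \<le> (\<integral>\<^sup>+u. indicator (ball (0 :: complex ^ 'n) R) u \<partial>lborel)"
      by (rule nn_integral_mono) (use sub in \<open>auto simp: indicator_def\<close>)
    also have "\<dots> = ennreal C" using emC by simp
    also have "ennreal (defect z ^ (CARD('n) + 1)) * ennreal C \<le> ennreal ((C + 1) * defect z ^ (CARD('n) + 1))"
      using A C0 by (subst ennreal_mult [symmetric]) (auto intro!: ennreal_leI simp: algebra_simps)
    finally show "emeasure lborel (pball \<delta> z) \<le> ennreal ((C + 1) * defect z ^ (CARD('n) + 1))"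
      by (simp add: mult_left_mono)
  qed
qed


section \<open>Holomorphic functions of several variables\<close>

text \<open>
  The vector in the definition of holomorphy is the gradient formed by the partial derivatives.
\<close>

lemma holomorphic_Cn_has_derivative:
  fixes f :: "complex ^ 'n::finite \<Rightarrow> complex"
  assumes "holomorphic_Cn f S" "z \<in> S"
  shows "(f has_derivative (\<lambda>h. \<Sum>j\<in>UNIV. partial_deriv j f z * h $ j)) (at z)"
proof -
  obtain a :: "complex ^ 'n" where a: "(f has_derivative (\<lambda>h. \<Sum>j\<in>UNIV. a $ j * h $ j)) (at z)"
    using assms by (auto simp: holomorphic_Cn_def)
  have "partial_deriv j f z = a $ j" for j
  proof -
    define g where "g = (\<lambda>t::complex. (\<chi> i. if i = j then t else z $ i))"
    have gz: "g (z $ j) = z" by (simp add: g_def vec_eq_iff)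
    have "g = (\<lambda>t. z + axis j (t - z $ j))"
      by (auto simp: g_def vec_eq_iff axis_def fun_eq_iff)
    moreover have bl: "bounded_linear (\<lambda>t::complex. axis j t :: complex ^ 'n)"
      by (rule bounded_linear_intro [where K=1]) (auto simp: axis_def vec_eq_iff norm_axis_vec [unfolded axis_def])
    moreover have "((\<lambda>t. z + axis j (t - z $ j)) has_derivative (\<lambda>h. 0 + axis j (h - 0))) (at (z $ j))"
      by (intro has_derivative_add has_derivative_const bounded_linear.has_derivative [OF bl]
          has_derivative_diff has_derivative_ident)
    ultimately have "(g has_derivative (\<lambda>h. axis j h)) (at (z $ j))" by simp
    then have "((\<lambda>t. f (g t)) has_derivative (\<lambda>h. \<Sum>i\<in>UNIV. a $ i * axis j h $ i)) (at (z $ j))"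
      using has_derivative_compose [of g _ "z $ j" UNIV f] a by (simp add: gz)
    also have "(\<lambda>h. \<Sum>i\<in>UNIV. a $ i * axis j h $ i) = (*) (a $ j)"
      by (auto simp: axis_def if_distrib cong: if_cong)
    finally have "((\<lambda>t. f (g t)) has_field_derivative a $ j) (at (z $ j))"
      by (simp add: has_field_derivative_def)
    then show ?thesis unfolding partial_deriv_def g_def
      by (rule DERIV_imp_deriv)
  qed
  with a show ?thesis by simp
qed

lemma holomorphic_Cn_continuous_on:
  assumes "holomorphic_Cn f S" shows "continuous_on S f"
  using holomorphic_Cn_has_derivative [OF assms]
  by (meson continuous_at_imp_continuous_on has_derivative_continuous)

lemma has_field_derivative_line:
  assumes f: "holomorphic_Cn f S" and S: "a + c *s b \<in> S"
  shows "((\<lambda>c. f (a + c *s b)) has_field_derivative (\<Sum>j\<in>UNIV. partial_deriv j f (a + c *s b) * b $ j)) (at c)"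
proof -
  have bl: "bounded_linear (\<lambda>c. c *s b)"
    by (rule bounded_linear_intro [where K="norm b"])
      (auto simp: vec_eq_iff norm_smult_vec algebra_simps)
  have "((\<lambda>c. a + c *s b) has_derivative (\<lambda>h. 0 + h *s b)) (at c)"
    by (intro has_derivative_add has_derivative_const bounded_linear.has_derivative [OF bl] has_derivative_ident)
  then have "((\<lambda>c. a + c *s b) has_derivative (\<lambda>h. h *s b)) (at c)" by simp
  from has_derivative_compose [OF this holomorphic_Cn_has_derivative [OF f S]]
  have "((\<lambda>c. f (a + c *s b)) has_derivative (\<lambda>h. \<Sum>j\<in>UNIV. partial_deriv j f (a + c *s b) * (h *s b) $ j)) (at c)" .
  also have "(\<lambda>h. \<Sum>j\<in>UNIV. partial_deriv j f (a + c *s b) * (h *s b) $ j)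
      = (*) (\<Sum>j\<in>UNIV. partial_deriv j f (a + c *s b) * b $ j)"
    by (simp add: fun_eq_iff sum_distrib_left mult_ac)
  finally show ?thesis by (simp add: has_field_derivative_def)
qed

lemma holomorphic_on_line:
  assumes "holomorphic_Cn f S" "T \<subseteq> {c. a + c *s b \<in> S}"
  shows "(\<lambda>c. f (a + c *s b)) holomorphic_on T"
  unfolding holomorphic_on_def field_differentiable_def
proof
  fix x assume "x \<in> T"
  then have "a + x *s b \<in> S" using assms(2) by blast
  from has_field_derivative_at_within [OF has_field_derivative_line [OF assms(1) this]]
  show "\<exists>f'. ((\<lambda>c. f (a + c *s b)) has_field_derivative f') (at x within T)" by blast
qed

text \<open>
  Cauchy's formula in one variable, written over a fixed interval so that it can be differentiated
  in the parameter \<open>z\<close>.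
\<close>

lemma partial_deriv_Cauchy:
  fixes f :: "complex ^ 'n::finite \<Rightarrow> complex"
  assumes f: "holomorphic_Cn f S" and r: "0 < r" and sub: "cball z r \<subseteq> S"
  shows "partial_deriv j f z = integral {0..2*pi} (\<lambda>t. f (z + (of_real r * cis t) *s axis j 1) * cis (- t)) / (2 * pi * r)"
proof -
  define \<phi> where "\<phi> = (\<lambda>c. f (z + c *s axis j 1))"
  have T: "cball 0 r \<subseteq> {c. z + c *s axis j 1 \<in> S}"
    using sub by (auto simp: subset_iff dist_norm norm_smult_vec norm_axis_vec)
  have hol: "\<phi> holomorphic_on cball 0 r"
    unfolding \<phi>_def by (rule holomorphic_on_line [OF f T])
  have D1: "(\<phi> has_field_derivative partial_deriv j f z) (at 0)"
    using has_field_derivative_line [OF f, of z 0 "axis j 1"] sub r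
    by (auto simp: \<phi>_def axis_def if_distrib subset_iff cong: if_cong)
  have cont: "continuous_on (cball 0 r) \<phi>" using hol by (rule holomorphic_on_imp_continuous_on)
  have holb: "\<phi> holomorphic_on ball 0 r" using hol by (rule holomorphic_on_subset) auto
  define I where "I = contour_integral (circlepath 0 r) (\<lambda>u. \<phi> u / (u - 0)\<^sup>2)"
  have ci: "(\<lambda>u. \<phi> u / (u - 0)\<^sup>2) contour_integrable_on circlepath 0 r"
    using Cauchy_derivative_integral_circlepath(1) [OF cont holb, of 0] r by simp
  have D2: "(\<phi> has_field_derivative (1 / (2 * of_real pi * \<i>) * I)) (at 0)"
    using Cauchy_derivative_integral_circlepath(2) [OF cont holb, of 0] r by (simp add: I_def)
  have eq: "partial_deriv j f z = 1 / (2 * of_real pi * \<i>) * I" using D1 D2 by (rule DERIV_unique)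
  have "((\<lambda>u. \<phi> u / (u - 0)\<^sup>2) has_contour_integral I) (part_circlepath 0 r 0 (2 * pi))"
    using has_contour_integral_integral [OF ci] by (simp add: I_def circlepath_def)
  then have "((\<lambda>t. \<phi> (0 + r * cis t) / (0 + r * cis t - 0)\<^sup>2 * r * \<i> * cis t) has_integral I) {0..2*pi}"
    by (subst (asm) has_contour_integral_part_circlepath_iff) auto
  also have "(\<lambda>t. \<phi> (0 + r * cis t) / (0 + r * cis t - 0)\<^sup>2 * r * \<i> * cis t) = (\<lambda>t. (\<phi> (of_real r * cis t) * cis (- t)) * (\<i> / r))"
  proof
    fix t
    have "cis (- t) = inverse (cis t)" by simp
    then show "\<phi> (0 + r * cis t) / (0 + r * cis t - 0)\<^sup>2 * r * \<i> * cis t = (\<phi> (of_real r * cis t) * cis (- t)) * (\<i> / r)"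
      using r by (simp add: power2_eq_square field_simps)
  qed
  finally have "integral {0..2*pi} (\<lambda>t. (\<phi> (of_real r * cis t) * cis (- t)) * (\<i> / r)) = I"
    by (rule integral_unique)
  then have "integral {0..2*pi} (\<lambda>t. \<phi> (of_real r * cis t) * cis (- t)) * (\<i> / r) = I"
    by simp
  then have "partial_deriv j f z = integral {0..2*pi} (\<lambda>t. \<phi> (of_real r * cis t) * cis (- t)) / (2 * pi * r)"
    unfolding eq by (simp add: field_simps)
  then show ?thesis unfolding \<phi>_def .
qed

lemma continuous_on_partial_deriv:
  fixes f :: "complex ^ 'n::finite \<Rightarrow> complex"
  assumes f: "holomorphic_Cn f S" and S: "open S"
  shows "continuous_on S (partial_deriv j f)"
proof (rule continuous_at_imp_continuous_on, rule ballI)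
  fix z assume "z \<in> S"
  then obtain e where e: "0 < e" "cball z e \<subseteq> S" using S open_contains_cball by blast
  define r where "r = e / 2"
  have r: "0 < r" using e by (simp add: r_def)
  have sub: "cball w r \<subseteq> S" if "w \<in> ball z r" for w
  proof
    fix x assume "x \<in> cball w r"
    then have "dist z x \<le> e" using that dist_triangle [of z x w] by (simp add: r_def)
    then show "x \<in> S" using e by auto
  qed
  let ?G = "\<lambda>w t. f (w + (of_real r * cis t) *s axis j 1) * cis (- t)"
  have mem: "w + (of_real r * cis t) *s axis j 1 \<in> S" if "w \<in> ball z r" for w t
    using sub [OF that] r by (auto simp: subset_iff dist_norm norm_smult_vec norm_axis_vec norm_mult)
  have "continuous_on (ball z r \<times> cbox 0 (2*pi)) (\<lambda>(w, t). ?G w t)"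
    unfolding case_prod_unfold
    by (intro continuous_intros continuous_on_compose2 [OF holomorphic_Cn_continuous_on [OF f]]) (use mem in auto)
  from integral_continuous_on_param [OF this]
  have "continuous_on (ball z r) (\<lambda>w. integral {0..2*pi} (?G w) / (2 * pi * r))"
    using r by (auto intro!: continuous_intros)
  then have "continuous_on (ball z r) (partial_deriv j f)"
    by (rule continuous_on_eq) (use partial_deriv_Cauchy [OF f r sub] in auto)
  then show "isCont (partial_deriv j f) z"
    using r by (simp add: continuous_on_eq_continuous_at)
qed

text \<open>
  Differentiation under Cauchy's integral; continuity of the partial derivatives provides the
  hypothesis of the Leibniz rule. Hence the radial derivative can be iterated.
\<close>

lemma holomorphic_partial_deriv:
  fixes f :: "complex ^ 'n::finite \<Rightarrow> complex"
  assumes f: "holomorphic_Cn f S" and S: "open S"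
  shows "holomorphic_Cn (partial_deriv j f) S"
  unfolding holomorphic_Cn_def
proof
  fix z assume "z \<in> S"
  then obtain e where e: "0 < e" "cball z e \<subseteq> S" using S open_contains_cball by blast
  define r where "r = e / 2"
  have r: "0 < r" using e by (simp add: r_def)
  have sub: "cball w r \<subseteq> S" if "w \<in> ball z r" for w
  proof
    fix x assume "x \<in> cball w r"
    then have "dist z x \<le> e" using that dist_triangle [of z x w] by (simp add: r_def)
    then show "x \<in> S" using e by auto
  qed
  let ?p = "\<lambda>w t. w + (of_real r * cis t) *s axis j 1"
  let ?G = "\<lambda>w t. f (?p w t) * cis (- t)"
  have mem: "?p w t \<in> S" if "w \<in> ball z r" for w t
    using sub [OF that] r by (auto simp: subset_iff dist_norm norm_smult_vec norm_axis_vec norm_mult)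
  \<comment> \<open>The total derivative of the integrand in \<open>w\<close>.\<close>
  define D where "D = (\<lambda>w t. Blinfun (\<lambda>h. (\<Sum>i\<in>UNIV. partial_deriv i f (?p w t) * h $ i) * cis (- t)))"
  have bl: "bounded_linear (\<lambda>h::complex ^ 'n. (\<Sum>i\<in>UNIV. c i * h $ i) * d)" for c d
    by (intro bounded_linear_intros bounded_linear_sum bounded_linear_mult_const
        bounded_linear_const_mult bounded_linear_vec_nth)
  have D: "blinfun_apply (D w t) h = (\<Sum>i\<in>UNIV. partial_deriv i f (?p w t) * h $ i) * cis (- t)" for w t h
    by (simp add: D_def bounded_linear_Blinfun_apply [OF bl])
  have contG: "continuous_on (ball z r \<times> cbox 0 (2*pi)) (\<lambda>(w, t). ?G w t)"
    unfolding case_prod_unfold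
    by (intro continuous_intros continuous_on_compose2 [OF holomorphic_Cn_continuous_on [OF f]]) (use mem in auto)
  have contD: "continuous_on (ball z r \<times> cbox 0 (2*pi)) (\<lambda>(w, t). D w t)"
    unfolding case_prod_unfold
    by (intro continuous_on_blinfun_componentwise, unfold D)
      (intro continuous_intros continuous_on_compose2 [OF continuous_on_partial_deriv [OF f S]], use mem in auto)
  have zr: "z \<in> ball z r" using r by simp
  have "((\<lambda>w. integral (cbox 0 (2*pi)) (?G w)) has_derivative integral (cbox 0 (2*pi)) (D z)) (at z within ball z r)"
  proof (rule leibniz_rule [OF _ _ contD zr convex_ball])
    fix w t assume w: "w \<in> ball z r"
    have "((\<lambda>w. ?p w t) has_derivative (\<lambda>h. h + 0)) (at w within ball z r)"
      by (intro has_derivative_add has_derivative_const has_derivative_ident)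
    then have "((\<lambda>w. ?p w t) has_derivative (\<lambda>h. h)) (at w within ball z r)" by simp
    from has_derivative_compose [OF this holomorphic_Cn_has_derivative [OF f mem [OF w]]]
    show "((\<lambda>w. ?G w t) has_derivative blinfun_apply (D w t)) (at w within ball z r)"
      unfolding D [abs_def] by (rule has_derivative_mult_left)
  next
    fix w assume w: "w \<in> ball z r"
    have "continuous_on (cbox 0 (2*pi)) (?G w)"
      by (intro continuous_intros continuous_on_compose2 [OF holomorphic_Cn_continuous_on [OF f]]) (use mem w in auto)
    then show "?G w integrable_on cbox 0 (2*pi)" by (rule integrable_continuous)
  qed
  then have der: "((\<lambda>w. integral {0..2*pi} (?G w)) has_derivative integral {0..2*pi} (D z)) (at z)"
    using zr by (simp add: at_within_open [OF zr open_ball])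
  have contDz: "continuous_on {0..2*pi} (D z)"
    by (intro continuous_on_blinfun_componentwise, unfold D)
      (intro continuous_intros continuous_on_compose2 [OF continuous_on_partial_deriv [OF f S]], use mem zr in auto)
  define b where "b = (\<chi> i. integral {0..2*pi} (\<lambda>t. partial_deriv i f (?p z t) * cis (- t)))"
  have app: "blinfun_apply (integral {0..2*pi} (D z)) h = (\<Sum>i\<in>UNIV. b $ i * h $ i)" for h
  proof -
    have "blinfun_apply (integral {0..2*pi} (D z)) h = integral {0..2*pi} (\<lambda>t. D z t h)"
      by (rule blinfun_apply_integral) (rule integrable_continuous_interval [OF contDz])
    also have "\<dots> = integral {0..2*pi} (\<lambda>t. \<Sum>i\<in>UNIV. (partial_deriv i f (?p z t) * cis (- t)) * h $ i)"
      by (simp add: D sum_distrib_left mult_ac)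
    also have "\<dots> = (\<Sum>i\<in>UNIV. integral {0..2*pi} (\<lambda>t. (partial_deriv i f (?p z t) * cis (- t)) * h $ i))"
      by (intro integral_sum integrable_continuous_interval continuous_intros
          continuous_on_compose2 [OF continuous_on_partial_deriv [OF f S]]) (use mem zr in auto)
    also have "\<dots> = (\<Sum>i\<in>UNIV. b $ i * h $ i)" by (simp add: b_def)
    finally show ?thesis .
  qed
  have "((\<lambda>w. integral {0..2*pi} (?G w) / (2 * pi * r)) has_derivative (\<lambda>h. (\<Sum>i\<in>UNIV. b $ i * h $ i) / (2 * pi * r))) (at z)"
    using has_derivative_mult_left [OF der [unfolded app [abs_def]], of "inverse (of_real (2 * pi * r))"]
    by (simp only: divide_inverse)
  also have "(\<lambda>h. (\<Sum>i\<in>UNIV. b $ i * h $ i) / (2 * pi * r)) = (\<lambda>h. \<Sum>i\<in>UNIV. (\<chi> i. b $ i / (2 * pi * r)) $ i * h $ i)"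
    by (simp add: sum_divide_distrib)
  finally have "((\<lambda>w. integral {0..2*pi} (?G w) / (2 * pi * r)) has_derivative (\<lambda>h. \<Sum>i\<in>UNIV. (\<chi> i. b $ i / (2 * pi * r)) $ i * h $ i)) (at z)" .
  then have "(partial_deriv j f has_derivative (\<lambda>h. \<Sum>i\<in>UNIV. (\<chi> i. b $ i / (2 * pi * r)) $ i * h $ i)) (at z)"
    by (rule has_derivative_transform_within_open [OF _ open_ball zr])
      (use partial_deriv_Cauchy [OF f r sub] in auto)
  then show "\<exists>a. (partial_deriv j f has_derivative (\<lambda>h. \<Sum>i\<in>UNIV. a $ i * h $ i)) (at z)" by blast
qed

lemma holomorphic_radial_deriv:
  fixes f :: "complex ^ 'n::finite \<Rightarrow> complex"
  assumes f: "holomorphic_Cn f S" and S: "open S"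
  shows "holomorphic_Cn (radial_deriv f) S"
  unfolding holomorphic_Cn_def
proof
  fix z assume z: "z \<in> S"
  let ?P = "\<lambda>j. partial_deriv j f"
  have "((\<lambda>w. \<Sum>j\<in>UNIV. w $ j * ?P j w) has_derivative
      (\<lambda>h. \<Sum>j\<in>UNIV. z $ j * (\<Sum>i\<in>UNIV. partial_deriv i (?P j) z * h $ i) + h $ j * ?P j z)) (at z)"
    by (intro has_derivative_sum has_derivative_mult
        holomorphic_Cn_has_derivative [OF holomorphic_partial_deriv [OF f S] z]
        bounded_linear.has_derivative [OF bounded_linear_vec_nth] has_derivative_ident)
  also have "(\<lambda>h. \<Sum>j\<in>UNIV. z $ j * (\<Sum>i\<in>UNIV. partial_deriv i (?P j) z * h $ i) + h $ j * ?P j z)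
     = (\<lambda>h. \<Sum>i\<in>UNIV. (\<chi> i. ?P i z + (\<Sum>j\<in>UNIV. z $ j * partial_deriv i (?P j) z)) $ i * h $ i)"
  proof
    fix h :: "complex ^ 'n"
    have "(\<Sum>j\<in>UNIV. z $ j * (\<Sum>i\<in>UNIV. partial_deriv i (?P j) z * h $ i))
        = (\<Sum>i\<in>UNIV. (\<Sum>j\<in>UNIV. z $ j * partial_deriv i (?P j) z) * h $ i)"
      by (simp only: sum_distrib_left sum_distrib_right mult.assoc) (rule sum.swap)
    then show "(\<Sum>j\<in>UNIV. z $ j * (\<Sum>i\<in>UNIV. partial_deriv i (?P j) z * h $ i) + h $ j * ?P j z)
      = (\<Sum>i\<in>UNIV. (\<chi> i. ?P i z + (\<Sum>j\<in>UNIV. z $ j * partial_deriv i (?P j) z)) $ i * h $ i)"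
      by (simp add: sum.distrib distrib_left mult.commute add.commute)
  qed
  finally show "\<exists>a. (radial_deriv f has_derivative (\<lambda>h. \<Sum>i\<in>UNIV. a $ i * h $ i)) (at z)"
    unfolding radial_deriv_def [abs_def] by blast
qed

lemma holomorphic_radial_deriv_iterate:
  "holomorphic_Cn f S \<Longrightarrow> open S \<Longrightarrow> holomorphic_Cn ((radial_deriv ^^ m) f) S"
  by (induction m) (auto intro: holomorphic_radial_deriv)

lemma radial_deriv_0 [simp]: "radial_deriv f 0 = 0"
  by (simp add: radial_deriv_def)

text \<open>
  The radial derivative is \<open>c d/dc\<close> along the complex ray \<open>c \<mapsto> f (c z)\<close>, by the chain rule.
\<close>

lemma has_field_derivative_ray:
  assumes f: "holomorphic_Cn f S" and S: "c *s z \<in> S"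
  shows "((\<lambda>c. f (c *s z)) has_field_derivative (\<Sum>j\<in>UNIV. partial_deriv j f (c *s z) * z $ j)) (at c)"
    "c * (\<Sum>j\<in>UNIV. partial_deriv j f (c *s z) * z $ j) = radial_deriv f (c *s z)"
  using has_field_derivative_line [OF f, of 0 c z] S
  by (simp_all add: radial_deriv_def sum_distrib_left mult_ac)

lemma radial_deriv_diff_const: "radial_deriv (\<lambda>z. f z - c) = radial_deriv f"
proof -
  have "((\<lambda>t. g t - c) has_field_derivative D) (at x) \<longleftrightarrow> (g has_field_derivative D) (at x)"
    for g :: "complex \<Rightarrow> complex" and D x
  proof
    assume "((\<lambda>t. g t - c) has_field_derivative D) (at x)"
    from DERIV_add [OF this DERIV_const [of c]] show "(g has_field_derivative D) (at x)" by simp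
  next
    assume "(g has_field_derivative D) (at x)"
    from DERIV_diff [OF this DERIV_const [of c]] show "((\<lambda>t. g t - c) has_field_derivative D) (at x)" by simp
  qed
  then have "deriv (\<lambda>t. g t - c) = deriv g" for g :: "complex \<Rightarrow> complex"
    unfolding deriv_def by simp
  then show ?thesis unfolding radial_deriv_def [abs_def] partial_deriv_def by simp
qed

lemma holomorphic_Cn_diff_const:
  assumes "holomorphic_Cn f S"
  shows "holomorphic_Cn (\<lambda>z. f z - c) S"
  unfolding holomorphic_Cn_def
proof
  fix z assume "z \<in> S"
  from has_derivative_diff [OF holomorphic_Cn_has_derivative [OF assms this] has_derivative_const [of c]]
  have "((\<lambda>z. f z - c) has_derivative (\<lambda>h. \<Sum>j\<in>UNIV. (\<chi> j. partial_deriv j f z) $ j * h $ j)) (at z)"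
    by simp
  then show "\<exists>a. ((\<lambda>z. f z - c) has_derivative (\<lambda>h. \<Sum>j\<in>UNIV. a $ j * h $ j)) (at z)" by blast
qed


section \<open>Mean value inequalities\<close>

lemma circle_mean_le:
  assumes hol: "\<phi> holomorphic_on cball 0 1"
  shows "ennreal (2 * pi * cmod (\<phi> 0)) \<le> (\<integral>\<^sup>+t. ennreal (cmod (\<phi> (cis t))) * indicator {0..2*pi} t \<partial>lborel)"
proof -
  have "((\<lambda>u. \<phi> u / (u - 0)) has_contour_integral (2 * of_real pi * \<i> * \<phi> 0)) (circlepath 0 1)"
    using Cauchy_integral_circlepath_simple [OF hol, of 0] by simp
  then have "((\<lambda>u. \<phi> u / (u - 0)) has_contour_integral (2 * of_real pi * \<i> * \<phi> 0)) (part_circlepath 0 1 0 (2 * pi))"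
    by (simp add: circlepath_def)
  then have "((\<lambda>t. \<phi> (0 + of_real 1 * cis t) / (0 + of_real 1 * cis t - 0) * of_real 1 * \<i> * cis t) has_integral (2 * of_real pi * \<i> * \<phi> 0)) {0..2*pi}"
    by (subst (asm) has_contour_integral_part_circlepath_iff) auto
  then have 1: "((\<lambda>t. \<i> * \<phi> (cis t)) has_integral (2 * of_real pi * \<i> * \<phi> 0)) {0..2*pi}"
    by (simp add: mult.commute)
  have cont: "continuous_on {0..2*pi} (\<lambda>t. \<phi> (cis t))"
    by (intro continuous_on_compose2 [OF holomorphic_on_imp_continuous_on [OF hol]] continuous_intros) auto
  have 2: "((\<lambda>t. cmod (\<phi> (cis t))) has_integral integral {0..2*pi} (\<lambda>t. cmod (\<phi> (cis t)))) {0..2*pi}"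
    by (intro integrable_integral integrable_continuous_interval continuous_intros cont)
  have "2 * pi * cmod (\<phi> 0) = norm (integral {0..2*pi} (\<lambda>t. \<i> * \<phi> (cis t)))"
    by (simp only: integral_unique [OF 1]) (simp add: norm_mult)
  also have "\<dots> \<le> integral {0..2*pi} (\<lambda>t. cmod (\<phi> (cis t)))"
    using 1 2 by (intro integral_norm_bound_integral) (auto simp: norm_mult integrable_on_def)
  finally have "ennreal (2 * pi * cmod (\<phi> 0)) \<le> ennreal (integral {0..2*pi} (\<lambda>t. cmod (\<phi> (cis t))))"
    by (rule ennreal_leI)
  also have "\<dots> = (\<integral>\<^sup>+t. ennreal (cmod (\<phi> (cis t))) * indicator {0..2*pi} t \<partial>lborel)"
    using nn_integral_has_integral_lebesgue' [OF _ 2] by simp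
  finally show ?thesis .
qed

text \<open>
  The mean value property and its consequences use holomorphy on complex lines only, and this weaker property
  passes to compositions with affine maps and to powers at once.
\<close>

definition gateaux_holomorphic :: "(complex ^ 'n::finite \<Rightarrow> complex) \<Rightarrow> (complex ^ 'n) set \<Rightarrow> bool" where
  "gateaux_holomorphic G S \<longleftrightarrow>
     continuous_on S G \<and> (\<forall>a b. (\<lambda>c. G (a + c *s b)) holomorphic_on {c. a + c *s b \<in> S})"

lemma borel_measurable_norm_powr_indicator:
  fixes g :: "'a::euclidean_space \<Rightarrow> complex"
  assumes "continuous_on S g" "S \<in> sets borel" "T \<subseteq> S" "T \<in> sets borel"
  shows "(\<lambda>w. ennreal (cmod (g w) powr p) * indicator T w) \<in> borel_measurable borel"
proof -
  have [measurable]: "(\<lambda>w. indicator S w *\<^sub>R g w) \<in> borel_measurable borel"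
    by (rule borel_measurable_continuous_on_indicator [OF assms(2,1)])
  note [measurable] = assms(4)
  have eq: "(\<lambda>w. ennreal (cmod (g w) powr p) * indicator T w)
      = (\<lambda>w. ennreal (cmod (indicator S w *\<^sub>R g w) powr p) * indicator T w)"
    using assms(3) by (auto simp: fun_eq_iff indicator_def)
  show ?thesis unfolding eq by measurable
qed

text \<open>
  Rotating the ball by \<open>cis t\<close> preserves Lebesgue measure. Averaging over \<open>t\<close> before integrating over
  the ball reduces the inequality to the one on circles.
\<close>

lemma mean_value_ball:
  fixes G :: "complex ^ 'n::finite \<Rightarrow> complex"
  assumes G: "gateaux_holomorphic G S" and sub: "cball a d \<subseteq> S"
  shows "ennreal (cmod (G a)) * emeasure lborel (ball a d) \<le> (\<integral>\<^sup>+u\<in>ball a d. ennreal (cmod (G u)) \<partial>lborel)"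
proof -
  define F where "F = (\<lambda>w. ennreal (cmod (G w)) * indicator (ball a d) w)"
  have "continuous_on (ball a d) G"
    using G continuous_on_subset [OF _ order_trans [OF ball_subset_cball sub]]
    by (auto simp: gateaux_holomorphic_def)
  from borel_measurable_norm_powr_indicator [OF this, of "ball a d" 1]
  have F [measurable]: "F \<in> borel_measurable borel" by (simp add: F_def powr_one_gt_zero_iff)
  have c1 [measurable]: "(\<lambda>(h, t). a + cis t *s h) \<in> borel_measurable (lborel \<Otimes>\<^sub>M lborel)"
  proof -
    have "continuous_on UNIV (\<lambda>x::(complex ^ 'n) \<times> real. a + cis (snd x) *s fst x)"
      by (intro continuous_intros)
    then have "(\<lambda>x::(complex ^ 'n) \<times> real. a + cis (snd x) *s fst x) \<in> borel_measurable borel"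
      by (rule borel_measurable_continuous_onI)
    then show ?thesis by (simp add: case_prod_unfold lborel_prod)
  qed
  have lin: "linear (\<lambda>h. cis t *s h)" for t
    by (rule linearI) (simp_all add: vec_eq_iff algebra_simps)
  have iso: "(\<integral>\<^sup>+h. F (a + cis t *s h) \<partial>lborel) = (\<integral>\<^sup>+w. F w \<partial>lborel)" for t
  proof -
    have "(\<integral>\<^sup>+h. F (a + cis t *s h) \<partial>lborel) = (\<integral>\<^sup>+h. F (a + h) \<partial>lborel)"
      by (rule nn_integral_lborel_isometry [OF lin, of t "\<lambda>h. F (a + h)"]) (auto simp: norm_smult_vec)
    then show ?thesis by (simp add: nn_integral_lborel_shift)
  qed
  have pt: "ennreal (2 * pi * cmod (G a)) * indicator (ball 0 d) h
      \<le> (\<integral>\<^sup>+t. F (a + cis t *s h) * indicator {0..2*pi} t \<partial>lborel)" for h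
  proof (cases "h \<in> ball 0 d")
    case True
    have mem: "a + c *s h \<in> cball a d" if "cmod c \<le> 1" for c
      using True that mult_mono [of "cmod c" 1 "norm h" d] by (simp add: dist_norm norm_smult_vec)
    have "(\<lambda>c. G (a + c *s h)) holomorphic_on cball 0 1"
      by (rule holomorphic_on_subset [of _ "{c. a + c *s h \<in> S}"])
        (use G mem sub in \<open>auto simp: gateaux_holomorphic_def\<close>)
    from circle_mean_le [OF this]
    have "ennreal (2 * pi * cmod (G a)) \<le> (\<integral>\<^sup>+t. ennreal (cmod (G (a + cis t *s h))) * indicator {0..2*pi} t \<partial>lborel)"
      by simp
    also have "\<dots> = (\<integral>\<^sup>+t. F (a + cis t *s h) * indicator {0..2*pi} t \<partial>lborel)"
      using True by (simp add: F_def dist_norm norm_smult_vec)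
    finally show ?thesis using True by simp
  qed simp
  have "ennreal (2 * pi * cmod (G a)) * emeasure lborel (ball (0 :: complex ^ 'n) d)
      = (\<integral>\<^sup>+h. ennreal (2 * pi * cmod (G a)) * indicator (ball (0 :: complex ^ 'n) d) h \<partial>lborel)"
    by (rule nn_integral_cmult_indicator [symmetric]) simp
  also have "\<dots> \<le> (\<integral>\<^sup>+h. (\<integral>\<^sup>+t. F (a + cis t *s h) * indicator {0..2*pi} t \<partial>lborel) \<partial>lborel)"
    by (rule nn_integral_mono) (rule pt)
  also have "\<dots> = (\<integral>\<^sup>+t. (\<integral>\<^sup>+h. F (a + cis t *s h) * indicator {0..2*pi} t \<partial>lborel) \<partial>lborel)"
    by (rule lborel_pair.Fubini') measurable
  also have "\<dots> = (\<integral>\<^sup>+t. (\<integral>\<^sup>+w. F w \<partial>lborel) * indicator {0..2*pi} t \<partial>lborel)"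
  proof (rule nn_integral_cong)
    fix t :: real
    have "(\<lambda>h. F (a + cis t *s h)) \<in> borel_measurable borel"
      by (intro measurable_compose [OF _ F] borel_measurable_continuous_onI continuous_intros)
    then show "(\<integral>\<^sup>+h. F (a + cis t *s h) * indicator {0..2*pi} t \<partial>lborel) = (\<integral>\<^sup>+w. F w \<partial>lborel) * indicator {0..2*pi} t"
      by (simp add: nn_integral_multc iso)
  qed
  also have "\<dots> = (\<integral>\<^sup>+w. F w \<partial>lborel) * ennreal (2 * pi)"
    by (subst nn_integral_cmult_indicator) auto
  finally have "ennreal (2 * pi) * (ennreal (cmod (G a)) * emeasure lborel (ball (0 :: complex ^ 'n) d))
      \<le> ennreal (2 * pi) * (\<integral>\<^sup>+w. F w \<partial>lborel)"
    by (simp add: ennreal_mult' mult_ac)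
  then have "ennreal (cmod (G a)) * emeasure lborel (ball (0 :: complex ^ 'n) d) \<le> (\<integral>\<^sup>+w. F w \<partial>lborel)"
    by (subst (asm) ennreal_mult_le_mult_iff) auto
  moreover have "emeasure lborel (ball (0 :: complex ^ 'n) d) = emeasure lborel (ball a d)"
    by (cases "0 \<le> d") (simp_all add: emeasure_ball ball_empty)
  ultimately show ?thesis by (simp add: F_def)
qed

text \<open>
  For \<open>p < 1\<close> Jensen's inequality points in the wrong direction. Instead let \<open>a\<close> maximise
  \<open>(1/2 - |u|)\<^bsup>D/p\<^esup> |G u|\<close>, where \<open>D = 2 n\<close> is the real dimension. On a ball around \<open>a\<close> whose radius \<open>d\<close> is half the distance of \<open>a\<close> to the
  sphere of radius \<open>1/2\<close>, the values of \<open>|G|\<close> are then at most \<open>K |G a|\<close>, so that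
  \<open>|G| \<le> (K |G a|)\<^bsup>1 - p\<^esup> |G|\<^sup>p\<close>, and the mean value inequality for \<open>|G|\<close> becomes one for \<open>|G|\<^sup>p\<close>. The exponent
  \<open>D/p\<close> is the one for which the powers of \<open>d\<close> cancel.
\<close>

lemma submean_unit_ball_le_1:
  fixes p :: real
  assumes p: "0 < p" "p \<le> 1"
  obtains C :: real where "0 < C"
    "\<And>G :: complex ^ 'n::finite \<Rightarrow> complex. gateaux_holomorphic G (ball 0 1) \<Longrightarrow>
       ennreal (cmod (G 0) powr p) \<le> ennreal C * (\<integral>\<^sup>+u\<in>ball 0 1. ennreal (cmod (G u) powr p) \<partial>lborel)"
proof -
  define D where "D = DIM(complex ^ 'n)"
  define \<omega> where "\<omega> = unit_ball_vol (real D)"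
  define K :: real where "K = 2 powr (D / p)"
  define C where "C = 4 ^ D * K powr (1 - p) / \<omega>"
  have \<omega>: "0 < \<omega>" by (simp add: \<omega>_def)
  have K: "0 < K" by (simp add: K_def)
  have D: "0 < D" by (simp add: D_def)
  have C: "0 < C" using \<omega> K by (simp add: C_def)
  show ?thesis
  proof (rule that [OF C])
    fix G :: "complex ^ 'n \<Rightarrow> complex" assume G: "gateaux_holomorphic G (ball 0 1)"
    define I where "I = (\<integral>\<^sup>+u\<in>ball 0 1. ennreal (cmod (G u) powr p) \<partial>lborel)"
    have contG: "continuous_on (ball 0 1) G" using G by (simp add: gateaux_holomorphic_def)
    show "ennreal (cmod (G 0) powr p) \<le> ennreal C * (\<integral>\<^sup>+u\<in>ball 0 1. ennreal (cmod (G u) powr p) \<partial>lborel)"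
    proof (cases "G 0 = 0 \<or> I = \<infinity>")
      case True
      then show ?thesis using C by (auto simp: I_def [symmetric] ennreal_mult_eq_top_iff)
    next
      case False
      then have G0: "G 0 \<noteq> 0" and If: "I \<noteq> \<infinity>" by auto
      define i where "i = enn2real I"
      have i: "I = ennreal i" "0 \<le> i" using If by (auto simp: i_def less_top)
      \<comment> \<open>The radius \<open>1/2\<close> instead of \<open>1\<close> makes the maximum exist without boundary values of \<open>G\<close>.\<close>
      define \<psi> where "\<psi> = (\<lambda>u. (1/2 - norm u) powr (D / p) * cmod (G u))"
      have "continuous_on (cball 0 (1/2)) \<psi>"
        unfolding \<psi>_def using p D
        by (intro continuous_intros continuous_on_powr' continuous_on_subset [OF contG]) auto
      then obtain a where a: "a \<in> cball 0 (1/2)" "\<And>u. u \<in> cball 0 (1/2) \<Longrightarrow> \<psi> u \<le> \<psi> a"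
        using continuous_attains_sup [of "cball (0::complex ^ 'n) (1/2)" \<psi>] by auto
      have psi0: "\<psi> 0 > 0" using G0 by (simp add: \<psi>_def)
      have "\<psi> a \<ge> \<psi> 0" using a by auto
      then have pos: "\<psi> a > 0" using psi0 by linarith
      then have na: "norm a < 1/2" and Ga: "G a \<noteq> 0"
        using a(1) by (auto simp: \<psi>_def less_le)
      define d where "d = (1/2 - norm a) / 2"
      have d: "0 < d" "d \<le> 1/4" using na by (auto simp: d_def)
      have d2: "norm a = 1/2 - 2 * d" by (simp add: d_def field_simps)
      have sub: "cball a d \<subseteq> ball 0 1"
      proof
        fix u assume "u \<in> cball a d"
        then have "norm u \<le> norm a + d" using norm_triangle_sub [of u a] by (simp add: dist_norm norm_minus_commute)
        then have "norm u < 1" using na d by linarith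
        then show "u \<in> ball 0 1" by simp
      qed
      have bd: "cmod (G u) \<le> K * cmod (G a)" if "u \<in> ball a d" for u
      proof -
        have nu: "norm u \<le> norm a + d" using that norm_triangle_sub [of u a] by (simp add: dist_norm norm_minus_commute)
        have "d powr (D / p) * cmod (G u) \<le> \<psi> u"
          unfolding \<psi>_def using d nu p by (intro mult_right_mono powr_mono2) (auto simp: d2)
        also have "\<dots> \<le> \<psi> a" using nu d by (intro a) (simp add: d2)
        also have "\<psi> a = (2 * d) powr (D / p) * cmod (G a)" by (simp add: \<psi>_def d2)
        also have "\<dots> = d powr (D / p) * (K * cmod (G a))" using d by (simp add: K_def powr_mult)
        finally show ?thesis using d by simp
      qed
      have bd2: "cmod (G u) \<le> (K * cmod (G a)) powr (1 - p) * cmod (G u) powr p" if "u \<in> ball a d" for u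
      proof (cases "G u = 0")
        case False
        then have "cmod (G u) = cmod (G u) powr (1 - p) * cmod (G u) powr p"
          by (simp flip: powr_add)
        also have "\<dots> \<le> (K * cmod (G a)) powr (1 - p) * cmod (G u) powr p"
          using p bd [OF that] by (intro mult_right_mono powr_mono2) auto
        finally show ?thesis .
      qed simp
      have "ennreal (cmod (G a)) * ennreal (\<omega> * d ^ D) \<le> (\<integral>\<^sup>+u\<in>ball a d. ennreal (cmod (G u)) \<partial>lborel)"
        using mean_value_ball [OF G sub] d by (simp add: emeasure_ball \<omega>_def D_def)
      also have "\<dots> \<le> (\<integral>\<^sup>+u. ennreal ((K * cmod (G a)) powr (1 - p)) * (ennreal (cmod (G u) powr p) * indicator (ball 0 1) u) \<partial>lborel)"
      proof (rule nn_integral_mono)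
        fix u
        show "ennreal (cmod (G u)) * indicator (ball a d) u \<le> ennreal ((K * cmod (G a)) powr (1 - p)) * (ennreal (cmod (G u) powr p) * indicator (ball 0 1) u)"
        proof (cases "u \<in> ball a d")
          case True
          then have "u \<in> ball 0 1" using sub ball_subset_cball by blast
          then show ?thesis using True bd2 [OF True]
            by (simp add: ennreal_leI flip: ennreal_mult)
        qed simp
      qed
      also have "\<dots> = ennreal ((K * cmod (G a)) powr (1 - p)) * I"
        unfolding I_def using borel_measurable_norm_powr_indicator [OF contG, of "ball 0 1" p]
        by (intro nn_integral_cmult) simp
      finally have "ennreal (cmod (G a) * (\<omega> * d ^ D)) \<le> ennreal ((K * cmod (G a)) powr (1 - p) * i)"
        using \<omega> d by (simp add: i ennreal_mult)
      then have "cmod (G a) * (\<omega> * d ^ D) \<le> (K * cmod (G a)) powr (1 - p) * i"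
        using i by (subst (asm) ennreal_le_iff) auto
      also have "(K * cmod (G a)) powr (1 - p) = K powr (1 - p) * (cmod (G a) / cmod (G a) powr p)"
        using K Ga by (simp add: powr_mult powr_diff)
      finally have "cmod (G a) powr p * (\<omega> * d ^ D) \<le> K powr (1 - p) * i"
        using Ga by (simp add: field_simps)
      then have e1: "cmod (G a) powr p * d ^ D \<le> K powr (1 - p) * i / \<omega>"
        using \<omega> by (simp add: field_simps)
      have "(1/2) ^ D * cmod (G 0) powr p = \<psi> 0 powr p"
        using p by (simp add: \<psi>_def powr_mult powr_powr powr_realpow)
      also have "\<dots> \<le> \<psi> a powr p" using \<open>\<psi> a \<ge> \<psi> 0\<close> psi0 p by (intro powr_mono2) auto
      also have "\<dots> = (2 * d) ^ D * cmod (G a) powr p"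
        using p d by (simp add: \<psi>_def d2 powr_mult powr_powr powr_realpow)
      also have "\<dots> = 2 ^ D * (cmod (G a) powr p * d ^ D)" by (simp add: power_mult_distrib)
      also have "\<dots> \<le> 2 ^ D * (K powr (1 - p) * i / \<omega>)" using e1 by (intro mult_left_mono) auto
      finally have "2 ^ D * ((1/2) ^ D * cmod (G 0) powr p) \<le> 2 ^ D * (2 ^ D * (K powr (1 - p) * i / \<omega>))"
        by (intro mult_left_mono) auto
      moreover have "(2 :: real) ^ D * (1/2) ^ D = 1" "(2 :: real) ^ D * 2 ^ D = 4 ^ D"
        by (simp_all flip: power_mult_distrib)
      ultimately have "cmod (G 0) powr p \<le> C * i"
        unfolding C_def by (simp only: mult.assoc [symmetric]) simp
      then show ?thesis using C i unfolding I_def [symmetric]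
        by (simp add: ennreal_leI flip: ennreal_mult)
    qed
  qed
qed

lemma gateaux_holomorphic_power:
  assumes "gateaux_holomorphic G S" shows "gateaux_holomorphic (\<lambda>u. G u ^ m) S"
  using assms unfolding gateaux_holomorphic_def
  by (auto intro!: continuous_intros holomorphic_intros)

text \<open>
  A large exponent \<open>p\<close> is reduced to a small one by applying the inequality to the power \<open>G\<^sup>m\<close> with
  the exponent \<open>p / m\<close>.
\<close>

lemma submean_unit_ball:
  fixes p :: real
  assumes p: "0 < p"
  obtains C :: real where "0 < C"
    "\<And>G :: complex ^ 'n::finite \<Rightarrow> complex. gateaux_holomorphic G (ball 0 1) \<Longrightarrow>
       ennreal (cmod (G 0) powr p) \<le> ennreal C * (\<integral>\<^sup>+u\<in>ball 0 1. ennreal (cmod (G u) powr p) \<partial>lborel)"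
proof -
  define m where "m = nat \<lceil>p\<rceil>"
  have m: "0 < m" "p \<le> real m" using p by (auto simp: m_def of_nat_ceiling)
  have "0 < p / m" "p / m \<le> 1" using p m by auto
  from submean_unit_ball_le_1 [OF this, where 'n='n] obtain C where C: "0 < C"
    "\<And>G :: complex ^ 'n \<Rightarrow> complex. gateaux_holomorphic G (ball 0 1) \<Longrightarrow>
       ennreal (cmod (G 0) powr (p / m)) \<le> ennreal C * (\<integral>\<^sup>+u\<in>ball 0 1. ennreal (cmod (G u) powr (p / m)) \<partial>lborel)"
    by blast
  have eq: "cmod (x ^ m) powr (p / m) = cmod x powr p" for x
    using m by (cases "x = 0") (simp_all add: norm_power powr_powr flip: powr_realpow)
  show ?thesis
  proof (rule that [OF C(1)])
    fix G :: "complex ^ 'n \<Rightarrow> complex" assume "gateaux_holomorphic G (ball 0 1)"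
    from C(2) [OF gateaux_holomorphic_power [OF this, of m]]
    show "ennreal (cmod (G 0) powr p) \<le> ennreal C * (\<integral>\<^sup>+u\<in>ball 0 1. ennreal (cmod (G u) powr p) \<partial>lborel)"
      by (simp only: eq)
  qed
qed

text \<open>
  Bergman balls contain ellipsoids: a step \<open>t\<close> of size \<open>sqrt (defect z)\<close> in general, but only
  \<open>defect z\<close> in the direction of \<open>z\<close>, changes the defect and \<open>1 - \<langle>z, w\<rangle>\<close> by small relative amounts.
\<close>

lemma near_imp_pball:
  assumes \<delta>: "0 < \<delta>" "\<delta> < 1" and z: "z \<in> ball 0 1" and c: "c = (1 - \<delta>) / 8"
    and 1: "(norm t)\<^sup>2 \<le> c * defect z" and 2: "cmod (herm t z) \<le> c * defect z"
  shows "z + t \<in> pball \<delta> z"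
proof -
  have A: "0 < defect z" using defect_pos [OF z] .
  have c0: "0 < c" "c \<le> 1/8" using \<delta> by (auto simp: c)
  have "defect (z + t) = defect z - 2 * Re (herm t z) - (norm t)\<^sup>2"
    by (simp add: defect_def norm_add_sq Re_herm_commute)
  then have d: "defect (z + t) \<ge> (1 - 3 * c) * defect z"
    using 1 2 abs_Re_le_cmod [of "herm t z"] by (simp add: algebra_simps)
  have "0 < (1 - 3 * c) * defect z" using c0 A by simp
  with d have b: "z + t \<in> ball 0 1" by (simp only: defect_pos_iff [symmetric])
  have eq: "1 - herm z (z + t) = of_real (defect z) - herm z t"
    by (simp add: herm_simps herm_self defect_def)
  have "cmod (1 - herm z (z + t)) \<le> cmod (of_real (defect z)) + cmod (herm z t)"
    unfolding eq by (rule norm_triangle_ineq4)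
  also have "\<dots> \<le> defect z + c * defect z"
    using A 2 by (simp add: norm_herm_commute [of z t])
  finally have n: "cmod (1 - herm z (z + t)) \<le> (1 + c) * defect z"
    by (simp add: distrib_right)
  \<comment> \<open>The constant \<open>c\<close> is chosen for the inequality \<open>\<delta> (1 + c)\<^sup>2 < 1 - 3 c\<close>.\<close>
  have "(1 + c)\<^sup>2 \<le> 1 + 3 * c" using c0 mult_mono [of c 1 c c] by (simp add: power2_eq_square algebra_simps)
  then have "\<delta> * (1 + c)\<^sup>2 \<le> \<delta> * (1 + 3 * c)" using \<delta> by (intro mult_left_mono) auto
  also have "\<dots> \<le> \<delta> + 3 * c" using \<delta> c0 mult_right_mono [of \<delta> 1 c] by (simp add: algebra_simps)
  also have "\<dots> < 1 - 3 * c"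
  proof -
    have "8 * c = 1 - \<delta>" by (simp add: c)
    then show ?thesis using \<delta> by linarith
  qed
  finally have k: "\<delta> * (1 + c)\<^sup>2 < 1 - 3 * c" .
  have "\<delta> * (cmod (1 - herm z (z + t)))\<^sup>2 \<le> \<delta> * ((1 + c) * defect z)\<^sup>2"
    using n \<delta> by (intro mult_left_mono power_mono) auto
  also have "\<dots> = \<delta> * (1 + c)\<^sup>2 * (defect z * defect z)" by (simp add: power_mult_distrib power2_eq_square)
  also have "\<dots> < (1 - 3 * c) * (defect z * defect z)" using k A by (intro mult_strict_right_mono) auto
  also have "\<dots> = defect z * ((1 - 3 * c) * defect z)" by simp
  also have "\<dots> \<le> defect z * defect (z + t)" using d A by (intro mult_left_mono) auto
  finally show ?thesis using b by (simp add: pball_def)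
qed

lemma ball_frame_affine: "ball_frame z (a + c *s b) = ball_frame z a + c *s ball_frame z b"
  by (simp add: ball_frame_def Let_def herm_simps vec_eq_iff add_divide_distrib algebra_simps)

lemma continuous_on_ball_frame [continuous_intros]:
  "continuous_on S f \<Longrightarrow> continuous_on S (\<lambda>x. ball_frame z (f x))"
  unfolding ball_frame_def Let_def divide_inverse by (intro continuous_intros)

text \<open>
  Without normalisation: the mean is obtained on dividing by \<open>defect w ^ (n + 1)\<close>, the order of the
  volume.
\<close>

definition local_mass :: "real \<Rightarrow> real \<Rightarrow> (complex ^ 'n::finite \<Rightarrow> complex) \<Rightarrow> complex ^ 'n \<Rightarrow> ennreal" where
  "local_mass p \<delta> h w = (\<integral>\<^sup>+v\<in>pball \<delta> w. ennreal (cmod (h v) powr p) \<partial>lborel)"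

text \<open>
  The inequality on the unit ball, transported by the affine map \<open>u \<mapsto> z + ball_frame z (\<kappa> u)\<close>, which sends the unit
  ball into the Bergman ball around \<open>z\<close>.
\<close>

lemma submean_pball:
  fixes p \<delta> :: real
  assumes p: "0 < p" and \<delta>: "0 < \<delta>" "\<delta> < 1"
  obtains C :: real where "0 < C"
    "\<And>(g :: complex ^ 'n::finite \<Rightarrow> complex) z. holomorphic_Cn g (ball 0 1) \<Longrightarrow> z \<in> ball 0 1 \<Longrightarrow>
       ennreal (cmod (g z) powr p * defect z ^ (CARD('n) + 1))
         \<le> ennreal C * local_mass p \<delta> g z"
proof -
  obtain C where C: "0 < C" "\<And>G :: complex ^ 'n::finite \<Rightarrow> complex. gateaux_holomorphic G (ball 0 1) \<Longrightarrow>
       ennreal (cmod (G 0) powr p) \<le> ennreal C * (\<integral>\<^sup>+u\<in>ball 0 1. ennreal (cmod (G u) powr p) \<partial>lborel)"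
    using submean_unit_ball [OF p, where 'n='n] by blast
  define c where "c = (1 - \<delta>) / 8"
  define \<kappa> where "\<kappa> = c / 2"
  have c: "0 < c" "c < 1" using \<delta> by (auto simp: c_def)
  then have "c * c \<le> c" by (simp add: mult_left_le)
  with c have \<kappa>: "0 < \<kappa>" "\<kappa> \<le> c" "(2 * \<kappa>)\<^sup>2 \<le> c"
    by (auto simp: \<kappa>_def power2_eq_square)
  define D where "D = DIM(complex ^ 'n)"
  show ?thesis
  proof (rule that [of "C / \<kappa> ^ D"])
    show "0 < C / \<kappa> ^ D" using C \<kappa> by simp
    fix g :: "complex ^ 'n \<Rightarrow> complex" and z :: "complex ^ 'n"
    assume g: "holomorphic_Cn g (ball 0 1)" and z: "z \<in> ball 0 1"
    have A: "0 < defect z" using z by (rule defect_pos)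
    define P where "P = (\<lambda>u. z + ball_frame z (complex_of_real \<kappa> *s u))"
    define F where "F = (\<lambda>w. ennreal (cmod (g w) powr p) * indicator (pball \<delta> z) w)"
    have contg: "continuous_on (ball 0 1) g" using g by (rule holomorphic_Cn_continuous_on)
    have F [measurable]: "F \<in> borel_measurable borel"
      unfolding F_def by (rule borel_measurable_norm_powr_indicator [OF contg]) (auto simp: pball_subset_ball sets_pball)
    have mem: "P u \<in> pball \<delta> z" if "u \<in> ball 0 1" for u
      unfolding P_def
    proof (rule near_imp_pball [OF \<delta> z c_def])
      have u: "norm u \<le> 1" using that by simp
      have "norm (ball_frame z (complex_of_real \<kappa> *s u)) \<le> 2 * sqrt (defect z) * norm (complex_of_real \<kappa> *s u)"
        by (rule norm_ball_frame_le [OF z])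
      also have "\<dots> \<le> 2 * sqrt (defect z) * \<kappa>"
        using u \<kappa> A by (intro mult_left_mono) (auto simp: norm_smult_vec mult_left_le)
      finally have "(norm (ball_frame z (complex_of_real \<kappa> *s u)))\<^sup>2 \<le> (2 * sqrt (defect z) * \<kappa>)\<^sup>2"
        by (intro power_mono) auto
      also have "\<dots> = (2 * \<kappa>)\<^sup>2 * defect z" using A by (simp add: power_mult_distrib)
      also have "\<dots> \<le> c * defect z" using \<kappa> A by (intro mult_right_mono) auto
      finally show "(norm (ball_frame z (complex_of_real \<kappa> *s u)))\<^sup>2 \<le> c * defect z" .
      have "cmod (herm (complex_of_real \<kappa> *s u) z) \<le> norm (complex_of_real \<kappa> *s u) * norm z"
        by (rule norm_herm_le)
      also have "\<dots> \<le> c * 1" using u \<kappa> z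
        by (intro mult_mono) (auto simp: norm_smult_vec intro: order_trans [OF mult_left_le])
      finally show "cmod (herm (ball_frame z (complex_of_real \<kappa> *s u)) z) \<le> c * defect z"
        using A by (simp add: ball_frame_herm [OF z] norm_mult)
    qed
    have mem1: "P u \<in> ball 0 1" if "u \<in> ball 0 1" for u
      using mem [OF that] pball_subset_ball by blast
    have aff: "P (a + s *s b) = P a + s *s ball_frame z (complex_of_real \<kappa> *s b)" for a s b
    proof -
      have "complex_of_real \<kappa> *s (a + s *s b) = complex_of_real \<kappa> *s a + s *s (complex_of_real \<kappa> *s b)"
        by (simp add: vec_eq_iff algebra_simps)
      then show ?thesis by (simp only: P_def ball_frame_affine add.assoc)
    qed
    have "gateaux_holomorphic (\<lambda>u. g (P u)) (ball 0 1)"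
      unfolding gateaux_holomorphic_def
    proof (intro conjI allI)
      show "continuous_on (ball 0 1) (\<lambda>u. g (P u))"
      proof (rule continuous_on_compose2 [OF contg])
        show "continuous_on (ball 0 1) P" unfolding P_def by (intro continuous_intros)
      qed (use mem1 in auto)
      fix a b
      show "(\<lambda>s. g (P (a + s *s b))) holomorphic_on {s. a + s *s b \<in> ball 0 1}"
        unfolding aff by (rule holomorphic_on_line [OF g]) (unfold aff [symmetric], use mem1 in blast)
    qed
    from C(2) [OF this] have 1: "ennreal (cmod (g z) powr p)
        \<le> ennreal C * (\<integral>\<^sup>+u\<in>ball 0 1. ennreal (cmod (g (P u)) powr p) \<partial>lborel)"
      by (simp add: P_def ball_frame_def)
    have "(\<integral>\<^sup>+u\<in>ball 0 1. ennreal (cmod (g (P u)) powr p) \<partial>lborel) \<le> (\<integral>\<^sup>+u. F (P u) \<partial>lborel)"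
      by (rule nn_integral_mono) (use mem in \<open>auto simp: F_def indicator_def\<close>)
    with 1 have 1: "ennreal (cmod (g z) powr p) \<le> ennreal C * (\<integral>\<^sup>+u. F (P u) \<partial>lborel)"
      by (meson mult_left_mono order_trans zero_le)
    have mF: "(\<lambda>u. F (z + ball_frame z u)) \<in> borel_measurable borel"
      by (intro measurable_compose [OF _ F] borel_measurable_continuous_onI continuous_intros)
    have "(\<integral>\<^sup>+w. F w \<partial>lborel) = ennreal (defect z ^ (CARD('n) + 1)) * (\<integral>\<^sup>+u. F (z + ball_frame z u) \<partial>lborel)"
      by (rule nn_integral_ball_frame [OF z F])
    also have "(\<integral>\<^sup>+u. F (z + ball_frame z u) \<partial>lborel) = ennreal (\<kappa> ^ D) * (\<integral>\<^sup>+u. F (P u) \<partial>lborel)"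
      using nn_integral_lborel_scale [OF \<kappa>(1) mF] by (simp add: P_def D_def of_real_smult_vec)
    finally have 2: "(\<integral>\<^sup>+w. F w \<partial>lborel) = ennreal (defect z ^ (CARD('n) + 1)) * (ennreal (\<kappa> ^ D) * (\<integral>\<^sup>+u. F (P u) \<partial>lborel))" .
    have "ennreal (cmod (g z) powr p * defect z ^ (CARD('n) + 1))
        = ennreal (defect z ^ (CARD('n) + 1)) * ennreal (cmod (g z) powr p)"
      using A by (simp add: ennreal_mult mult.commute)
    also have "\<dots> \<le> ennreal (defect z ^ (CARD('n) + 1)) * (ennreal C * (\<integral>\<^sup>+u. F (P u) \<partial>lborel))"
      using 1 by (intro mult_left_mono) auto
    also have "ennreal C = ennreal (C / \<kappa> ^ D) * ennreal (\<kappa> ^ D)"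
      using C \<kappa> by (simp flip: ennreal_mult)
    also have "ennreal (defect z ^ (CARD('n) + 1)) * (ennreal (C / \<kappa> ^ D) * ennreal (\<kappa> ^ D) * (\<integral>\<^sup>+u. F (P u) \<partial>lborel))
      = ennreal (C / \<kappa> ^ D) * (\<integral>\<^sup>+w. F w \<partial>lborel)"
      unfolding 2 by (simp only: mult_ac)
    finally show "ennreal (cmod (g z) powr p * defect z ^ (CARD('n) + 1))
         \<le> ennreal (C / \<kappa> ^ D) * local_mass p \<delta> g z"
      by (simp only: F_def local_mass_def)
  qed
qed


section \<open>Integral inequalities\<close>

text \<open>
  Two-sided comparability is what survives taking powers of either sign.
\<close>

lemma powr_compare:
  fixes x y K e :: real
  assumes "0 < x" "0 < y" "x \<le> K * y" "y \<le> K * x" "0 < K"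
  shows "x powr e \<le> K powr \<bar>e\<bar> * y powr e"
proof (cases "0 \<le> e")
  case True
  have "x powr e \<le> (K * y) powr e" using assms True by (intro powr_mono2) auto
  then show ?thesis using assms True by (simp add: powr_mult)
next
  case False
  have "x powr e \<le> (y / K) powr e"
    using assms False by (intro powr_mono2') (auto simp: pos_divide_le_eq mult.commute)
  also have "\<dots> = K powr \<bar>e\<bar> * y powr e"
    using assms False by (simp add: powr_divide powr_minus field_simps)
  finally show ?thesis .
qed

lemma pball_powr_compare:
  assumes "z \<in> ball 0 1" "w \<in> pball \<delta> z" "0 < \<delta>"
  shows "defect z powr e \<le> (4 / \<delta>) powr \<bar>e\<bar> * defect w powr e"
    "defect w powr e \<le> (4 / \<delta>) powr \<bar>e\<bar> * defect z powr e"
proof -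
  have w: "w \<in> ball 0 1" using assms pball_subset_ball by blast
  have "defect z \<le> 4 / \<delta> * defect w" "defect w \<le> 4 / \<delta> * defect z"
    using pball_defect [OF assms] assms(3) by (auto simp: field_simps)
  then show "defect z powr e \<le> (4 / \<delta>) powr \<bar>e\<bar> * defect w powr e"
    "defect w powr e \<le> (4 / \<delta>) powr \<bar>e\<bar> * defect z powr e"
    using assms w by (auto intro!: powr_compare defect_pos)
qed

text \<open>
  The relation \<open>w \<in> pball \<delta> z\<close> is open in both variables jointly, which is what Tonelli's theorem
  needs.
\<close>

lemma measurable_indicator_pball:
  "(\<lambda>x :: (complex ^ 'n::finite) \<times> (complex ^ 'n). indicator (pball \<delta> (fst x)) (snd x) :: ennreal) \<in> borel_measurable (borel \<Otimes>\<^sub>M borel)"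
proof -
  define Q where "Q = {x :: (complex ^ 'n::finite) \<times> (complex ^ 'n). snd x \<in> pball \<delta> (fst x)}"
  have "open Q" unfolding Q_def pball_def mem_Collect_eq mem_ball dist_norm
    by (intro open_Collect_conj open_Collect_less continuous_intros)
  then have "(indicator Q :: _ \<Rightarrow> ennreal) \<in> borel_measurable (borel :: ((complex ^ 'n) \<times> (complex ^ 'n)) measure)"
    by (intro borel_measurable_indicator borel_open)
  moreover have "(\<lambda>x. indicator (pball \<delta> (fst x)) (snd x) :: ennreal) = indicator Q"
    by (auto simp: Q_def indicator_def fun_eq_iff)
  ultimately show ?thesis by (simp add: borel_prod)
qed

lemma sets_ball_borel [measurable]: "ball a r \<in> sets borel"
  by simp

lemma measurable_defect [measurable]: "defect \<in> borel_measurable borel"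
  by (rule borel_measurable_continuous_onI) (rule continuous_on_defect [OF continuous_on_id])

lemma measurable_local_integral:
  assumes F [measurable]: "F \<in> borel_measurable borel"
  shows "(\<lambda>z. \<integral>\<^sup>+w\<in>pball \<delta> z. F w \<partial>lborel) \<in> borel_measurable borel"
proof -
  note [measurable] = measurable_indicator_pball [unfolded split_beta' [symmetric]]
  have "(\<lambda>x. F (snd x) * indicator (pball \<delta> (fst x)) (snd x)) \<in> borel_measurable (borel \<Otimes>\<^sub>M lborel)"
    using measurable_indicator_pball [of \<delta>]
    by (intro borel_measurable_times_ennreal) (auto simp: measurable_cong_sets [OF sets_pair_measure_cong [OF refl sets_lborel] refl])
  then have "(\<lambda>(z, w). F w * indicator (pball \<delta> z) w) \<in> borel_measurable (borel \<Otimes>\<^sub>M lborel)"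
    by (simp add: case_prod_unfold)
  from lborel.borel_measurable_nn_integral [OF this] show ?thesis .
qed

text \<open>
  After exchanging the integrals, the symmetry of the relation turns the inner one into the integral
  of \<open>defect\<^bsup>e\<^esup>\<close> over the Bergman ball around \<open>w\<close>, where the integrand is comparable to its value at \<open>w\<close>.
\<close>

lemma fubini_pball:
  fixes e \<delta> :: real
  assumes \<delta>: "0 < \<delta>"
  obtains C :: real where "0 < C"
    "\<And>F :: complex ^ 'n::finite \<Rightarrow> ennreal. F \<in> borel_measurable borel \<Longrightarrow>
       (\<integral>\<^sup>+z\<in>ball 0 1. ennreal (defect z powr e) * (\<integral>\<^sup>+w\<in>pball \<delta> z. F w \<partial>lborel) \<partial>lborel)
       \<le> ennreal C * (\<integral>\<^sup>+w\<in>ball 0 1. ennreal (defect w powr (e + real (CARD('n) + 1))) * F w \<partial>lborel)"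
proof -
  obtain V where V: "0 < V"
    "\<And>z :: complex ^ 'n. z \<in> ball 0 1 \<Longrightarrow> emeasure lborel (pball \<delta> z) \<le> ennreal (V * defect z ^ (CARD('n) + 1))"
    using emeasure_pball_le [OF \<delta>, where 'n='n] by blast
  define K where "K = (4 / \<delta>) powr \<bar>e\<bar>"
  have K: "0 < K" using \<delta> by (simp add: K_def)
  show ?thesis
  proof (rule that [of "K * V"])
    show "0 < K * V" using K V by simp
    fix F :: "complex ^ 'n \<Rightarrow> ennreal" assume F [measurable]: "F \<in> borel_measurable borel"
    let ?k = "\<lambda>z w. ennreal (defect z powr e) * indicator (ball 0 1) z * F w * indicator (pball \<delta> z) w"
    have m1: "(\<lambda>x. indicator (pball \<delta> (fst x)) (snd x) :: ennreal) \<in> borel_measurable (lborel \<Otimes>\<^sub>M (lborel :: (complex ^ 'n) measure))"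
      using measurable_indicator_pball [of \<delta>]
      by (simp add: measurable_cong_sets [OF sets_pair_measure_cong [OF sets_lborel sets_lborel] refl])
    have m2: "(\<lambda>x. ennreal (defect (fst x) powr e) * indicator (ball 0 1) (fst x) * F (snd x)) \<in> borel_measurable (lborel \<Otimes>\<^sub>M (lborel :: (complex ^ 'n) measure))"
      by measurable
    have meas: "(\<lambda>(z, w). ?k z w) \<in> borel_measurable (lborel \<Otimes>\<^sub>M lborel)"
      using borel_measurable_times_ennreal [OF m2 m1] by (simp add: case_prod_unfold)
    have mz: "(\<lambda>w. F w * indicator (pball \<delta> z) w) \<in> borel_measurable lborel" for z
      using sets_pball [of \<delta> z] by (intro borel_measurable_times_ennreal) (auto intro: borel_measurable_indicator)
    have "(\<integral>\<^sup>+z\<in>ball 0 1. ennreal (defect z powr e) * (\<integral>\<^sup>+w\<in>pball \<delta> z. F w \<partial>lborel) \<partial>lborel)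
        = (\<integral>\<^sup>+z. (\<integral>\<^sup>+w. ?k z w \<partial>lborel) \<partial>lborel)"
      using mz by (simp add: nn_integral_cmult [symmetric] mult_ac)
    also have "\<dots> = (\<integral>\<^sup>+w. (\<integral>\<^sup>+z. ?k z w \<partial>lborel) \<partial>lborel)"
      by (rule lborel_pair.Fubini' [OF meas, symmetric])
    also have "\<dots> \<le> (\<integral>\<^sup>+w. ennreal (K * V) * (ennreal (defect w powr (e + real (CARD('n) + 1))) * F w * indicator (ball 0 1) w) \<partial>lborel)"
    proof (rule nn_integral_mono)
      fix w :: "complex ^ 'n"
      show "(\<integral>\<^sup>+z. ?k z w \<partial>lborel) \<le> ennreal (K * V) * (ennreal (defect w powr (e + real (CARD('n) + 1))) * F w * indicator (ball 0 1) w)"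
      proof (cases "w \<in> ball 0 1")
        case True
        then have A: "0 < defect w" by (rule defect_pos)
        have "(\<integral>\<^sup>+z. ?k z w \<partial>lborel) \<le> (\<integral>\<^sup>+z. (ennreal (K * defect w powr e) * F w) * indicator (pball \<delta> w) z \<partial>lborel)"
        proof (rule nn_integral_mono)
          fix z
          show "?k z w \<le> (ennreal (K * defect w powr e) * F w) * indicator (pball \<delta> w) z"
          proof (cases "z \<in> ball 0 1 \<and> w \<in> pball \<delta> z")
            case True
            then have "z \<in> pball \<delta> w" using pball_sym by blast
            moreover have "defect z powr e \<le> K * defect w powr e"
              using True pball_powr_compare(1) [of z w \<delta> e] \<delta> by (simp add: K_def)
            ultimately show ?thesis using True
              by (simp add: mult_right_mono ennreal_leI)
          qed (auto simp: indicator_def)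
        qed
        also have "\<dots> = (ennreal (K * defect w powr e) * F w) * emeasure lborel (pball \<delta> w)"
          by (rule nn_integral_cmult_indicator) (simp add: sets_pball)
        also have "\<dots> \<le> (ennreal (K * defect w powr e) * F w) * ennreal (V * defect w ^ (CARD('n) + 1))"
          by (intro mult_left_mono V(2) True) auto
        also have "\<dots> = ennreal (K * defect w powr e) * ennreal (V * defect w ^ (CARD('n) + 1)) * F w"
          by (simp only: mult_ac)
        also have "ennreal (K * defect w powr e) * ennreal (V * defect w ^ (CARD('n) + 1)) = ennreal (K * V * defect w powr (e + real (CARD('n) + 1)))"
          using A K V by (subst ennreal_mult [symmetric]) (simp_all add: powr_add powr_realpow [symmetric] mult_ac)
        also have "\<dots> = ennreal (K * V) * ennreal (defect w powr (e + real (CARD('n) + 1)))"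
          using K V by (simp add: ennreal_mult')
        finally show ?thesis using True by (simp add: mult.assoc)
      next
        case False
        then have "?k z w = 0" for z using pball_subset_ball [of \<delta> z] by (auto simp: indicator_def)
        then have "(\<integral>\<^sup>+z. ?k z w \<partial>lborel) = (\<integral>\<^sup>+z. 0 \<partial>(lborel :: (complex ^ 'n) measure))"
          by (intro nn_integral_cong)
        then show ?thesis by simp
      qed
    qed
    also have "\<dots> = ennreal (K * V) * (\<integral>\<^sup>+w\<in>ball 0 1. ennreal (defect w powr (e + real (CARD('n) + 1))) * F w \<partial>lborel)"
      by (rule nn_integral_cmult) measurable
    finally show "(\<integral>\<^sup>+z\<in>ball 0 1. ennreal (defect z powr e) * (\<integral>\<^sup>+w\<in>pball \<delta> z. F w \<partial>lborel) \<partial>lborel)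
       \<le> ennreal (K * V) * (\<integral>\<^sup>+w\<in>ball 0 1. ennreal (defect w powr (e + real (CARD('n) + 1))) * F w \<partial>lborel)" .
  qed
qed

text \<open>
  The mean value inequality with the centre moved: a small Bergman ball around \<open>w\<close> lies in a
  larger one around \<open>z\<close>.
\<close>

lemma local_sup:
  fixes p \<delta> :: real
  assumes p: "0 < p" and \<delta>: "0 < \<delta>"
  obtains \<delta>' C :: real where "0 < \<delta>'" "0 < C"
    "\<And>(g :: complex ^ 'n::finite \<Rightarrow> complex) z w. holomorphic_Cn g (ball 0 1) \<Longrightarrow> z \<in> ball 0 1 \<Longrightarrow> w \<in> pball \<delta> z \<Longrightarrow>
       ennreal (cmod (g w) powr p * defect z ^ (CARD('n) + 1))
         \<le> ennreal C * local_mass p \<delta>' g z"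
proof -
  obtain C where C: "0 < C" "\<And>(g :: complex ^ 'n \<Rightarrow> complex) z. holomorphic_Cn g (ball 0 1) \<Longrightarrow> z \<in> ball 0 1 \<Longrightarrow>
       ennreal (cmod (g z) powr p * defect z ^ (CARD('n) + 1))
         \<le> ennreal C * local_mass p (1/4) g z"
    using submean_pball [OF p, of "1/4", where 'n='n] by auto
  have quarter: "0 < (1/4 :: real)" by simp
  obtain \<delta>' :: real where \<delta>': "0 < \<delta>'" "\<delta>' < 1"
    "\<And>z w u :: complex ^ 'n. z \<in> ball 0 1 \<Longrightarrow> w \<in> pball \<delta> z \<Longrightarrow> u \<in> pball (1/4) w \<Longrightarrow> u \<in> pball \<delta>' z"
  proof (rule pball_trans [OF \<delta> quarter, where 'n='n])
    fix d :: real
    assume "0 < d" "d < 1"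
      and "\<And>z w u :: complex ^ 'n. z \<in> ball 0 1 \<Longrightarrow> w \<in> pball \<delta> z \<Longrightarrow> u \<in> pball (1/4) w \<Longrightarrow> u \<in> pball d z"
    then show thesis by (rule that)
  qed
  define K where "K = (4 / \<delta>) ^ (CARD('n) + 1)"
  have K: "0 < K" using \<delta> by (simp add: K_def)
  show ?thesis
  proof (rule that [of \<delta>' "K * C"])
    show "0 < \<delta>'" "0 < K * C" using \<delta>' K C by auto
    fix g :: "complex ^ 'n \<Rightarrow> complex" and z w :: "complex ^ 'n"
    assume g: "holomorphic_Cn g (ball 0 1)" and z: "z \<in> ball 0 1" and w: "w \<in> pball \<delta> z"
    have wb: "w \<in> ball 0 1" using w pball_subset_ball by blast
    have A: "0 < defect z" "0 < defect w" using z wb by (auto intro: defect_pos)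
    have "defect z \<le> 4 / \<delta> * defect w" using pball_defect(1) [OF z w \<delta>] \<delta> by (simp add: field_simps)
    then have "defect z ^ (CARD('n) + 1) \<le> (4 / \<delta> * defect w) ^ (CARD('n) + 1)"
      using A by (intro power_mono) auto
    also have "\<dots> = K * defect w ^ (CARD('n) + 1)" by (simp only: K_def power_mult_distrib)
    finally have "cmod (g w) powr p * defect z ^ (CARD('n) + 1) \<le> cmod (g w) powr p * (K * defect w ^ (CARD('n) + 1))"
      by (intro mult_left_mono) auto
    then have "ennreal (cmod (g w) powr p * defect z ^ (CARD('n) + 1)) \<le> ennreal (K * (cmod (g w) powr p * defect w ^ (CARD('n) + 1)))"
      by (intro ennreal_leI) (simp only: mult_ac)
    also have "\<dots> = ennreal K * ennreal (cmod (g w) powr p * defect w ^ (CARD('n) + 1))"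
      using K by (simp add: ennreal_mult')
    also have "\<dots> \<le> ennreal K * (ennreal C * local_mass p (1/4) g w)"
      by (intro mult_left_mono C(2) g wb) auto
    also have "\<dots> \<le> ennreal K * (ennreal C * local_mass p \<delta>' g z)"
      unfolding local_mass_def
      by (intro mult_left_mono nn_integral_mono) (use \<delta>'(3) [OF z w] in \<open>auto simp: indicator_def\<close>)
    finally show "ennreal (cmod (g w) powr p * defect z ^ (CARD('n) + 1))
         \<le> ennreal (K * C) * local_mass p \<delta>' g z"
      using K C by (simp add: ennreal_mult' mult.assoc)
  qed
qed

text \<open>
  Cauchy's estimate for \<open>c \<mapsto> g (z + c z)\<close> on a disc whose radius is proportional to \<open>defect z\<close>; the
  disc is mapped into a Bergman ball around \<open>z\<close>, where \<open>local_sup\<close> bounds \<open>g\<close>.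
\<close>

lemma radial_deriv_pointwise:
  fixes p :: real
  assumes p: "0 < p"
  obtains \<delta> C :: real where "0 < \<delta>" "0 < C"
    "\<And>(g :: complex ^ 'n::finite \<Rightarrow> complex) z. holomorphic_Cn g (ball 0 1) \<Longrightarrow> z \<in> ball 0 1 \<Longrightarrow>
       ennreal ((defect z * cmod (radial_deriv g z)) powr p * defect z ^ (CARD('n) + 1))
         \<le> ennreal C * local_mass p \<delta> g z"
proof -
  obtain \<delta> C where \<delta>: "0 < \<delta>" and C: "0 < C" and LS: "\<And>(g :: complex ^ 'n \<Rightarrow> complex) z w. holomorphic_Cn g (ball 0 1) \<Longrightarrow> z \<in> ball 0 1 \<Longrightarrow> w \<in> pball (1/2) z \<Longrightarrow>
       ennreal (cmod (g w) powr p * defect z ^ (CARD('n) + 1))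
         \<le> ennreal C * local_mass p \<delta> g z"
    using local_sup [OF p, of "1/2", where 'n='n] by auto
  show ?thesis
  proof (rule that [OF \<delta>, of "16 powr p * C"])
    show "0 < 16 powr p * C" using C by simp
    fix g :: "complex ^ 'n \<Rightarrow> complex" and z :: "complex ^ 'n"
    assume g: "holomorphic_Cn g (ball 0 1)" and z: "z \<in> ball 0 1"
    have A: "0 < defect z" "defect z \<le> 1" using z by (auto intro: defect_pos defect_le_1)
    define S where "S = local_mass p \<delta> g z"
    \<comment> \<open>The factor \<open>1/16\<close> is the constant of \<open>near_imp_pball\<close> for \<open>\<delta> = 1/2\<close>.\<close>
    define r where "r = defect z / 16"
    have r: "0 < r" using A by (simp add: r_def)
    show "ennreal ((defect z * cmod (radial_deriv g z)) powr p * defect z ^ (CARD('n) + 1))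
         \<le> ennreal (16 powr p * C) * local_mass p \<delta> g z"
    proof (cases "S = \<infinity>")
      case True
      then show ?thesis using C by (simp add: S_def [symmetric] ennreal_mult_eq_top_iff)
    next
      case False
      define s where "s = enn2real S"
      have s: "S = ennreal s" "0 \<le> s" using False by (auto simp: s_def less_top)
      define N where "N = (C * s / defect z ^ (CARD('n) + 1)) powr (1 / p)"
      have bd: "cmod (g w) \<le> N" if "w \<in> pball (1/2) z" for w
      proof -
        have "ennreal (cmod (g w) powr p * defect z ^ (CARD('n) + 1)) \<le> ennreal (C * s)"
          using LS [OF g z that] C s by (simp add: S_def [symmetric] ennreal_mult)
        then have "cmod (g w) powr p * defect z ^ (CARD('n) + 1) \<le> C * s"
          using C s by (subst (asm) ennreal_le_iff) auto
        then have "cmod (g w) powr p \<le> C * s / defect z ^ (CARD('n) + 1)"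
          using A by (subst pos_le_divide_eq) auto
        then have "(cmod (g w) powr p) powr (1 / p) \<le> N"
          unfolding N_def using p by (intro powr_mono2) auto
        then show ?thesis using p by (simp add: powr_powr)
      qed
      have mem: "z + c *s z \<in> pball (1/2) z" if "cmod c \<le> r" for c
      proof (rule near_imp_pball [OF _ _ z refl])
        have nz: "norm z \<le> 1" using z by simp
        have "norm (c *s z) \<le> r * 1" using that nz r by (simp only: norm_smult_vec) (intro mult_mono, auto)
        then have "(norm (c *s z))\<^sup>2 \<le> (defect z / 16)\<^sup>2" by (intro power_mono) (auto simp: r_def)
        also have "\<dots> \<le> defect z * 1 / 256" using A unfolding power2_eq_square
          by (simp add: mult_left_le)
        finally show "(norm (c *s z))\<^sup>2 \<le> (1 - 1/2) / 8 * defect z" using A by simp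
        have "cmod (herm (c *s z) z) \<le> norm (c *s z) * norm z" by (rule norm_herm_le)
        also have "\<dots> \<le> r * 1" using \<open>norm (c *s z) \<le> r * 1\<close> nz r by (intro mult_mono) auto
        finally show "cmod (herm (c *s z) z) \<le> (1 - 1/2) / 8 * defect z" by (simp add: r_def)
      qed auto
      define \<phi> where "\<phi> = (\<lambda>c. g (z + c *s z))"
      have hol: "\<phi> holomorphic_on cball 0 r"
        unfolding \<phi>_def using mem pball_subset_ball
        by (intro holomorphic_on_line [OF g]) (auto simp: subset_iff simp del: mem_ball)
      have "(\<phi> has_field_derivative radial_deriv g z) (at 0)"
        using has_field_derivative_line [OF g, of z 0 z] z
        by (simp add: \<phi>_def radial_deriv_def mult.commute)
      then have d: "deriv \<phi> 0 = radial_deriv g z" by (rule DERIV_imp_deriv)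
      have "norm ((deriv ^^ 1) \<phi> 0) \<le> fact 1 * N / r ^ 1"
      proof (rule Cauchy_inequality)
        show "\<phi> holomorphic_on ball 0 r" using hol by (rule holomorphic_on_subset) auto
        show "continuous_on (cball 0 r) \<phi>" using hol by (rule holomorphic_on_imp_continuous_on)
      qed (use r bd mem in \<open>auto simp: \<phi>_def\<close>)
      then have "cmod (radial_deriv g z) \<le> 16 * N / defect z" by (simp add: d r_def mult.commute)
      then have "defect z * cmod (radial_deriv g z) \<le> 16 * N"
        using A by (simp add: field_simps)
      then have "(defect z * cmod (radial_deriv g z)) powr p \<le> (16 * N) powr p"
        using A p by (intro powr_mono2) auto
      also have "\<dots> = 16 powr p * (C * s / defect z ^ (CARD('n) + 1))"
        using p C s A by (simp add: powr_mult N_def powr_powr)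
      finally have "(defect z * cmod (radial_deriv g z)) powr p * defect z ^ (CARD('n) + 1)
           \<le> 16 powr p * (C * s / defect z ^ (CARD('n) + 1)) * defect z ^ (CARD('n) + 1)"
        using A by (intro mult_right_mono) auto
      also have "\<dots> = 16 powr p * C * s" using A by simp
      finally show ?thesis
        unfolding S_def [symmetric] s(1) using C s by (simp add: ennreal_leI flip: ennreal_mult)
    qed
  qed
qed

definition weighted_energy :: "real \<Rightarrow> real \<Rightarrow> (complex ^ 'n::finite \<Rightarrow> complex) \<Rightarrow> ennreal" where
  "weighted_energy b p g = (\<integral>\<^sup>+z\<in>ball 0 1. ennreal (defect z powr b * cmod (g z) powr p) \<partial>lborel)"

lemma measurable_norm_powr:
  assumes "holomorphic_Cn g (ball 0 1)"
  shows "(\<lambda>w. ennreal (cmod (g w) powr p) * indicator (ball 0 1) w) \<in> borel_measurable borel"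
  by (rule borel_measurable_norm_powr_indicator [OF holomorphic_Cn_continuous_on [OF assms]]) auto

lemma measurable_energy_integrand:
  assumes "holomorphic_Cn g (ball 0 1)"
  shows "(\<lambda>w. ennreal (defect w powr s * cmod (g w) powr p) * indicator (ball 0 1) w) \<in> borel_measurable borel"
proof -
  note [measurable] = measurable_norm_powr [OF assms, of p]
  have "(\<lambda>w. ennreal (defect w powr s) * (ennreal (cmod (g w) powr p) * indicator (ball 0 1) w)) \<in> borel_measurable borel"
    by measurable
  then show ?thesis by (simp add: ennreal_mult mult.assoc)
qed

lemma indicator_pball_ball:
  "indicator (ball 0 1) w * indicator (pball \<delta> z) w = (indicator (pball \<delta> z) w :: ennreal)"
  "indicator (pball \<delta> z) w * indicator (ball 0 1) w = (indicator (pball \<delta> z) w :: ennreal)"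
  using pball_subset_ball [of \<delta> z] by (auto simp: indicator_def)

lemma measurable_local_mass:
  assumes "holomorphic_Cn h (ball 0 1)"
  shows "local_mass p \<delta> h \<in> borel_measurable borel"
  using measurable_local_integral [OF measurable_norm_powr [OF assms, of p], of \<delta>]
  by (simp only: mult.assoc indicator_pball_ball local_mass_def [abs_def])

lemma fubini_pball_energy:
  fixes b p \<delta> :: real
  assumes \<delta>: "0 < \<delta>"
  obtains C :: real where "0 < C"
    "\<And>g :: complex ^ 'n::finite \<Rightarrow> complex. holomorphic_Cn g (ball 0 1) \<Longrightarrow>
       (\<integral>\<^sup>+z\<in>ball 0 1. ennreal (defect z powr (b - real (CARD('n) + 1))) * local_mass p \<delta> g z \<partial>lborel)
       \<le> ennreal C * weighted_energy b p g"
proof -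
  obtain C where C: "0 < C" "\<And>F :: complex ^ 'n \<Rightarrow> ennreal. F \<in> borel_measurable borel \<Longrightarrow>
       (\<integral>\<^sup>+z\<in>ball 0 1. ennreal (defect z powr (b - real (CARD('n) + 1))) * (\<integral>\<^sup>+w\<in>pball \<delta> z. F w \<partial>lborel) \<partial>lborel)
       \<le> ennreal C * (\<integral>\<^sup>+w\<in>ball 0 1. ennreal (defect w powr ((b - real (CARD('n) + 1)) + real (CARD('n) + 1))) * F w \<partial>lborel)"
    using fubini_pball [OF \<delta>, where e="b - real (CARD('n) + 1)" and 'n='n] by blast
  show ?thesis
  proof (rule that [OF C(1)])
    fix g :: "complex ^ 'n \<Rightarrow> complex" assume g: "holomorphic_Cn g (ball 0 1)"
    have "local_mass p \<delta> g z = (\<integral>\<^sup>+w\<in>pball \<delta> z. ennreal (cmod (g w) powr p) * indicator (ball 0 1) w \<partial>lborel)" for z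
      by (simp only: local_mass_def mult.assoc indicator_pball_ball)
    moreover have "weighted_energy b p g = (\<integral>\<^sup>+w\<in>ball 0 1. ennreal (defect w powr ((b - real (CARD('n) + 1)) + real (CARD('n) + 1))) * (ennreal (cmod (g w) powr p) * indicator (ball 0 1) w) \<partial>lborel)"
      unfolding weighted_energy_def by (intro nn_integral_cong) (auto simp: indicator_def ennreal_mult)
    ultimately show "(\<integral>\<^sup>+z\<in>ball 0 1. ennreal (defect z powr (b - real (CARD('n) + 1))) * local_mass p \<delta> g z \<partial>lborel)
       \<le> ennreal C * weighted_energy b p g"
      using C(2) [OF measurable_norm_powr [OF g, of p]] by simp
  qed
qed

text \<open>
  The pointwise estimate integrated: differentiating costs one power of \<open>defect\<close>, whatever the weight.
\<close>

lemma energy_radial_deriv_le: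
  fixes b p :: real
  assumes p: "0 < p"
  obtains C :: real where "0 < C"
    "\<And>g :: complex ^ 'n::finite \<Rightarrow> complex. holomorphic_Cn g (ball 0 1) \<Longrightarrow>
       weighted_energy (b + p) p (radial_deriv g) \<le> ennreal C * weighted_energy b p g"
proof -
  obtain \<delta> C1 where \<delta>: "0 < \<delta>" and C1: "0 < C1" "\<And>(g :: complex ^ 'n \<Rightarrow> complex) z. holomorphic_Cn g (ball 0 1) \<Longrightarrow> z \<in> ball 0 1 \<Longrightarrow>
       ennreal ((defect z * cmod (radial_deriv g z)) powr p * defect z ^ (CARD('n) + 1))
         \<le> ennreal C1 * local_mass p \<delta> g z"
    using radial_deriv_pointwise [OF p, where 'n='n] by blast
  obtain C2 where C2: "0 < C2" "\<And>g :: complex ^ 'n \<Rightarrow> complex. holomorphic_Cn g (ball 0 1) \<Longrightarrow>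
       (\<integral>\<^sup>+z\<in>ball 0 1. ennreal (defect z powr (b - real (CARD('n) + 1))) * local_mass p \<delta> g z \<partial>lborel)
       \<le> ennreal C2 * weighted_energy b p g"
    using fubini_pball_energy [OF \<delta>, where b=b and p=p and 'n='n] by blast
  show ?thesis
  proof (rule that [of "C1 * C2"])
    show "0 < C1 * C2" using C1 C2 by simp
    fix g :: "complex ^ 'n \<Rightarrow> complex" assume g: "holomorphic_Cn g (ball 0 1)"
    define L where "L = local_mass p \<delta> g"
    have [measurable]: "L \<in> borel_measurable borel"
      unfolding L_def by (rule measurable_local_mass [OF g])
    have "weighted_energy (b + p) p (radial_deriv g)
       \<le> (\<integral>\<^sup>+z. ennreal C1 * (ennreal (defect z powr (b - real (CARD('n) + 1))) * L z * indicator (ball 0 1) z) \<partial>lborel)"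
      unfolding weighted_energy_def
    proof (rule nn_integral_mono)
      fix z :: "complex ^ 'n"
      show "ennreal (defect z powr (b + p) * cmod (radial_deriv g z) powr p) * indicator (ball 0 1) z
         \<le> ennreal C1 * (ennreal (defect z powr (b - real (CARD('n) + 1))) * L z * indicator (ball 0 1) z)"
      proof (cases "z \<in> ball 0 1")
        case True
        then have A: "0 < defect z" by (rule defect_pos)
        have "defect z powr (b + p) * cmod (radial_deriv g z) powr p
          = defect z powr (b - real (CARD('n) + 1)) * ((defect z * cmod (radial_deriv g z)) powr p * defect z ^ (CARD('n) + 1))"
          using A by (simp add: powr_add powr_diff powr_mult powr_realpow)
        then have "ennreal (defect z powr (b + p) * cmod (radial_deriv g z) powr p)
          = ennreal (defect z powr (b - real (CARD('n) + 1))) * ennreal ((defect z * cmod (radial_deriv g z)) powr p * defect z ^ (CARD('n) + 1))"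
          using A by (simp only: ennreal_mult' powr_ge_zero)
        also have "\<dots> \<le> ennreal (defect z powr (b - real (CARD('n) + 1))) * (ennreal C1 * L z)"
          unfolding L_def by (intro mult_left_mono C1(2) g True) auto
        finally show ?thesis using True by (simp add: mult_ac)
      qed simp
    qed
    also have "\<dots> = ennreal C1 * (\<integral>\<^sup>+z\<in>ball 0 1. ennreal (defect z powr (b - real (CARD('n) + 1))) * L z \<partial>lborel)"
      by (rule nn_integral_cmult) measurable
    also have "\<dots> \<le> ennreal C1 * (ennreal C2 * weighted_energy b p g)"
      unfolding L_def by (intro mult_left_mono C2(2) g) auto
    finally show "weighted_energy (b + p) p (radial_deriv g) \<le> ennreal (C1 * C2) * weighted_energy b p g"
      using C1 C2 by (simp add: ennreal_mult' mult.assoc)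
  qed
qed

text \<open>
  For \<open>1/4 \<le> u \<le> 1\<close> the number \<open>1 - (x/u)\<^sup>2\<close> is comparable to \<open>u - x\<close> up to the factor \<open>8\<close>, and the
  integral of \<open>(u - x)\<^sup>e\<close> from \<open>x\<close> to \<open>1\<close> converges for \<open>e > -1\<close>.
\<close>

lemma dilation_inner:
  fixes e x :: real
  assumes e: "-1 < e" and x: "0 \<le> x" "x < 1"
  shows "(\<integral>\<^sup>+u. ennreal ((1 - (x / u)\<^sup>2) powr e) * indicator {u. 1/4 \<le> u \<and> u \<le> 1 \<and> x < u} u \<partial>lborel)
     \<le> ennreal (8 powr \<bar>e\<bar> / (e + 1) * (1 - x\<^sup>2) powr (e + 1))"
proof -
  have "((\<lambda>u. u powr e) has_integral ((1 - x) powr (e + 1) / (e + 1))) {0..1 - x}"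
    using has_integral_powr_from_0 [OF e, of "1 - x"] x by simp
  from nn_integral_has_integral_lebesgue' [OF _ this]
  have "(\<integral>\<^sup>+v. ennreal (v powr e) * indicator {0..1 - x} v \<partial>lborel) = ennreal ((1 - x) powr (e + 1) / (e + 1))"
    by simp
  moreover have "(\<lambda>u. ennreal ((u - x) powr e) * indicator {x..1} u) \<in> borel_measurable borel"
    by measurable
  from nn_integral_lborel_shift [OF this, of x]
  have "(\<integral>\<^sup>+v. ennreal (v powr e) * indicator {0..1 - x} v \<partial>lborel) = (\<integral>\<^sup>+u. ennreal ((u - x) powr e) * indicator {x..1} u \<partial>lborel)"
    by (simp add: indicator_def algebra_simps)
  ultimately have I: "(\<integral>\<^sup>+u. ennreal ((u - x) powr e) * indicator {x..1} u \<partial>lborel) = ennreal ((1 - x) powr (e + 1) / (e + 1))"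
    by simp
  have "(\<integral>\<^sup>+u. ennreal ((1 - (x / u)\<^sup>2) powr e) * indicator {u. 1/4 \<le> u \<and> u \<le> 1 \<and> x < u} u \<partial>lborel)
     \<le> (\<integral>\<^sup>+u. ennreal (8 powr \<bar>e\<bar>) * (ennreal ((u - x) powr e) * indicator {x..1} u) \<partial>lborel)"
  proof (rule nn_integral_mono)
    fix u :: real
    show "ennreal ((1 - (x / u)\<^sup>2) powr e) * indicator {u. 1/4 \<le> u \<and> u \<le> 1 \<and> x < u} u
      \<le> ennreal (8 powr \<bar>e\<bar>) * (ennreal ((u - x) powr e) * indicator {x..1} u)"
    proof (cases "1/4 \<le> u \<and> u \<le> 1 \<and> x < u")
      case True
      define y where "y = x / u"
      have y: "0 \<le> y" "y < 1" "x = y * u" using True x by (auto simp: y_def)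
      have 1: "u - x = u * (1 - y)" using y by (simp add: algebra_simps)
      have 2: "1 - y\<^sup>2 = (1 - y) * (1 + y)" by (simp add: power2_eq_square algebra_simps)
      have "(1 - y) * (1 + y) \<le> (1 - y) * (8 * u)" using y True by (intro mult_left_mono) auto
      moreover have "(1 - y) * u \<le> (1 - y) * (8 * (1 + y))" using y True by (intro mult_left_mono) auto
      moreover have "0 < (1 - y) * (1 + y)" "0 < (1 - y) * u" using y True by auto
      ultimately have "(1 - y\<^sup>2) powr e \<le> 8 powr \<bar>e\<bar> * (u - x) powr e"
        unfolding 1 2 by (intro powr_compare) (auto simp: mult_ac)
      then show ?thesis using True x unfolding y_def
        by (simp add: ennreal_leI flip: ennreal_mult)
    qed simp
  qed
  also have "\<dots> = ennreal (8 powr \<bar>e\<bar>) * ennreal ((1 - x) powr (e + 1) / (e + 1))"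
    unfolding I [symmetric] by (rule nn_integral_cmult) measurable
  also have "\<dots> = ennreal (8 powr \<bar>e\<bar> / (e + 1) * (1 - x) powr (e + 1))"
    using e by (subst ennreal_mult [symmetric]) auto
  also have "\<dots> \<le> ennreal (8 powr \<bar>e\<bar> / (e + 1) * (1 - x\<^sup>2) powr (e + 1))"
    using e x by (intro ennreal_leI mult_left_mono powr_mono2) (auto simp: power2_eq_square mult_left_le)
  finally show ?thesis .
qed

text \<open>
  This does the work of polar coordinates. For fixed \<open>u\<close> one substitutes \<open>w = u z\<close>; the power of \<open>u\<close>
  that arises is harmless since \<open>u\<close> stays away from zero. Then the integral over \<open>u\<close> is carried out for fixed
  \<open>w\<close> and gains one power of \<open>defect w\<close>.
\<close>

lemma dilation_fubini:
  fixes e :: real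
  assumes e: "-1 < e"
  obtains C :: real where "0 < C"
    "\<And>F :: complex ^ 'n::finite \<Rightarrow> ennreal. F \<in> borel_measurable borel \<Longrightarrow>
       (\<integral>\<^sup>+z\<in>ball 0 1. ennreal (defect z powr e) * (\<integral>\<^sup>+u\<in>{1/4..1}. F (u *\<^sub>R z) \<partial>lborel) \<partial>lborel)
       \<le> ennreal C * (\<integral>\<^sup>+w\<in>ball 0 1. ennreal (defect w powr (e + 1)) * F w \<partial>lborel)"
proof -
  define D where "D = DIM(complex ^ 'n)"
  define K where "K = 8 powr \<bar>e\<bar> / (e + 1)"
  have K: "0 < K" using e by (simp add: K_def)
  show ?thesis
  proof (rule that [of "4 ^ D * K"])
    show "0 < 4 ^ D * K" using K by simp
    fix F :: "complex ^ 'n \<Rightarrow> ennreal" assume F [measurable]: "F \<in> borel_measurable borel"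
    define E where "E = (\<lambda>z::complex ^ 'n. ennreal (defect z powr e) * indicator (ball 0 1) z)"
    have E [measurable]: "E \<in> borel_measurable borel" unfolding E_def by measurable
    have sc: "(\<integral>\<^sup>+z. E z * F (u *\<^sub>R z) \<partial>lborel) \<le> ennreal (4 ^ D) * (\<integral>\<^sup>+w. E ((1 / u) *\<^sub>R w) * F w \<partial>lborel)"
      if u: "1/4 \<le> u" for u :: real
    proof -
      have "(\<integral>\<^sup>+w. E ((1 / u) *\<^sub>R w) * F w \<partial>lborel) = ennreal (u ^ D) * (\<integral>\<^sup>+z. E ((1 / u) *\<^sub>R (u *\<^sub>R z)) * F (u *\<^sub>R z) \<partial>lborel)"
        unfolding D_def using u by (intro nn_integral_lborel_scale) auto
      also have "\<dots> = ennreal (u ^ D) * (\<integral>\<^sup>+z. E z * F (u *\<^sub>R z) \<partial>lborel)" using u by simp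
      finally have eq: "ennreal (4 ^ D) * (\<integral>\<^sup>+w. E ((1 / u) *\<^sub>R w) * F w \<partial>lborel) = ennreal (4 ^ D * u ^ D) * (\<integral>\<^sup>+z. E z * F (u *\<^sub>R z) \<partial>lborel)"
        using u by (simp add: ennreal_mult' mult.assoc)
      have "1 \<le> (4 * u) ^ D" using u by (intro one_le_power) simp
      then have "ennreal 1 \<le> ennreal (4 ^ D * u ^ D)" by (intro ennreal_leI) (simp add: power_mult_distrib)
      then show ?thesis unfolding eq using mult_right_mono [of 1 "ennreal (4 ^ D * u ^ D)"] by simp
    qed
    have "(\<integral>\<^sup>+z\<in>ball 0 1. ennreal (defect z powr e) * (\<integral>\<^sup>+u\<in>{1/4..1}. F (u *\<^sub>R z) \<partial>lborel) \<partial>lborel)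
       = (\<integral>\<^sup>+z. E z * (\<integral>\<^sup>+u\<in>{1/4..1}. F (u *\<^sub>R z) \<partial>lborel) \<partial>lborel)"
      by (simp only: E_def mult_ac)
    also have "\<dots> = (\<integral>\<^sup>+z. (\<integral>\<^sup>+u. E z * (F (u *\<^sub>R z) * indicator {1/4..1} u) \<partial>lborel) \<partial>lborel)"
      by (intro nn_integral_cong nn_integral_cmult [symmetric]) measurable
    also have "\<dots> = (\<integral>\<^sup>+u. (\<integral>\<^sup>+z. E z * (F (u *\<^sub>R z) * indicator {1/4..1} u) \<partial>lborel) \<partial>lborel)"
      by (rule lborel_pair.Fubini') measurable
    also have "\<dots> \<le> (\<integral>\<^sup>+u. (\<integral>\<^sup>+w. ennreal (4 ^ D) * (F w * (E ((1 / u) *\<^sub>R w) * indicator {1/4..1} u)) \<partial>lborel) \<partial>lborel)"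
    proof (rule nn_integral_mono)
      fix u :: real
      show "(\<integral>\<^sup>+z. E z * (F (u *\<^sub>R z) * indicator {1/4..1} u) \<partial>lborel) \<le> (\<integral>\<^sup>+w. ennreal (4 ^ D) * (F w * (E ((1 / u) *\<^sub>R w) * indicator {1/4..1} u)) \<partial>lborel)"
      proof (cases "u \<in> {1/4..1}")
        case True
        have "(\<integral>\<^sup>+w. ennreal (4 ^ D) * (F w * (E ((1 / u) *\<^sub>R w) * indicator {1/4..1} u)) \<partial>lborel)
           = ennreal (4 ^ D) * (\<integral>\<^sup>+w. E ((1 / u) *\<^sub>R w) * F w \<partial>lborel)"
          using True by (subst nn_integral_cmult [symmetric]) (auto simp: mult_ac)
        then show ?thesis using True sc [of u] by simp
      qed simp
    qed
    also have "\<dots> = (\<integral>\<^sup>+w. (\<integral>\<^sup>+u. ennreal (4 ^ D) * (F w * (E ((1 / u) *\<^sub>R w) * indicator {1/4..1} u)) \<partial>lborel) \<partial>lborel)"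
      by (rule lborel_pair.Fubini') measurable
    also have "\<dots> \<le> (\<integral>\<^sup>+w. ennreal (4 ^ D * K) * (ennreal (defect w powr (e + 1)) * F w * indicator (ball 0 1) w) \<partial>lborel)"
    proof (rule nn_integral_mono)
      fix w :: "complex ^ 'n"
      define x where "x = norm w"
      have x0: "0 \<le> x" by (simp add: x_def)
      have inn: "E ((1 / u) *\<^sub>R w) * indicator {1/4..1} u = ennreal ((1 - (x / u)\<^sup>2) powr e) * indicator {u. 1/4 \<le> u \<and> u \<le> 1 \<and> x < u} u" for u
        by (auto simp: E_def defect_def x_def indicator_def field_simps)
      have "(\<integral>\<^sup>+u. ennreal (4 ^ D) * (F w * (E ((1 / u) *\<^sub>R w) * indicator {1/4..1} u)) \<partial>lborel)
         = ennreal (4 ^ D) * (F w * (\<integral>\<^sup>+u. E ((1 / u) *\<^sub>R w) * indicator {1/4..1} u \<partial>lborel))"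
        by (subst nn_integral_cmult; (subst nn_integral_cmult)?; measurable)
      also have "(\<integral>\<^sup>+u. E ((1 / u) *\<^sub>R w) * indicator {1/4..1} u \<partial>lborel) \<le> ennreal (K * defect w powr (e + 1)) * indicator (ball 0 1) w"
      proof (cases "x < 1")
        case True
        then show ?thesis unfolding inn using dilation_inner [OF e x0 True] by (simp add: K_def defect_def x_def)
      next
        case False
        then have "{u. 1/4 \<le> u \<and> u \<le> 1 \<and> x < u} = {}" by auto
        then show ?thesis unfolding inn by simp
      qed
      finally have "(\<integral>\<^sup>+u. ennreal (4 ^ D) * (F w * (E ((1 / u) *\<^sub>R w) * indicator {1/4..1} u)) \<partial>lborel)
         \<le> ennreal (4 ^ D) * (F w * (ennreal (K * defect w powr (e + 1)) * indicator (ball 0 1) w))"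
        by (simp add: mult_left_mono)
      also have "\<dots> = ennreal (4 ^ D * K) * (ennreal (defect w powr (e + 1)) * F w * indicator (ball 0 1) w)"
        using K by (simp add: ennreal_mult' mult_ac)
      finally show "(\<integral>\<^sup>+u. ennreal (4 ^ D) * (F w * (E ((1 / u) *\<^sub>R w) * indicator {1/4..1} u)) \<partial>lborel)
         \<le> ennreal (4 ^ D * K) * (ennreal (defect w powr (e + 1)) * F w * indicator (ball 0 1) w)" .
    qed
    also have "\<dots> = ennreal (4 ^ D * K) * (\<integral>\<^sup>+w\<in>ball 0 1. ennreal (defect w powr (e + 1)) * F w \<partial>lborel)"
      by (rule nn_integral_cmult) measurable
    finally show "(\<integral>\<^sup>+z\<in>ball 0 1. ennreal (defect z powr e) * (\<integral>\<^sup>+u\<in>{1/4..1}. F (u *\<^sub>R z) \<partial>lborel) \<partial>lborel)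
       \<le> ennreal (4 ^ D * K) * (\<integral>\<^sup>+w\<in>ball 0 1. ennreal (defect w powr (e + 1)) * F w \<partial>lborel)" .
  qed
qed

text \<open>
  With \<open>F = 1\<close> the dilation inequality bounds the integral of \<open>defect\<^bsup>e\<^esup>\<close> by that of
  \<open>defect\<^bsup>e + 1\<^esup>\<close>, whose integrand is bounded.
\<close>

lemma weight_integrable:
  assumes e: "-1 < e"
  shows "(\<integral>\<^sup>+z\<in>ball (0 :: complex ^ 'n::finite) 1. ennreal (defect z powr e) \<partial>lborel) < \<infinity>"
proof -
  obtain C where C: "\<And>F :: complex ^ 'n::finite \<Rightarrow> ennreal. F \<in> borel_measurable borel \<Longrightarrow>
       (\<integral>\<^sup>+z\<in>ball 0 1. ennreal (defect z powr e) * (\<integral>\<^sup>+u\<in>{1/4..1}. F (u *\<^sub>R z) \<partial>lborel) \<partial>lborel)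
       \<le> ennreal C * (\<integral>\<^sup>+w\<in>ball 0 1. ennreal (defect w powr (e + 1)) * F w \<partial>lborel)"
    using dilation_fubini [OF e, where 'n='n] by blast
  have len: "(\<integral>\<^sup>+u\<in>{1/4..1}. 1 \<partial>(lborel :: real measure)) = ennreal (3/4)" by simp
  have "ennreal (3/4) * (\<integral>\<^sup>+z\<in>ball (0 :: complex ^ 'n) 1. ennreal (defect z powr e) \<partial>lborel)
     = (\<integral>\<^sup>+z\<in>ball (0 :: complex ^ 'n) 1. ennreal (defect z powr e) * (\<integral>\<^sup>+u\<in>{1/4..1}. 1 \<partial>(lborel :: real measure)) \<partial>lborel)"
    unfolding len by (subst nn_integral_cmult [symmetric]) (measurable, simp only: mult_ac)
  also have "\<dots> \<le> ennreal C * (\<integral>\<^sup>+w\<in>ball (0 :: complex ^ 'n) 1. ennreal (defect w powr (e + 1)) * 1 \<partial>lborel)"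
    by (rule C) simp
  also have "\<dots> \<le> ennreal C * (\<integral>\<^sup>+w. indicator (ball (0 :: complex ^ 'n) 1) w \<partial>lborel)"
  proof (intro mult_left_mono nn_integral_mono)
    fix w :: "complex ^ 'n"
    show "ennreal (defect w powr (e + 1)) * 1 * indicator (ball 0 1) w \<le> indicator (ball 0 1) w"
    proof (cases "w \<in> ball 0 1")
      case True
      then have "defect w powr (e + 1) \<le> 1 powr (e + 1)"
        using e defect_pos [OF True] defect_le_1 [of w] by (intro powr_mono2) auto
      then show ?thesis using True by simp
    qed simp
  qed simp
  also have "\<dots> = ennreal C * emeasure lborel (ball (0 :: complex ^ 'n) 1)" by simp
  also have "\<dots> < \<infinity>" using emeasure_lborel_unit_ball(2) [where 'a="complex ^ 'n" and r=1]
    by (simp add: ennreal_mult_less_top)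
  finally show ?thesis by (auto simp: ennreal_mult_less_top)
qed


section \<open>The Hardy inequality for the radial derivative\<close>

text \<open>
  The local masses of \<open>h\<close> integrated along the ray through \<open>z\<close>. The weight is such that a piece of the ray of
  length \<open>defect w\<close> around \<open>w\<close> contributes \<open>defect w powr a\<close> times the local mean of \<open>|h|\<^sup>p\<close>; the
  exponent corrects for the length of the piece and the volume of the Bergman ball.
\<close>

definition ray_mass :: "real \<Rightarrow> real \<Rightarrow> real \<Rightarrow> (complex ^ 'n::finite \<Rightarrow> complex) \<Rightarrow> complex ^ 'n \<Rightarrow> ennreal" where
  "ray_mass p \<delta> a h z =
     (\<integral>\<^sup>+u\<in>{1/4..1}. ennreal (defect (u *\<^sub>R z) powr (a - 1 - real (CARD('n) + 1))) * local_mass p \<delta> h (u *\<^sub>R z) \<partial>lborel)"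

lemma defect_scaleR: "defect (u *\<^sub>R z) = 1 - (u * norm z)\<^sup>2"
  by (simp add: defect_def power_mult_distrib)

text \<open>
  Going inwards from \<open>t z\<close> by a quarter of its distance to the sphere does not leave a fixed Bergman ball.
\<close>

lemma ray_pball:
  fixes z :: "complex ^ 'n::finite"
  assumes z: "z \<in> ball 0 1" and t: "0 \<le> t" "t \<le> 1"
    and u: "t - (1 - t * norm z) / 4 \<le> u" "0 \<le> u" "u \<le> t"
  shows "t *\<^sub>R z \<in> pball (1/16) (u *\<^sub>R z)"
proof -
  define x where "x = norm z"
  have x: "0 \<le> x" "x < 1" using z by (auto simp: x_def)
  define A B where "A = 1 - t * x" and "B = 1 - u * x"
  have tx: "t * x \<le> x" using x t by (simp add: mult_left_le_one_le)
  then have A: "0 < A" using x by (simp add: A_def)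
  have ut: "u * x \<le> t * x" using u x by (intro mult_right_mono) auto
  then have AB: "A \<le> B" by (simp add: A_def B_def)
  have "4 * (t - u) \<le> A" using u(1) by (simp add: A_def x_def field_simps)
  then have "4 * (t - u) * x \<le> A * 1" using x A u by (intro mult_mono) auto
  then have B: "4 * B \<le> 5 * A" by (simp add: A_def B_def algebra_simps)
  have tz: "t *\<^sub>R z \<in> ball 0 1" using x t tx by (simp add: x_def [symmetric])
  have "herm (u *\<^sub>R z) (t *\<^sub>R z) = of_real (u * x * (t * x))"
    by (simp add: of_real_smult_vec [symmetric] herm_simps herm_self x_def power2_eq_square)
  then have "1 - herm (u *\<^sub>R z) (t *\<^sub>R z) = of_real (1 - u * x * (t * x))" by simp
  then have "cmod (1 - herm (u *\<^sub>R z) (t *\<^sub>R z)) = \<bar>1 - u * x * (t * x)\<bar>" by (simp only: norm_of_real)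
  also have "1 - u * x * (t * x) = A + B - A * B" by (simp add: A_def B_def algebra_simps)
  also have "\<bar>A + B - A * B\<bar> \<le> A + B"
  proof -
    have "B \<le> 1" using u x by (simp add: B_def)
    then have "A * B \<le> A" using A by (simp add: mult_left_le)
    moreover have "0 \<le> A * B" using A AB by simp
    ultimately show ?thesis using A AB by linarith
  qed
  finally have n: "4 * cmod (1 - herm (u *\<^sub>R z) (t *\<^sub>R z)) \<le> 9 * A" using B by linarith
  have "(4 * cmod (1 - herm (u *\<^sub>R z) (t *\<^sub>R z)))\<^sup>2 \<le> (9 * A)\<^sup>2" using n by (intro power_mono) auto
  then have "1/16 * (cmod (1 - herm (u *\<^sub>R z) (t *\<^sub>R z)))\<^sup>2 \<le> 81/256 * (A * A)"
    by (simp add: power_mult_distrib power2_eq_square)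
  also have "\<dots> < A * A" using A by simp
  also have "\<dots> \<le> A * B" using A AB by (intro mult_left_mono) auto
  also have "\<dots> \<le> defect (t *\<^sub>R z) * defect (u *\<^sub>R z)"
  proof (intro mult_mono)
    have sq: "y\<^sup>2 \<le> y" if "0 \<le> y" "y \<le> 1" for y :: real using that by (simp add: power2_eq_square mult_left_le)
    show "A \<le> defect (t *\<^sub>R z)" using sq [of "t * x"] x t tx by (simp add: A_def defect_scaleR x_def)
    show "B \<le> defect (u *\<^sub>R z)" using sq [of "u * x"] x u tx ut by (simp add: B_def defect_scaleR x_def)
    then show "0 \<le> B" "0 \<le> defect (t *\<^sub>R z)" using A AB defect_pos [OF tz] by auto
  qed
  finally show ?thesis using tz by (simp add: pball_def mult.commute)
qed

text \<open>
  The piece of the ray in \<open>ray_pball\<close> alone contributes enough to the ray mass. Its lower end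
  \<open>s\<close> is at least \<open>1/4\<close> because \<open>t \<ge> 1/2\<close>.
\<close>

lemma ray_mass_lower:
  fixes p a :: real
  assumes p: "0 < p"
  obtains \<delta> C :: real where "0 < \<delta>" "0 < C"
    "\<And>(h :: complex ^ 'n::finite \<Rightarrow> complex) z t. holomorphic_Cn h (ball 0 1) \<Longrightarrow> z \<in> ball 0 1 \<Longrightarrow> 1/2 \<le> t \<Longrightarrow> t \<le> 1 \<Longrightarrow>
       ennreal (cmod (h (t *\<^sub>R z)) powr p * defect (t *\<^sub>R z) powr a) \<le> ennreal C * ray_mass p \<delta> a h z"
proof -
  obtain \<delta> C where \<delta>: "0 < \<delta>" and C: "0 < C" and LS: "\<And>(g :: complex ^ 'n \<Rightarrow> complex) z w. holomorphic_Cn g (ball 0 1) \<Longrightarrow> z \<in> ball 0 1 \<Longrightarrow> w \<in> pball (1/16) z \<Longrightarrow>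
       ennreal (cmod (g w) powr p * defect z ^ (CARD('n) + 1)) \<le> ennreal C * local_mass p \<delta> g z"
    using local_sup [OF p, of "1/16", where 'n='n] by auto
  define K where "K = 64 powr \<bar>a - 1\<bar>"
  have K: "0 < K" by (simp add: K_def)
  show ?thesis
  proof (rule that [OF \<delta>, of "8 * (K * C)"])
    show "0 < 8 * (K * C)" using K C by simp
    fix h :: "complex ^ 'n \<Rightarrow> complex" and z :: "complex ^ 'n" and t :: real
    assume h: "holomorphic_Cn h (ball 0 1)" and z: "z \<in> ball 0 1" and t: "1/2 \<le> t" "t \<le> 1"
    note [measurable] = measurable_local_mass [OF h, of p \<delta>]
    define \<Phi> where "\<Phi> = (\<lambda>u. ennreal (defect (u *\<^sub>R z) powr (a - 1 - real (CARD('n) + 1))) * local_mass p \<delta> h (u *\<^sub>R z))"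
    have \<Phi>: "\<Phi> \<in> borel_measurable borel" unfolding \<Phi>_def by measurable
    define x where "x = norm z"
    have x: "0 \<le> x" "x < 1" using z by (auto simp: x_def)
    define w where "w = t *\<^sub>R z"
    have tx: "t * x \<le> x" using x t by (simp add: mult_left_le_one_le)
    have wb: "w \<in> ball 0 1" using tx x t by (simp add: w_def x_def [symmetric])
    have A: "0 < defect w" using wb by (rule defect_pos)
    define s where "s = t - (1 - t * x) / 4"
    have s4: "4 * s = 4 * t - (1 - t * x)" by (simp add: s_def field_simps)
    have s: "1/4 \<le> s" "s \<le> t" using s4 t x tx mult_nonneg_nonneg [of t x] by linarith+
    define X where "X = cmod (h w) powr p * defect w powr (a - 1)"
    have X: "0 \<le> X" by (simp add: X_def)
    have pt: "ennreal X \<le> ennreal (K * C) * \<Phi> u" if u: "s \<le> u" "u \<le> t" for u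
    proof -
      have u0: "0 \<le> u" "u \<le> 1" using u s t by auto
      have mem: "w \<in> pball (1/16) (u *\<^sub>R z)"
        unfolding w_def using u u0 t by (intro ray_pball z) (auto simp: s_def x_def)
      have ub: "u *\<^sub>R z \<in> ball 0 1" using x u0 mult_left_le_one_le [of x u] by (simp add: x_def [symmetric])
      have B: "0 < defect (u *\<^sub>R z)" using ub by (rule defect_pos)
      have "defect w powr (a - 1) \<le> K * defect (u *\<^sub>R z) powr (a - 1)"
        using pball_powr_compare(2) [OF ub mem, of "a - 1"] by (simp add: K_def)
      then have "X \<le> cmod (h w) powr p * (K * defect (u *\<^sub>R z) powr (a - 1))"
        unfolding X_def by (intro mult_left_mono) auto
      also have "\<dots> = K * (defect (u *\<^sub>R z) powr (a - 1 - real (CARD('n) + 1)) * (cmod (h w) powr p * defect (u *\<^sub>R z) ^ (CARD('n) + 1)))"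
      proof -
        have "defect (u *\<^sub>R z) powr (a - 1) = defect (u *\<^sub>R z) powr (a - 1 - real (CARD('n) + 1)) * defect (u *\<^sub>R z) ^ (CARD('n) + 1)"
          using B by (simp only: powr_realpow [symmetric] powr_add [symmetric]) simp
        then show ?thesis by (simp only: mult_ac)
      qed
      finally have "ennreal X \<le> ennreal (K * (defect (u *\<^sub>R z) powr (a - 1 - real (CARD('n) + 1)) * (cmod (h w) powr p * defect (u *\<^sub>R z) ^ (CARD('n) + 1))))"
        by (rule ennreal_leI)
      also have "\<dots> = ennreal K * (ennreal (defect (u *\<^sub>R z) powr (a - 1 - real (CARD('n) + 1))) * ennreal (cmod (h w) powr p * defect (u *\<^sub>R z) ^ (CARD('n) + 1)))"
        using K B by (simp only: ennreal_mult' less_imp_le powr_ge_zero)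
      also have "\<dots> \<le> ennreal K * (ennreal (defect (u *\<^sub>R z) powr (a - 1 - real (CARD('n) + 1))) * (ennreal C * local_mass p \<delta> h (u *\<^sub>R z)))"
        by (intro mult_left_mono LS h ub mem) auto
      also have "\<dots> = ennreal (K * C) * \<Phi> u" using K C by (simp add: \<Phi>_def ennreal_mult' mult_ac)
      finally show ?thesis .
    qed
    have len: "cmod (h w) powr p * defect w powr a \<le> 8 * (X * (t - s))"
    proof -
      have "defect w = (1 - t * x) * (1 + t * x)" by (simp add: w_def defect_scaleR x_def power2_eq_square algebra_simps)
      also have "\<dots> \<le> (1 - t * x) * 2" using tx x t by (intro mult_left_mono) auto
      also have "\<dots> = 8 * (t - s)" using s4 by (simp add: algebra_simps)
      finally have "X * defect w \<le> X * (8 * (t - s))" using X by (intro mult_left_mono)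
      moreover have "defect w powr a = defect w powr (a - 1) * defect w"
        using A by (simp add: powr_diff)
      ultimately have "cmod (h w) powr p * defect w powr a \<le> X * (8 * (t - s))"
        by (simp only: X_def mult.assoc)
      also have "\<dots> = 8 * (X * (t - s))" by (rule mult.left_commute)
      finally show ?thesis .
    qed
    have "ennreal (cmod (h w) powr p * defect w powr a) \<le> ennreal (8 * (X * (t - s)))"
      by (rule ennreal_leI [OF len])
    also have "\<dots> = ennreal 8 * (ennreal X * emeasure lborel {s..t})"
      using X s by (simp add: ennreal_mult' mult.commute)
    also have "ennreal X * emeasure lborel {s..t} = (\<integral>\<^sup>+u. ennreal X * indicator {s..t} u \<partial>lborel)"
      by (rule nn_integral_cmult_indicator [symmetric]) simp
    also have "\<dots> \<le> (\<integral>\<^sup>+u. ennreal (K * C) * (\<Phi> u * indicator {1/4..1} u) \<partial>lborel)"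
    proof (rule nn_integral_mono)
      fix u
      show "ennreal X * indicator {s..t} u \<le> ennreal (K * C) * (\<Phi> u * indicator {1/4..1} u)"
        using pt [of u] s t by (auto simp: indicator_def)
    qed
    also have "\<dots> = ennreal (K * C) * ray_mass p \<delta> a h z"
      unfolding ray_mass_def using \<Phi> by (subst nn_integral_cmult) (auto simp: \<Phi>_def)
    finally have "ennreal (cmod (h w) powr p * defect w powr a) \<le> ennreal 8 * (ennreal (K * C) * ray_mass p \<delta> a h z)"
      by (simp add: mult_left_mono)
    also have "\<dots> = ennreal (8 * (K * C)) * ray_mass p \<delta> a h z"
      using K C by (subst ennreal_mult' [of 8]) (auto simp: mult.assoc)
    finally show "ennreal (cmod (h (t *\<^sub>R z)) powr p * defect (t *\<^sub>R z) powr a) \<le> ennreal (8 * (K * C)) * ray_mass p \<delta> a h z"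
      by (simp only: w_def)
  qed
qed

lemma has_vector_derivative_ray:
  assumes g: "holomorphic_Cn g S" and S: "t *\<^sub>R z \<in> S" and t: "t \<noteq> 0"
  shows "((\<lambda>t. g (t *\<^sub>R z)) has_vector_derivative (radial_deriv g (t *\<^sub>R z) / of_real t)) (at t)"
proof -
  define D where "D = (\<Sum>j\<in>UNIV. partial_deriv j g (of_real t *s z) * z $ j)"
  have S': "complex_of_real t *s z \<in> S" using S by (simp add: of_real_smult_vec)
  have "((\<lambda>c. g (c *s z)) has_field_derivative D) (at (of_real t))"
    unfolding D_def by (rule has_field_derivative_ray(1) [OF g S'])
  then have "((\<lambda>t. g (of_real t *s z)) has_vector_derivative D) (at t)"
    by (rule has_vector_derivative_real_field [unfolded o_def])
  moreover have "of_real t * D = radial_deriv g (of_real t *s z)"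
    unfolding D_def by (rule has_field_derivative_ray(2) [OF g S'])
  then have "D = radial_deriv g (t *\<^sub>R z) / of_real t" using t by (simp add: of_real_smult_vec field_simps)
  ultimately show ?thesis by (simp add: of_real_smult_vec)
qed

text \<open>
  Let \<open>J\<close> be the ray mass of the radial derivative with exponent \<open>p + b\<close>. It bounds \<open>|R g (t z)|\<close>
  by \<open>J\<^bsup>1/p\<^esup> defect (t z) powr - (1 + b/p)\<close> up to a constant, and integrating this majorant over \<open>t\<close>
  gives \<open>J\<^bsup>1/p\<^esup> defect z powr - (b/p)\<close>. Here \<open>b > 0\<close> is essential: for \<open>b = 0\<close> a logarithm would
  appear.
\<close>

lemma hardy_pointwise:
  fixes p b :: real
  assumes p: "0 < p" and b: "0 < b"
  obtains \<delta> C :: real where "0 < \<delta>" "0 < C"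
    "\<And>(g :: complex ^ 'n::finite \<Rightarrow> complex) z. holomorphic_Cn g (ball 0 1) \<Longrightarrow> z \<in> ball 0 1 \<Longrightarrow>
       ennreal (cmod (g z - g ((1/2) *\<^sub>R z)) powr p * defect z powr b) \<le> ennreal C * ray_mass p \<delta> (p + b) (radial_deriv g) z"
proof -
  obtain \<delta> C where \<delta>: "0 < \<delta>" and C: "0 < C" and RM:
    "\<And>(h :: complex ^ 'n \<Rightarrow> complex) z t. holomorphic_Cn h (ball 0 1) \<Longrightarrow> z \<in> ball 0 1 \<Longrightarrow> 1/2 \<le> t \<Longrightarrow> t \<le> 1 \<Longrightarrow>
       ennreal (cmod (h (t *\<^sub>R z)) powr p * defect (t *\<^sub>R z) powr (p + b)) \<le> ennreal C * ray_mass p \<delta> (p + b) h z"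
    using ray_mass_lower [OF p, of "p + b", where 'n='n] by blast
  define \<epsilon> where "\<epsilon> = b / p"
  have \<epsilon>: "0 < \<epsilon>" using p b by (simp add: \<epsilon>_def)
  define L where "L = 2 * 2 powr (1 + \<epsilon>) / \<epsilon> * 2 powr \<epsilon>"
  have L: "0 < L" using \<epsilon> by (simp add: L_def)
  show ?thesis
  proof (rule that [OF \<delta>, of "L powr p * C"])
    show "0 < L powr p * C" using L C by simp
    fix g :: "complex ^ 'n \<Rightarrow> complex" and z :: "complex ^ 'n"
    assume g: "holomorphic_Cn g (ball 0 1)" and z: "z \<in> ball 0 1"
    have Rg: "holomorphic_Cn (radial_deriv g) (ball 0 1)" using g by (rule holomorphic_radial_deriv) simp
    have A: "0 < defect z" using z by (rule defect_pos)
    define J where "J = ray_mass p \<delta> (p + b) (radial_deriv g) z"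
    show "ennreal (cmod (g z - g ((1/2) *\<^sub>R z)) powr p * defect z powr b) \<le> ennreal (L powr p * C) * ray_mass p \<delta> (p + b) (radial_deriv g) z"
    proof (cases "J = \<infinity>")
      case True
      then show ?thesis using L C by (simp add: J_def [symmetric] ennreal_mult_eq_top_iff)
    next
      case False
      define j where "j = enn2real J"
      have j: "J = ennreal j" "0 \<le> j" using False by (auto simp: j_def less_top)
      define N where "N = (C * j) powr (1 / p)"
      have N: "0 \<le> N" by (simp add: N_def)
      define x where "x = norm z"
      have x: "0 \<le> x" "x < 1" using z by (auto simp: x_def)
      \<comment> \<open>Half of \<open>y t\<close> is a lower bound for \<open>1 - t x\<close> whose slope in \<open>t\<close> is bounded away from zero even if
        \<open>x\<close> is small, so that its powers can be integrated uniformly in \<open>x\<close>.\<close>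
      define y where "y = (\<lambda>t::real. (1 - t) + (1 - x))"
      have y: "0 < y t" if "t \<le> 1" for t using that x by (simp add: y_def)
      have tz: "t *\<^sub>R z \<in> ball 0 1" if "1/2 \<le> t" "t \<le> 1" for t
        using x that mult_left_le_one_le [of x t] by (simp add: x_def [symmetric])
      have bd: "cmod (radial_deriv g (t *\<^sub>R z)) \<le> N * (2 powr (1 + \<epsilon>) * y t powr (- (1 + \<epsilon>)))" if t: "1/2 \<le> t" "t \<le> 1" for t
      proof -
        have B: "0 < defect (t *\<^sub>R z)" using tz [OF t] by (rule defect_pos)
        have "ennreal (cmod (radial_deriv g (t *\<^sub>R z)) powr p * defect (t *\<^sub>R z) powr (p + b)) \<le> ennreal (C * j)"
          using RM [OF Rg z t] C j by (simp add: J_def [symmetric] ennreal_mult)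
        then have "cmod (radial_deriv g (t *\<^sub>R z)) powr p * defect (t *\<^sub>R z) powr (p + b) \<le> C * j"
          using C j by (subst (asm) ennreal_le_iff) auto
        then have "(cmod (radial_deriv g (t *\<^sub>R z)) powr p * defect (t *\<^sub>R z) powr (p + b)) powr (1 / p) \<le> N"
          unfolding N_def using p by (intro powr_mono2) auto
        also have "(cmod (radial_deriv g (t *\<^sub>R z)) powr p * defect (t *\<^sub>R z) powr (p + b)) powr (1 / p)
          = cmod (radial_deriv g (t *\<^sub>R z)) * defect (t *\<^sub>R z) powr (1 + \<epsilon>)"
        proof -
          have "(p + b) * (1 / p) = 1 + \<epsilon>" using p by (simp add: \<epsilon>_def field_simps)
          moreover have "p * (1 / p) = 1" using p by simp
          ultimately show ?thesis by (simp add: powr_mult powr_powr del: times_divide_eq_right)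
        qed
        finally have "cmod (radial_deriv g (t *\<^sub>R z)) \<le> N / defect (t *\<^sub>R z) powr (1 + \<epsilon>)"
          using B by (subst pos_le_divide_eq) auto
        also have "\<dots> = N * defect (t *\<^sub>R z) powr (- (1 + \<epsilon>))" by (simp only: powr_minus_divide) simp
        also have "\<dots> \<le> N * (y t / 2) powr (- (1 + \<epsilon>))"
        proof (intro mult_left_mono powr_mono2')
          have tx: "0 \<le> t * x" "t * x \<le> x" "t * x \<le> t" using x t by (auto simp: mult_left_le_one_le mult_left_le)
          have "(t * x)\<^sup>2 \<le> t * x" using tx x unfolding power2_eq_square by (intro mult_left_le) auto
          then have le: "1 - t * x \<le> defect (t *\<^sub>R z)" by (simp add: defect_scaleR x_def)
          have "y t \<le> 2 * (1 - t * x)" using tx by (simp add: y_def)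
          also have "\<dots> \<le> 2 * defect (t *\<^sub>R z)" using le by (intro mult_left_mono) auto
          finally show "y t / 2 \<le> defect (t *\<^sub>R z)" by simp
        qed (use N \<epsilon> y [OF t(2)] in auto)
        also have "(y t / 2) powr (- (1 + \<epsilon>)) = 2 powr (1 + \<epsilon>) * y t powr (- (1 + \<epsilon>))"
        proof -
          have "(2 :: real) powr (1 + \<epsilon>) * 2 powr (- 1 - \<epsilon>) = 1" by (simp flip: powr_add)
          then show ?thesis using y [OF t(2)] by (simp add: powr_divide powr_minus field_simps)
        qed
        finally show ?thesis .
      qed
      define M where "M = 2 * N * 2 powr (1 + \<epsilon>)"
      have M: "0 \<le> M" using N by (simp add: M_def)
      \<comment> \<open>A primitive of the majorant of \<open>|d/dt g (t z)|\<close>.\<close>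
      define \<phi> where "\<phi> = (\<lambda>t. M / \<epsilon> * y t powr (- \<epsilon>))"
      have "norm (g (1 *\<^sub>R z) - g ((1/2) *\<^sub>R z)) \<le> \<phi> 1 - \<phi> (1/2)"
      proof (rule differentiable_bound_general [of "1/2" 1 "\<lambda>t. g (t *\<^sub>R z)" \<phi> "\<lambda>t. radial_deriv g (t *\<^sub>R z) / of_real t" "\<lambda>t. M * y t powr (- (1 + \<epsilon>))"])
        show "continuous_on {1/2..1} (\<lambda>t. g (t *\<^sub>R z))"
          by (intro continuous_on_compose2 [OF holomorphic_Cn_continuous_on [OF g]] continuous_intros) (use tz in auto)
        show "continuous_on {1/2..1} \<phi>"
          unfolding \<phi>_def y_def using x by (intro continuous_intros) auto
        fix t :: real assume t: "1/2 < t" "t < 1"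
        show "((\<lambda>t. g (t *\<^sub>R z)) has_vector_derivative radial_deriv g (t *\<^sub>R z) / complex_of_real t) (at t)"
          using t by (intro has_vector_derivative_ray [OF g] tz) auto
        have "(y has_real_derivative -1) (at t)"
          unfolding y_def by (auto intro!: derivative_eq_intros)
        from DERIV_powr [OF this _ DERIV_const [of "- \<epsilon>"]]
        have "((\<lambda>t. y t powr - \<epsilon>) has_real_derivative (y t powr - \<epsilon> * (0 * ln (y t) + - 1 * - \<epsilon> / y t))) (at t)"
          using y [of t] t by simp
        from DERIV_cmult [OF this, of "M / \<epsilon>"]
        have "(\<phi> has_real_derivative M / \<epsilon> * (y t powr - \<epsilon> * (0 * ln (y t) + - 1 * - \<epsilon> / y t))) (at t)"
          by (simp add: \<phi>_def)
        also have "M / \<epsilon> * (y t powr - \<epsilon> * (0 * ln (y t) + - 1 * - \<epsilon> / y t)) = M * y t powr (- (1 + \<epsilon>))"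
        proof -
          have "- (1 + \<epsilon>) = - \<epsilon> - 1" by simp
          then have "y t powr (- (1 + \<epsilon>)) = y t powr (- \<epsilon>) / y t"
            using y [of t] t by (simp only: powr_diff) simp
          then show ?thesis using \<epsilon> by simp
        qed
        finally show "(\<phi> has_vector_derivative M * y t powr (- (1 + \<epsilon>))) (at t)"
          by (simp add: has_real_derivative_iff_has_vector_derivative)
        have "norm (radial_deriv g (t *\<^sub>R z) / of_real t) \<le> (N * (2 powr (1 + \<epsilon>) * y t powr (- (1 + \<epsilon>)))) / (1/2)"
          using bd [of t] t N by (simp only: norm_divide) (intro frac_le, auto)
        then show "norm (radial_deriv g (t *\<^sub>R z) / of_real t) \<le> M * y t powr (- (1 + \<epsilon>))"
          by (simp add: M_def mult_ac)
      qed simp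
      also have "\<dots> \<le> \<phi> 1" using M \<epsilon> by (simp add: \<phi>_def)
      also have "\<phi> 1 = M / \<epsilon> * (1 - x) powr (- \<epsilon>)" by (simp add: \<phi>_def y_def)
      also have "\<dots> \<le> M / \<epsilon> * (defect z / 2) powr (- \<epsilon>)"
      proof (intro mult_left_mono powr_mono2')
        have "defect z = (1 - x) * (1 + x)" by (simp add: defect_def x_def power2_eq_square algebra_simps)
        also have "\<dots> \<le> (1 - x) * 2" using x by (intro mult_left_mono) auto
        finally show "defect z / 2 \<le> 1 - x" by simp
      qed (use A M \<epsilon> in auto)
      also have "(defect z / 2) powr (- \<epsilon>) = 2 powr \<epsilon> * defect z powr (- \<epsilon>)"
        using A by (simp add: powr_divide powr_minus field_simps)
      also have "M / \<epsilon> * (2 powr \<epsilon> * defect z powr (- \<epsilon>)) = L * N * defect z powr (- \<epsilon>)"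
        by (simp add: M_def L_def)
      finally have "cmod (g z - g ((1/2) *\<^sub>R z)) \<le> L * N * defect z powr (- \<epsilon>)" by simp
      then have "cmod (g z - g ((1/2) *\<^sub>R z)) powr p \<le> (L * N * defect z powr (- \<epsilon>)) powr p"
        using p by (intro powr_mono2) auto
      also have "\<dots> = L powr p * (C * j) * defect z powr (- b)"
        using p C j by (simp add: powr_mult powr_powr N_def \<epsilon>_def)
      finally have "cmod (g z - g ((1/2) *\<^sub>R z)) powr p * defect z powr b \<le> L powr p * (C * j) * defect z powr (- b) * defect z powr b"
        by (intro mult_right_mono) auto
      also have "\<dots> = L powr p * C * j" using A by (simp add: powr_minus field_simps)
      finally show ?thesis unfolding J_def [symmetric] j(1) using L C j
        by (simp add: ennreal_leI flip: ennreal_mult)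
    qed
  qed
qed

text \<open>
  Away from the sphere the weight is bounded from above and below. On the line through \<open>w = z / 2\<close> the derivative of
  \<open>\<phi> c = g (c w)\<close> is \<open>R g (c w) / c\<close>. The quotient is bounded on the circle \<open>|c| = 3/2\<close>, where \<open>c\<close> does
  not vanish, and hence inside by the maximum principle.
\<close>

lemma center_bound:
  fixes p s :: real
  assumes p: "0 < p"
  obtains C :: real where "0 < C"
    "\<And>(g :: complex ^ 'n::finite \<Rightarrow> complex) z. holomorphic_Cn g (ball 0 1) \<Longrightarrow> g 0 = 0 \<Longrightarrow> z \<in> ball 0 1 \<Longrightarrow>
       ennreal (cmod (g ((1/2) *\<^sub>R z)) powr p) \<le> ennreal C * weighted_energy s p (radial_deriv g)"
proof -
  obtain C where C: "0 < C" "\<And>(g :: complex ^ 'n \<Rightarrow> complex) z. holomorphic_Cn g (ball 0 1) \<Longrightarrow> z \<in> ball 0 1 \<Longrightarrow>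
       ennreal (cmod (g z) powr p * defect z ^ (CARD('n) + 1))
         \<le> ennreal C * local_mass p (1/4) g z"
    using submean_pball [OF p, of "1/4", where 'n='n] by auto
  define K where "K = 16 powr \<bar>s\<bar> * (16/7) powr \<bar>s\<bar>"
  define n1 where "n1 = CARD('n) + 1"
  define C' where "C' = (16/7) ^ n1 * (C * K)"
  have K: "0 < K" by (simp add: K_def)
  have C': "0 < C'" using K C by (simp add: C'_def)
  show ?thesis
  proof (rule that [OF C'])
    fix g :: "complex ^ 'n \<Rightarrow> complex" and z :: "complex ^ 'n"
    assume g: "holomorphic_Cn g (ball 0 1)" and g0: "g 0 = 0" and z: "z \<in> ball 0 1"
    define h where "h = radial_deriv g"
    have h: "holomorphic_Cn h (ball 0 1)" unfolding h_def using g by (rule holomorphic_radial_deriv) simp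
    define Y where "Y = weighted_energy s p h"
    have hv: "ennreal (cmod (h v) powr p) \<le> ennreal C' * Y" if v: "norm v \<le> 3/4" for v :: "complex ^ 'n"
    proof -
      have vb: "v \<in> ball 0 1" using v by simp
      have A: "0 < defect v" using vb by (rule defect_pos)
      have "(norm v)\<^sup>2 \<le> (3/4)\<^sup>2" using v by (intro power_mono) auto
      then have dv: "7/16 \<le> defect v" by (simp add: defect_def power2_eq_square)
      have "(7/16) ^ n1 * cmod (h v) powr p \<le> defect v ^ n1 * cmod (h v) powr p"
        using dv by (intro mult_right_mono power_mono) auto
      then have "(16/7) ^ n1 * ((7/16) ^ n1 * cmod (h v) powr p) \<le> (16/7) ^ n1 * (cmod (h v) powr p * defect v ^ n1)"
        by (intro mult_left_mono) (auto simp: mult.commute)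
      moreover have "(16/7 :: real) ^ n1 * (7/16) ^ n1 = 1" by (simp flip: power_mult_distrib)
      ultimately have "cmod (h v) powr p \<le> (16/7) ^ n1 * (cmod (h v) powr p * defect v ^ n1)"
        by (simp only: mult.assoc [symmetric] mult_1_left)
      then have "ennreal (cmod (h v) powr p) \<le> ennreal ((16/7) ^ n1) * ennreal (cmod (h v) powr p * defect v ^ n1)"
        using A by (simp add: ennreal_leI flip: ennreal_mult)
      also have "\<dots> \<le> ennreal ((16/7) ^ n1) * (ennreal C * local_mass p (1/4) h v)"
        unfolding n1_def by (intro mult_left_mono C(2) h vb) auto
      also have "local_mass p (1/4) h v
         \<le> (\<integral>\<^sup>+w. ennreal K * (ennreal (defect w powr s * cmod (h w) powr p) * indicator (ball 0 1) w) \<partial>lborel)"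
        unfolding local_mass_def
      proof (rule nn_integral_mono)
        fix w
        show "ennreal (cmod (h w) powr p) * indicator (pball (1/4) v) w
          \<le> ennreal K * (ennreal (defect w powr s * cmod (h w) powr p) * indicator (ball 0 1) w)"
        proof (cases "w \<in> pball (1/4) v")
          case True
          then have wb: "w \<in> ball 0 1" using pball_subset_ball by blast
          have "1 powr s \<le> (16/7) powr \<bar>s\<bar> * defect v powr s"
            using dv A defect_le_1 [of v] by (intro powr_compare) auto
          also have "\<dots> \<le> (16/7) powr \<bar>s\<bar> * (16 powr \<bar>s\<bar> * defect w powr s)"
            using pball_powr_compare(1) [OF vb True, of s] by (intro mult_left_mono) auto
          finally have "1 \<le> K * defect w powr s" by (simp add: K_def mult_ac)
          then have "1 * cmod (h w) powr p \<le> K * defect w powr s * cmod (h w) powr p"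
            by (intro mult_right_mono) auto
          then show ?thesis using True wb K
            by (simp add: ennreal_leI mult.assoc flip: ennreal_mult)
        qed simp
      qed
      also have "\<dots> = ennreal K * Y"
        unfolding Y_def weighted_energy_def using measurable_energy_integrand [OF h] by (intro nn_integral_cmult) simp
      finally show ?thesis
        using C K by (simp add: C'_def ennreal_mult' mult_left_mono mult.assoc)
    qed
    show "ennreal (cmod (g ((1/2) *\<^sub>R z)) powr p) \<le> ennreal C' * weighted_energy s p (radial_deriv g)"
    proof (cases "Y = \<infinity>")
      case True
      then show ?thesis using C' by (simp add: Y_def h_def ennreal_mult_eq_top_iff)
    next
      case False
      define y where "y = enn2real Y"
      have y: "Y = ennreal y" "0 \<le> y" using False by (auto simp: y_def less_top)
      define M where "M = (C' * y) powr (1 / p)"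
      have M: "0 \<le> M" by (simp add: M_def)
      have hM: "cmod (h v) \<le> M" if v: "norm v \<le> 3/4" for v
      proof -
        have "ennreal (cmod (h v) powr p) \<le> ennreal (C' * y)"
          using hv [OF v] C' y by (simp add: ennreal_mult)
        then have "cmod (h v) powr p \<le> C' * y"
          using C' y by (subst (asm) ennreal_le_iff) auto
        then have "(cmod (h v) powr p) powr (1 / p) \<le> M"
          unfolding M_def using p by (intro powr_mono2) auto
        then show ?thesis using p by (simp add: powr_powr)
      qed
      define w where "w = (1/2) *\<^sub>R z"
      have nw: "norm w < 1/2" using z by (simp add: w_def)
      define \<phi> where "\<phi> = (\<lambda>c. g (0 + c *s w))"
      have mem: "0 + c *s w \<in> ball 0 1" if "cmod c < 2" for c
      proof -
        have "cmod c * norm w \<le> cmod c * (1/2)" using nw by (intro mult_left_mono) auto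
        then show ?thesis using that by (simp add: norm_smult_vec)
      qed
      have hol: "\<phi> holomorphic_on ball 0 2"
        unfolding \<phi>_def by (rule holomorphic_on_line [OF g]) (use mem in auto)
      have hold: "deriv \<phi> holomorphic_on ball 0 2" by (rule holomorphic_deriv [OF hol]) simp
      have dphi: "(\<phi> has_field_derivative deriv \<phi> c) (at c)" if "cmod c < 2" for c
        using holomorphic_derivI [OF hol open_ball, of c] that by simp
      have cphi: "c * deriv \<phi> c = h (c *s w)" if "cmod c < 2" for c
      proof -
        have S: "c *s w \<in> ball 0 1" using mem [OF that] by simp
        have "deriv \<phi> c = (\<Sum>j\<in>UNIV. partial_deriv j g (c *s w) * w $ j)"
          using has_field_derivative_ray(1) [OF g S] by (intro DERIV_imp_deriv) (simp add: \<phi>_def)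
        then show ?thesis using has_field_derivative_ray(2) [OF g S] by (simp add: h_def)
      qed
      have dM: "cmod (deriv \<phi> c) \<le> M" if c: "cmod c \<le> 3/2" for c
      proof (rule maximum_modulus_frontier [of "deriv \<phi>" "cball 0 (3/2)"])
        show "deriv \<phi> holomorphic_on interior (cball 0 (3/2))"
          by (rule holomorphic_on_subset [OF hold]) auto
        show "continuous_on (closure (cball 0 (3/2))) (deriv \<phi>)"
          by (rule holomorphic_on_imp_continuous_on, rule holomorphic_on_subset [OF hold]) auto
        show "bounded (cball (0::complex) (3/2))" by simp
        show "c \<in> cball 0 (3/2)" using c by simp
        fix c :: complex assume "c \<in> frontier (cball 0 (3/2))"
        then have c: "cmod c = 3/2" by simp
        have "norm (c *s w) \<le> 3/4" unfolding norm_smult_vec c using nw by simp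
        then have "cmod (c * deriv \<phi> c) \<le> M" using cphi [of c] c hM by simp
        then have "3/2 * cmod (deriv \<phi> c) \<le> M" using c by (simp add: norm_mult)
        then show "cmod (deriv \<phi> c) \<le> M" using norm_ge_zero [of "deriv \<phi> c"] by linarith
      qed
      have "cmod (\<phi> 1 - \<phi> 0) \<le> M * cmod (1 - 0)"
        by (rule field_differentiable_bound [of "cball 0 1" \<phi> "deriv \<phi>"])
          (use dphi dM in \<open>auto intro: has_field_derivative_at_within\<close>)
      then have "cmod (g w) \<le> M" using g0 by (simp add: \<phi>_def)
      then have "cmod (g w) powr p \<le> M powr p" using p by (intro powr_mono2) auto
      also have "M powr p = C' * y" using p C' y by (simp add: M_def powr_powr)
      finally show ?thesis unfolding Y_def [symmetric, unfolded h_def] y(1) w_def using C' y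
        by (simp add: ennreal_leI flip: ennreal_mult)
    qed
  qed
qed

lemma norm_add_powr_le:
  fixes x y :: "'a::real_normed_vector"
  assumes p: "0 < p"
  shows "norm (x + y) powr p \<le> 2 powr p * (norm x powr p + norm y powr p)"
proof -
  define m where "m = max (norm x) (norm y)"
  have "norm (x + y) \<le> 2 * m" using norm_triangle_ineq [of x y] by (simp add: m_def)
  then have "norm (x + y) powr p \<le> (2 * m) powr p" using p by (intro powr_mono2) auto
  also have "\<dots> = 2 powr p * m powr p" by (simp add: powr_mult m_def)
  also have "m powr p \<le> norm x powr p + norm y powr p" by (simp add: m_def max_def)
  finally show ?thesis by simp
qed

text \<open>
  The exponent \<open>b\<close> is halfway between zero, where \<open>hardy_pointwise\<close> breaks down, and \<open>\<beta> + 1\<close>, where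
  the weight \<open>\<beta> - b\<close> ceases to be integrable.
\<close>

lemma energy_le_radial_deriv:
  fixes \<beta> p :: real
  assumes p: "0 < p" and \<beta>: "-1 < \<beta>"
  obtains C :: real where "0 < C"
    "\<And>g :: complex ^ 'n::finite \<Rightarrow> complex. holomorphic_Cn g (ball 0 1) \<Longrightarrow> g 0 = 0 \<Longrightarrow>
       weighted_energy \<beta> p g \<le> ennreal C * weighted_energy (\<beta> + p) p (radial_deriv g)"
proof -
  define b where "b = (\<beta> + 1) / 2"
  have b: "0 < b" "-1 < \<beta> - b" using \<beta> by (auto simp: b_def field_simps)
  obtain \<delta> C1 where \<delta>: "0 < \<delta>" and C1: "0 < C1" and HP:
    "\<And>(g :: complex ^ 'n \<Rightarrow> complex) z. holomorphic_Cn g (ball 0 1) \<Longrightarrow> z \<in> ball 0 1 \<Longrightarrow>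
       ennreal (cmod (g z - g ((1/2) *\<^sub>R z)) powr p * defect z powr b) \<le> ennreal C1 * ray_mass p \<delta> (p + b) (radial_deriv g) z"
    using hardy_pointwise [OF p b(1), where 'n='n] by blast
  obtain C2 where C2: "0 < C2" and CB:
    "\<And>(g :: complex ^ 'n \<Rightarrow> complex) z. holomorphic_Cn g (ball 0 1) \<Longrightarrow> g 0 = 0 \<Longrightarrow> z \<in> ball 0 1 \<Longrightarrow>
       ennreal (cmod (g ((1/2) *\<^sub>R z)) powr p) \<le> ennreal C2 * weighted_energy (\<beta> + p) p (radial_deriv g)"
    using center_bound [OF p, of "\<beta> + p", where 'n='n] by blast
  obtain C3 where C3: "0 < C3" and DF: "\<And>F :: complex ^ 'n \<Rightarrow> ennreal. F \<in> borel_measurable borel \<Longrightarrow>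
       (\<integral>\<^sup>+z\<in>ball 0 1. ennreal (defect z powr (\<beta> - b)) * (\<integral>\<^sup>+u\<in>{1/4..1}. F (u *\<^sub>R z) \<partial>lborel) \<partial>lborel)
       \<le> ennreal C3 * (\<integral>\<^sup>+w\<in>ball 0 1. ennreal (defect w powr (\<beta> - b + 1)) * F w \<partial>lborel)"
    using dilation_fubini [OF b(2), where 'n='n] by blast
  obtain C4 where C4: "0 < C4" and FE: "\<And>g :: complex ^ 'n \<Rightarrow> complex. holomorphic_Cn g (ball 0 1) \<Longrightarrow>
       (\<integral>\<^sup>+z\<in>ball 0 1. ennreal (defect z powr (\<beta> + p - real (CARD('n) + 1))) * local_mass p \<delta> g z \<partial>lborel)
       \<le> ennreal C4 * weighted_energy (\<beta> + p) p g"
    using fubini_pball_energy [OF \<delta>, where b="\<beta> + p" and p=p and 'n='n] by blast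
  define W where "W = (\<integral>\<^sup>+z\<in>ball (0 :: complex ^ 'n) 1. ennreal (defect z powr \<beta>) \<partial>lborel)"
  have "W < \<infinity>" unfolding W_def by (rule weight_integrable [OF \<beta>])
  then obtain \<omega> where \<omega>: "W = ennreal \<omega>" "0 \<le> \<omega>" by (cases W) auto
  define C where "C = 2 powr p * (C1 * (C3 * C4) + C2 * \<omega>)"
  have "0 < C1 * (C3 * C4)" "0 \<le> C2 * \<omega>" using C1 C2 C3 C4 \<omega> by auto
  then have C: "0 < C" by (simp add: C_def add_pos_nonneg)
  show ?thesis
  proof (rule that [OF C])
    fix g :: "complex ^ 'n \<Rightarrow> complex"
    assume g: "holomorphic_Cn g (ball 0 1)" and g0: "g 0 = 0"
    define h where "h = radial_deriv g"
    have h: "holomorphic_Cn h (ball 0 1)" unfolding h_def using g by (rule holomorphic_radial_deriv) simp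
    define Y where "Y = weighted_energy (\<beta> + p) p h"
    define r where "r = p + b - 1 - real (CARD('n) + 1)"
    note lm [measurable] = measurable_local_mass [OF h, of p \<delta>]
    define \<Phi> where "\<Phi> = (\<lambda>w. ennreal (defect w powr r) * local_mass p \<delta> h w)"
    have \<Phi> [measurable]: "\<Phi> \<in> borel_measurable borel" unfolding \<Phi>_def by measurable
    define J where "J = (\<lambda>z. \<integral>\<^sup>+u\<in>{1/4..1}. \<Phi> (u *\<^sub>R z) \<partial>lborel)"
    have J: "ray_mass p \<delta> (p + b) h z = J z" for z by (simp add: ray_mass_def J_def \<Phi>_def r_def)
    have mJ [measurable]: "J \<in> borel_measurable borel"
      unfolding J_def by measurable
    have intJ: "(\<integral>\<^sup>+z\<in>ball 0 1. ennreal (defect z powr (\<beta> - b)) * J z \<partial>lborel) \<le> ennreal (C3 * C4) * Y"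
    proof -
      have "(\<integral>\<^sup>+z\<in>ball 0 1. ennreal (defect z powr (\<beta> - b)) * J z \<partial>lborel)
        \<le> ennreal C3 * (\<integral>\<^sup>+w\<in>ball 0 1. ennreal (defect w powr (\<beta> - b + 1)) * \<Phi> w \<partial>lborel)"
        unfolding J_def by (rule DF) simp
      also have "(\<integral>\<^sup>+w\<in>ball 0 1. ennreal (defect w powr (\<beta> - b + 1)) * \<Phi> w \<partial>lborel)
        = (\<integral>\<^sup>+w\<in>ball 0 1. ennreal (defect w powr (\<beta> + p - real (CARD('n) + 1))) * local_mass p \<delta> h w \<partial>lborel)"
      proof (rule nn_integral_cong)
        fix w :: "complex ^ 'n"
        have "ennreal (defect w powr (\<beta> - b + 1)) * ennreal (defect w powr r) = ennreal (defect w powr (\<beta> + p - real (CARD('n) + 1)))"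
          by (simp add: r_def algebra_simps flip: ennreal_mult powr_add)
        then show "ennreal (defect w powr (\<beta> - b + 1)) * \<Phi> w * indicator (ball 0 1) w
          = ennreal (defect w powr (\<beta> + p - real (CARD('n) + 1))) * local_mass p \<delta> h w * indicator (ball 0 1) w"
          by (simp add: \<Phi>_def flip: mult.assoc)
      qed
      also have "\<dots> \<le> ennreal C4 * Y" unfolding Y_def by (rule FE [OF h])
      finally show ?thesis using C3 C4 by (simp add: ennreal_mult' mult_left_mono mult.assoc)
    qed
    have "weighted_energy \<beta> p g
      \<le> (\<integral>\<^sup>+z. ennreal (2 powr p) * (ennreal C1 * (ennreal (defect z powr (\<beta> - b)) * J z * indicator (ball 0 1) z)
            + (ennreal C2 * Y) * (ennreal (defect z powr \<beta>) * indicator (ball 0 1) z)) \<partial>lborel)"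
      unfolding weighted_energy_def
    proof (rule nn_integral_mono)
      fix z :: "complex ^ 'n"
      show "ennreal (defect z powr \<beta> * cmod (g z) powr p) * indicator (ball 0 1) z
        \<le> ennreal (2 powr p) * (ennreal C1 * (ennreal (defect z powr (\<beta> - b)) * J z * indicator (ball 0 1) z)
            + (ennreal C2 * Y) * (ennreal (defect z powr \<beta>) * indicator (ball 0 1) z))"
      proof (cases "z \<in> ball 0 1")
        case True
        then have A: "0 < defect z" by (rule defect_pos)
        define a1 where "a1 = cmod (g z - g ((1/2) *\<^sub>R z)) powr p"
        define a2 where "a2 = cmod (g ((1/2) *\<^sub>R z)) powr p"
        have "cmod (g z) powr p \<le> 2 powr p * (a1 + a2)"
          using norm_add_powr_le [OF p, of "g z - g ((1/2) *\<^sub>R z)" "g ((1/2) *\<^sub>R z)"] by (simp add: a1_def a2_def)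
        then have "defect z powr \<beta> * cmod (g z) powr p \<le> defect z powr \<beta> * (2 powr p * (a1 + a2))"
          by (intro mult_left_mono) auto
        also have "\<dots> = 2 powr p * (defect z powr (\<beta> - b) * (a1 * defect z powr b) + a2 * defect z powr \<beta>)"
          using A by (simp add: powr_diff algebra_simps)
        finally have "ennreal (defect z powr \<beta> * cmod (g z) powr p) \<le> ennreal (2 powr p * (defect z powr (\<beta> - b) * (a1 * defect z powr b) + a2 * defect z powr \<beta>))"
          by (rule ennreal_leI)
        also have "\<dots> = ennreal (2 powr p) * (ennreal (defect z powr (\<beta> - b)) * ennreal (a1 * defect z powr b) + ennreal a2 * ennreal (defect z powr \<beta>))"
          by (simp add: ennreal_mult ennreal_plus a1_def a2_def)
        also have "\<dots> \<le> ennreal (2 powr p) * (ennreal (defect z powr (\<beta> - b)) * (ennreal C1 * J z) + (ennreal C2 * Y) * ennreal (defect z powr \<beta>))"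
        proof (intro mult_left_mono add_mono mult_right_mono)
          show "ennreal (a1 * defect z powr b) \<le> ennreal C1 * J z"
            using HP [OF g True] by (simp add: a1_def J h_def [symmetric])
          show "ennreal a2 \<le> ennreal C2 * Y"
            using CB [OF g g0 True] by (simp add: a2_def Y_def h_def)
        qed auto
        finally show ?thesis using True by (simp add: mult_ac)
      qed simp
    qed
    also have "\<dots> = ennreal (2 powr p) * (ennreal C1 * (\<integral>\<^sup>+z\<in>ball 0 1. ennreal (defect z powr (\<beta> - b)) * J z \<partial>lborel) + (ennreal C2 * Y) * W)"
      unfolding W_def
      by (subst nn_integral_cmult, measurable) (subst nn_integral_add, measurable, simp add: nn_integral_cmult)
    also have "\<dots> \<le> ennreal (2 powr p) * (ennreal C1 * (ennreal (C3 * C4) * Y) + (ennreal C2 * Y) * ennreal \<omega>)"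
      unfolding \<omega>(1) by (intro mult_left_mono add_mono intJ) auto
    also have "\<dots> = ennreal C * Y"
      using C1 C2 C3 C4 \<omega> by (simp add: C_def ennreal_mult ennreal_plus distrib_left distrib_right mult_ac)
    finally show "weighted_energy \<beta> p g \<le> ennreal C * weighted_energy (\<beta> + p) p (radial_deriv g)"
      by (simp only: Y_def h_def)
  qed
qed


section \<open>Extended powers\<close>

lemma ennreal_powr_ennreal: "0 \<le> x \<Longrightarrow> ennreal_powr (ennreal x) a = ennreal (x powr a)"
  by (simp add: ennreal_powr_def)

lemma ennreal_powr_top: "ennreal_powr \<infinity> a = \<infinity>" "ennreal_powr top a = \<infinity>"
  by (simp_all add: ennreal_powr_def)

lemma ennreal_powr_mono:
  assumes "x \<le> y" "0 \<le> a"
  shows "ennreal_powr x a \<le> ennreal_powr y a"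
proof (cases y)
  case (real r)
  with assms obtain s where "x = ennreal s" "0 \<le> s" "s \<le> r"
    by (cases x) (auto simp: top_unique)
  with real assms show ?thesis by (simp add: ennreal_powr_ennreal ennreal_leI powr_mono2)
qed (simp add: ennreal_powr_top)

lemma ennreal_powr_mult:
  assumes "0 < C"
  shows "ennreal_powr (ennreal C * x) a = ennreal (C powr a) * ennreal_powr x a"
proof (cases x)
  case (real r)
  have "ennreal C * x = ennreal (C * r)" using real assms by (simp add: ennreal_mult)
  then have "ennreal_powr (ennreal C * x) a = ennreal (C powr a * r powr a)"
    using real assms by (simp add: ennreal_powr_ennreal powr_mult)
  also have "\<dots> = ennreal (C powr a) * ennreal_powr x a"
    using real by (simp add: ennreal_powr_ennreal ennreal_mult)
  finally show ?thesis .
next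
  case top
  with assms show ?thesis by (simp add: ennreal_powr_top ennreal_mult_eq_top_iff ennreal_mult_top)
qed

lemma ennreal_powr_powr:
  "ennreal_powr (ennreal_powr x a) b = ennreal_powr x (a * b)"
  by (cases x) (simp_all add: ennreal_powr_ennreal ennreal_powr_top powr_powr)

lemma ennreal_powr_less_top: "ennreal_powr x a < top \<longleftrightarrow> x < top"
  by (cases x) (simp_all add: ennreal_powr_ennreal ennreal_powr_top)

lemma measurable_ennreal_powr [measurable]: "(\<lambda>x. ennreal_powr x a) \<in> borel_measurable borel"
  unfolding ennreal_powr_def by measurable

section \<open>The measures of the statement\<close>

lemma unit_ball_volume:
  obtains V :: real where "0 < V" "emeasure lborel (ball (0 :: complex ^ 'n::finite) 1) = ennreal V"
proof
  show "emeasure lborel (ball (0 :: complex ^ 'n) 1) = ennreal (unit_ball_vol (DIM(complex ^ 'n)))"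
    by (simp add: emeasure_ball)
qed simp

lemma borel_measurable_ball_measure_iff:
  fixes F :: "complex ^ 'n::finite \<Rightarrow> ennreal"
  shows "F \<in> borel_measurable ball_measure \<longleftrightarrow> (\<lambda>z. F z * indicator (ball 0 1) z) \<in> borel_measurable borel"
proof -
  have "F \<in> borel_measurable ball_measure \<longleftrightarrow>
      (\<lambda>z. F z * indicator (ball 0 1) z) \<in> borel_measurable (uniform_measure lborel (ball 0 1))"
    unfolding ball_measure_def by (rule borel_measurable_restrict_space_iff_ennreal) simp
  also have "\<dots> \<longleftrightarrow> (\<lambda>z. F z * indicator (ball 0 1) z) \<in> borel_measurable borel"
    by (intro arg_cong [where f="(\<in>) (\<lambda>z. F z * indicator (ball 0 1) z)"] measurable_cong_sets refl) simp
  finally show ?thesis .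
qed

lemma borel_measurable_weighted_measure_iff:
  fixes F :: "complex ^ 'n::finite \<Rightarrow> ennreal"
  shows "F \<in> borel_measurable (weighted_measure \<alpha>) \<longleftrightarrow> (\<lambda>z. F z * indicator (ball 0 1) z) \<in> borel_measurable borel"
proof -
  have "sets (weighted_measure \<alpha> :: (complex ^ 'n) measure) = sets ball_measure"
    by (simp add: weighted_measure_def)
  then have "F \<in> borel_measurable (weighted_measure \<alpha>) \<longleftrightarrow> F \<in> borel_measurable ball_measure"
    by (intro arg_cong [where f="(\<in>) F"] measurable_cong_sets refl)
  then show ?thesis by (simp only: borel_measurable_ball_measure_iff)
qed

lemma nn_integral_ball_measure:
  fixes F :: "complex ^ 'n::finite \<Rightarrow> ennreal"
  assumes F: "(\<lambda>z. F z * indicator (ball 0 1) z) \<in> borel_measurable borel"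
  shows "(\<integral>\<^sup>+z. F z \<partial>ball_measure) = (\<integral>\<^sup>+z\<in>ball 0 1. F z \<partial>lborel) / emeasure lborel (ball (0 :: complex ^ 'n) 1)"
proof -
  have "(\<integral>\<^sup>+z. F z \<partial>ball_measure) = (\<integral>\<^sup>+z\<in>ball 0 1. F z \<partial>uniform_measure lborel (ball 0 1))"
    unfolding ball_measure_def by (rule nn_integral_restrict_space) simp
  also have "\<dots> = (\<integral>\<^sup>+z. F z * indicator (ball 0 1) z * indicator (ball 0 1) z \<partial>lborel) / emeasure lborel (ball (0 :: complex ^ 'n) 1)"
    using F by (subst nn_integral_uniform_measure) auto
  also have "(\<integral>\<^sup>+z. F z * indicator (ball 0 1) z * indicator (ball 0 1) z \<partial>lborel) = (\<integral>\<^sup>+z\<in>ball 0 1. F z \<partial>lborel)"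
    by (intro nn_integral_cong) (auto simp: indicator_def)
  finally show ?thesis .
qed

text \<open>
  All measures of the statement are weights times Lebesgue measure on the ball; the normalisation
  only produces a positive factor.
\<close>

lemma nn_integral_density_ball_measure:
  fixes c e :: real
  assumes c: "0 < c"
  shows "\<exists>\<kappa>>0. \<forall>F :: complex ^ 'n::finite \<Rightarrow> ennreal. (\<lambda>z. F z * indicator (ball 0 1) z) \<in> borel_measurable borel \<longrightarrow>
       (\<integral>\<^sup>+z. F z \<partial>density ball_measure (\<lambda>z. ennreal (c * (1 - (norm z)\<^sup>2) powr e)))
       = ennreal \<kappa> * (\<integral>\<^sup>+z\<in>ball 0 1. ennreal (defect z powr e) * F z \<partial>lborel)"
proof -
  obtain V where V: "0 < V" "emeasure lborel (ball (0 :: complex ^ 'n) 1) = ennreal V"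
    by (rule unit_ball_volume)
  show ?thesis
  proof (intro exI [of _ "c / V"] conjI allI impI)
    show "0 < c / V" using c V by simp
    fix F :: "complex ^ 'n \<Rightarrow> ennreal" assume F: "(\<lambda>z. F z * indicator (ball 0 1) z) \<in> borel_measurable borel"
    define G where "G = (\<lambda>z. F z * indicator (ball 0 1) z)"
    note [measurable] = F [folded G_def]
    let ?d = "\<lambda>z::complex ^ 'n. ennreal (c * defect z powr e)"
    have "?d \<in> borel_measurable ball_measure"
      unfolding borel_measurable_ball_measure_iff by measurable
    moreover have "F \<in> borel_measurable ball_measure"
      unfolding borel_measurable_ball_measure_iff by (rule F)
    ultimately have "(\<integral>\<^sup>+z. F z \<partial>density ball_measure ?d) = (\<integral>\<^sup>+z. ?d z * F z \<partial>ball_measure)"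
      by (rule nn_integral_density)
    also have "\<dots> = (\<integral>\<^sup>+z\<in>ball 0 1. ?d z * F z \<partial>lborel) / ennreal V"
    proof -
      have "(\<lambda>z. ?d z * G z) \<in> borel_measurable borel" by measurable
      then have "(\<lambda>z. ?d z * F z * indicator (ball 0 1) z) \<in> borel_measurable borel" by (simp only: G_def mult.assoc)
      then show ?thesis by (subst nn_integral_ball_measure) (auto simp: V(2))
    qed
    also have "(\<integral>\<^sup>+z\<in>ball 0 1. ?d z * F z \<partial>lborel) = (\<integral>\<^sup>+z. ennreal c * (ennreal (defect z powr e) * G z) \<partial>lborel)"
      using c by (intro nn_integral_cong) (simp add: G_def ennreal_mult' mult_ac)
    also have "\<dots> = ennreal c * (\<integral>\<^sup>+z. ennreal (defect z powr e) * G z \<partial>lborel)"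
      by (rule nn_integral_cmult) measurable
    also have "\<dots> / ennreal V = ennreal (c / V) * (\<integral>\<^sup>+z. ennreal (defect z powr e) * G z \<partial>lborel)"
    proof -
      have "ennreal (c / V) = ennreal c / ennreal V" using c V by (simp add: divide_ennreal)
      then show ?thesis by (simp only: mult.commute [of _ "\<integral>\<^sup>+z. ennreal (defect z powr e) * G z \<partial>lborel"] ennreal_times_divide)
    qed
    finally show "(\<integral>\<^sup>+z. F z \<partial>density ball_measure (\<lambda>z. ennreal (c * (1 - (norm z)\<^sup>2) powr e)))
       = ennreal (c / V) * (\<integral>\<^sup>+z\<in>ball 0 1. ennreal (defect z powr e) * F z \<partial>lborel)"
      by (simp only: defect_def G_def mult.assoc)
  qed
qed

lemma weight_const_pos: "0 < n \<Longrightarrow> 0 < weight_const n \<alpha>"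
  by (auto simp: weight_const_def intro!: divide_pos_pos mult_pos_pos Gamma_real_pos)

lemma nn_integral_weighted_measure:
  "\<exists>\<kappa>>0. \<forall>F :: complex ^ 'n::finite \<Rightarrow> ennreal. (\<lambda>z. F z * indicator (ball 0 1) z) \<in> borel_measurable borel \<longrightarrow>
     (\<integral>\<^sup>+z. F z \<partial>weighted_measure \<alpha>) = ennreal \<kappa> * (\<integral>\<^sup>+z\<in>ball 0 1. ennreal (defect z powr \<alpha>) * F z \<partial>lborel)"
  unfolding weighted_measure_def
  by (rule nn_integral_density_ball_measure) (rule weight_const_pos, simp)

lemma nn_integral_invariant_measure:
  "\<exists>\<kappa>>0. \<forall>F :: complex ^ 'n::finite \<Rightarrow> ennreal. (\<lambda>z. F z * indicator (ball 0 1) z) \<in> borel_measurable borel \<longrightarrow>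
     (\<integral>\<^sup>+z. F z \<partial>invariant_measure) = ennreal \<kappa> * (\<integral>\<^sup>+z\<in>ball 0 1. ennreal (defect z powr (- (real CARD('n) + 1))) * F z \<partial>lborel)"
  using nn_integral_density_ball_measure [where 'n='n and c=1 and e="- (real CARD('n) + 1)"]
  by (simp only: invariant_measure_def mult_1_left zero_less_one simp_thms)

section \<open>The area function\<close>

text \<open>
  The \<open>q\<close>-th power of the area function up to the normalisation of the invariant measure, with \<open>h\<close> in
  place of the \<open>m\<close>-th radial derivative.
\<close>

definition area_integral :: "real \<Rightarrow> real \<Rightarrow> nat \<Rightarrow> (complex ^ 'n::finite \<Rightarrow> complex) \<Rightarrow> complex ^ 'n \<Rightarrow> ennreal" where
  "area_integral \<delta> q m h z =
     (\<integral>\<^sup>+w\<in>pball \<delta> z. ennreal ((defect w ^ m * cmod (h w)) powr q * defect w powr (- (real CARD('n) + 1))) \<partial>lborel)"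

lemma measurable_area_integrand:
  fixes h :: "complex ^ 'n::finite \<Rightarrow> complex"
  assumes "holomorphic_Cn h (ball 0 1)"
  shows "(\<lambda>w. ennreal ((defect w ^ m * cmod (h w)) powr q * defect w powr s) * indicator (ball 0 1) w) \<in> borel_measurable borel"
proof -
  note [measurable] = measurable_norm_powr [OF assms, of q]
  have "(\<lambda>w. ennreal ((defect w ^ m) powr q * defect w powr s) * (ennreal (cmod (h w) powr q) * indicator (ball 0 1) w)) \<in> borel_measurable borel"
    by measurable
  also have "(\<lambda>w. ennreal ((defect w ^ m) powr q * defect w powr s) * (ennreal (cmod (h w) powr q) * indicator (ball 0 1) w))
    = (\<lambda>w. ennreal ((defect w ^ m * cmod (h w)) powr q * defect w powr s) * indicator (ball 0 1) w)"
  proof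
    fix w :: "complex ^ 'n"
    show "ennreal ((defect w ^ m) powr q * defect w powr s) * (ennreal (cmod (h w) powr q) * indicator (ball 0 1) w)
      = ennreal ((defect w ^ m * cmod (h w)) powr q * defect w powr s) * indicator (ball 0 1) w"
      by (cases "w \<in> ball 0 1") (simp_all add: powr_mult defect_pos less_imp_le mult_ac flip: ennreal_mult)
  qed
  finally show ?thesis .
qed

lemma measurable_area_integral:
  assumes "holomorphic_Cn h (ball 0 1)"
  shows "area_integral \<delta> q m h \<in> borel_measurable borel"
  using measurable_local_integral [OF measurable_area_integrand [OF assms], where \<delta>=\<delta>]
  by (simp only: mult.assoc indicator_pball_ball area_integral_def [abs_def])

lemma area_fun_eq:
  fixes q \<gamma> :: real
  assumes \<gamma>: "0 < \<gamma>"
  obtains \<delta> \<kappa> :: real where "0 < \<delta>" "\<delta> < 1" "0 < \<kappa>"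
    "\<And>(f :: complex ^ 'n::finite \<Rightarrow> complex) m z. holomorphic_Cn f (ball 0 1) \<Longrightarrow> z \<in> ball 0 1 \<Longrightarrow>
       area_fun \<gamma> q m f z = ennreal_powr (ennreal \<kappa> * area_integral \<delta> q m ((radial_deriv ^^ m) f) z) (1 / q)"
proof -
  obtain \<delta> :: real where \<delta>: "0 < \<delta>" "\<delta> < 1" and bb: "\<And>z :: complex ^ 'n. z \<in> ball 0 1 \<Longrightarrow> bergman_ball z \<gamma> = pball \<delta> z"
    using bergman_ball_eq_pball [OF \<gamma>, where 'n='n] by blast
  obtain \<kappa> where \<kappa>: "0 < \<kappa>" and inv:
    "\<And>F :: complex ^ 'n \<Rightarrow> ennreal. (\<lambda>z. F z * indicator (ball 0 1) z) \<in> borel_measurable borel \<Longrightarrow>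
       (\<integral>\<^sup>+z. F z \<partial>invariant_measure) = ennreal \<kappa> * (\<integral>\<^sup>+z\<in>ball 0 1. ennreal (defect z powr (- (real CARD('n) + 1))) * F z \<partial>lborel)"
    using nn_integral_invariant_measure [where 'n='n] by blast
  show ?thesis
  proof (rule that [OF \<delta> \<kappa>])
    fix f :: "complex ^ 'n \<Rightarrow> complex" and m and z :: "complex ^ 'n"
    assume f: "holomorphic_Cn f (ball 0 1)" and z: "z \<in> ball 0 1"
    define h where "h = (radial_deriv ^^ m) f"
    have h: "holomorphic_Cn h (ball 0 1)" unfolding h_def by (rule holomorphic_radial_deriv_iterate [OF f]) simp
    have cm: "cmod (of_real ((1 - (norm w)\<^sup>2) ^ m) * h w) = defect w ^ m * cmod (h w)" if "w \<in> ball 0 1" for w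
      using defect_pos [OF that] by (simp add: norm_mult norm_power defect_def [symmetric] del: of_real_diff of_real_power)
    define F where "F = (\<lambda>w. ennreal (cmod (of_real ((1 - (norm w)\<^sup>2) ^ m) * h w) powr q) * indicator (bergman_ball z \<gamma>) w)"
    have F: "F w = ennreal ((defect w ^ m * cmod (h w)) powr q) * indicator (pball \<delta> z) w" for w
      unfolding F_def bb [OF z] using cm pball_subset_ball [of \<delta> z] by (cases "w \<in> pball \<delta> z") auto
    have "(\<lambda>w. ennreal ((defect w ^ m * cmod (h w)) powr q * defect w powr 0) * indicator (ball 0 1) w * indicator (pball \<delta> z) w) \<in> borel_measurable borel"
      by (intro borel_measurable_times_ennreal [OF measurable_area_integrand [OF h]]
          borel_measurable_indicator sets_pball)
    moreover have "ennreal ((defect w ^ m * cmod (h w)) powr q * defect w powr 0) * indicator (ball 0 1) w * indicator (pball \<delta> z) w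
      = F w * indicator (ball 0 1) w" for w
      using defect_pos [of w] by (cases "w \<in> ball 0 1") (auto simp: F)
    ultimately have mF: "(\<lambda>w. F w * indicator (ball 0 1) w) \<in> borel_measurable borel" by simp
    have "(\<integral>\<^sup>+w. F w \<partial>invariant_measure) = ennreal \<kappa> * (\<integral>\<^sup>+w\<in>ball 0 1. ennreal (defect w powr (- (real CARD('n) + 1))) * F w \<partial>lborel)"
      by (rule inv [OF mF])
    also have "(\<integral>\<^sup>+w\<in>ball 0 1. ennreal (defect w powr (- (real CARD('n) + 1))) * F w \<partial>lborel) = area_integral \<delta> q m h z"
      unfolding area_integral_def
      using pball_subset_ball [of \<delta> z]
      by (intro nn_integral_cong) (auto simp: F indicator_def ennreal_mult mult.commute)
    finally show "area_fun \<gamma> q m f z = ennreal_powr (ennreal \<kappa> * area_integral \<delta> q m ((radial_deriv ^^ m) f) z) (1 / q)"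
      by (simp only: area_fun_def F_def h_def)
  qed
qed

lemma area_integral_lower:
  fixes q \<delta> :: real
  assumes q: "0 < q" and \<delta>: "0 < \<delta>" "\<delta> < 1"
  obtains C :: real where "0 < C"
    "\<And>(h :: complex ^ 'n::finite \<Rightarrow> complex) z. holomorphic_Cn h (ball 0 1) \<Longrightarrow> z \<in> ball 0 1 \<Longrightarrow>
       ennreal ((defect z ^ m * cmod (h z)) powr q) \<le> ennreal C * area_integral \<delta> q m h z"
proof -
  obtain C where C: "0 < C" "\<And>(g :: complex ^ 'n \<Rightarrow> complex) z. holomorphic_Cn g (ball 0 1) \<Longrightarrow> z \<in> ball 0 1 \<Longrightarrow>
       ennreal (cmod (g z) powr q * defect z ^ (CARD('n) + 1))
         \<le> ennreal C * local_mass q \<delta> g z"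
    using submean_pball [OF q \<delta>, where 'n='n] by blast
  define s where "s = real m * q - (real CARD('n) + 1)"
  define K where "K = (4 / \<delta>) powr \<bar>s\<bar>"
  have K: "0 < K" using \<delta> by (simp add: K_def)
  show ?thesis
  proof (rule that [of "C * K"])
    show "0 < C * K" using C K by simp
    fix h :: "complex ^ 'n \<Rightarrow> complex" and z :: "complex ^ 'n"
    assume h: "holomorphic_Cn h (ball 0 1)" and z: "z \<in> ball 0 1"
    have A: "0 < defect z" using z by (rule defect_pos)
    have ex: "(defect w ^ m * y) powr q = defect w powr (real m * q) * y powr q" if "w \<in> ball 0 1" "0 \<le> y" for w :: "complex ^ 'n" and y
      using defect_pos [OF that(1)] that(2) by (simp add: powr_mult powr_powr flip: powr_realpow)
    have "(defect z ^ m * cmod (h z)) powr q = defect z powr s * (cmod (h z) powr q * defect z ^ (CARD('n) + 1))"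
      using A ex [OF z, of "cmod (h z)"] by (simp add: s_def powr_diff powr_add powr_realpow)
    then have "ennreal ((defect z ^ m * cmod (h z)) powr q) = ennreal (defect z powr s) * ennreal (cmod (h z) powr q * defect z ^ (CARD('n) + 1))"
      by (simp only: ennreal_mult' powr_ge_zero)
    also have "\<dots> \<le> ennreal (defect z powr s) * (ennreal C * local_mass q \<delta> h z)"
      by (intro mult_left_mono C(2) h z) auto
    also have "\<dots> = ennreal C * (ennreal (defect z powr s) * local_mass q \<delta> h z)"
      by (simp only: mult_ac)
    also have "ennreal (defect z powr s) * local_mass q \<delta> h z
      = (\<integral>\<^sup>+w. ennreal (defect z powr s) * (ennreal (cmod (h w) powr q) * indicator (pball \<delta> z) w) \<partial>lborel)"
      using borel_measurable_norm_powr_indicator [OF holomorphic_Cn_continuous_on [OF h] _ pball_subset_ball sets_pball, of q \<delta> z]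
      unfolding local_mass_def by (intro nn_integral_cmult [symmetric]) auto
    also have "\<dots> \<le> (\<integral>\<^sup>+w. ennreal K * (ennreal ((defect w ^ m * cmod (h w)) powr q * defect w powr (- (real CARD('n) + 1))) * indicator (ball 0 1) w * indicator (pball \<delta> z) w) \<partial>lborel)"
    proof (rule nn_integral_mono)
      fix w :: "complex ^ 'n"
      show "ennreal (defect z powr s) * (ennreal (cmod (h w) powr q) * indicator (pball \<delta> z) w)
        \<le> ennreal K * (ennreal ((defect w ^ m * cmod (h w)) powr q * defect w powr (- (real CARD('n) + 1))) * indicator (ball 0 1) w * indicator (pball \<delta> z) w)"
      proof (cases "w \<in> pball \<delta> z")
        case True
        then have wb: "w \<in> ball 0 1" using pball_subset_ball by blast
        have B: "0 < defect w" using wb by (rule defect_pos)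
        have "defect z powr s * cmod (h w) powr q \<le> (K * defect w powr s) * cmod (h w) powr q"
          using pball_powr_compare(1) [OF z True \<delta>(1), of s] by (intro mult_right_mono) (auto simp: K_def)
        also have "\<dots> = K * ((defect w ^ m * cmod (h w)) powr q * defect w powr (- (real CARD('n) + 1)))"
        proof -
          have "s = real m * q + - (real CARD('n) + 1)" by (simp add: s_def)
          then have "defect w powr s = defect w powr (real m * q) * defect w powr (- (real CARD('n) + 1))"
            by (simp only: powr_add)
          then show ?thesis unfolding ex [OF wb norm_ge_zero] by (simp only: mult_ac)
        qed
        finally show ?thesis using True wb K
          by (simp add: ennreal_leI flip: ennreal_mult)
      qed simp
    qed
    also have "\<dots> = ennreal K * area_integral \<delta> q m h z"
    proof (subst nn_integral_cmult)
      show "(\<lambda>w. ennreal ((defect w ^ m * cmod (h w)) powr q * defect w powr (- (real CARD('n) + 1))) * indicator (ball 0 1) w * indicator (pball \<delta> z) w) \<in> borel_measurable lborel"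
        unfolding measurable_lborel2
        by (rule borel_measurable_times_ennreal [OF measurable_area_integrand [OF h] borel_measurable_indicator [OF sets_pball]])
    qed (simp only: area_integral_def mult.assoc indicator_pball_ball)
    finally show "ennreal ((defect z ^ m * cmod (h z)) powr q) \<le> ennreal (C * K) * area_integral \<delta> q m h z"
      using C K by (simp add: ennreal_mult' mult_left_mono mult.assoc)
  qed
qed

text \<open>
  On the Bergman ball around \<open>z\<close>, \<open>local_sup\<close> bounds \<open>|h|\<^sup>p\<close> by the local mean, and the invariant
  volume of a Bergman ball is bounded. The exponent \<open>p / q\<close> turns the \<open>q\<close>-th power of the bound into a
  \<open>p\<close>-th power, which is linear in the local mass.
\<close>

lemma area_integral_upper:
  fixes p q \<delta> :: real
  assumes p: "0 < p" and q: "0 < q" and \<delta>: "0 < \<delta>"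
  obtains \<delta>' C :: real where "0 < \<delta>'" "0 < C"
    "\<And>(h :: complex ^ 'n::finite \<Rightarrow> complex) z. holomorphic_Cn h (ball 0 1) \<Longrightarrow> z \<in> ball 0 1 \<Longrightarrow>
       ennreal_powr (area_integral \<delta> q m h z) (p / q)
         \<le> ennreal C * (ennreal (defect z powr (real m * p - real (CARD('n) + 1))) * local_mass p \<delta>' h z)"
proof -
  obtain \<delta>' C where \<delta>': "0 < \<delta>'" and C: "0 < C" and LS: "\<And>(g :: complex ^ 'n \<Rightarrow> complex) z w. holomorphic_Cn g (ball 0 1) \<Longrightarrow> z \<in> ball 0 1 \<Longrightarrow> w \<in> pball \<delta> z \<Longrightarrow>
       ennreal (cmod (g w) powr p * defect z ^ (CARD('n) + 1)) \<le> ennreal C * local_mass p \<delta>' g z"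
    using local_sup [OF p \<delta>, where 'n='n] by blast
  obtain V where V: "0 < V"
    "\<And>z :: complex ^ 'n. z \<in> ball 0 1 \<Longrightarrow> emeasure lborel (pball \<delta> z) \<le> ennreal (V * defect z ^ (CARD('n) + 1))"
    using emeasure_pball_le [OF \<delta>, where 'n='n] by blast
  define n1 where "n1 = real CARD('n) + 1"
  have n1: "n1 = real (CARD('n) + 1)" by (simp add: n1_def)
  define s where "s = real m * q - n1"
  define K where "K = (4 / \<delta>) powr \<bar>s\<bar>"
  have K: "0 < K" using \<delta> by (simp add: K_def)
  show ?thesis
  proof (rule that [OF \<delta>', of "(K * V) powr (p / q) * C"])
    show "0 < (K * V) powr (p / q) * C" using C K V by simp
    fix h :: "complex ^ 'n \<Rightarrow> complex" and z :: "complex ^ 'n"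
    assume h: "holomorphic_Cn h (ball 0 1)" and z: "z \<in> ball 0 1"
    have A: "0 < defect z" using z by (rule defect_pos)
    define S where "S = local_mass p \<delta>' h z"
    show "ennreal_powr (area_integral \<delta> q m h z) (p / q)
         \<le> ennreal ((K * V) powr (p / q) * C) * (ennreal (defect z powr (real m * p - real (CARD('n) + 1))) * local_mass p \<delta>' h z)"
    proof (cases "S = \<infinity>")
      case True
      then show ?thesis using C K V A by (simp add: S_def [symmetric] ennreal_mult_eq_top_iff ennreal_mult_top)
    next
      case False
      define j where "j = enn2real S"
      have j: "S = ennreal j" "0 \<le> j" using False by (auto simp: j_def less_top)
      define Q where "Q = C * j / defect z ^ (CARD('n) + 1)"
      have Q: "0 \<le> Q" using C j A by (simp add: Q_def)
      have bd: "cmod (h w) powr q \<le> Q powr (q / p)" if w: "w \<in> pball \<delta> z" for w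
      proof -
        have "ennreal (cmod (h w) powr p * defect z ^ (CARD('n) + 1)) \<le> ennreal (C * j)"
          using LS [OF h z w] C j by (simp add: S_def [symmetric] ennreal_mult)
        then have "cmod (h w) powr p * defect z ^ (CARD('n) + 1) \<le> C * j"
          using C j by (subst (asm) ennreal_le_iff) auto
        then have "cmod (h w) powr p \<le> Q"
          using A unfolding Q_def by (subst pos_le_divide_eq) auto
        then have "(cmod (h w) powr p) powr (q / p) \<le> Q powr (q / p)"
          using p q by (intro powr_mono2) auto
        then show ?thesis using p by (simp add: powr_powr)
      qed
      define M where "M = K * defect z powr s * Q powr (q / p)"
      have M: "0 \<le> M" using K by (simp add: M_def)
      have "area_integral \<delta> q m h z \<le> (\<integral>\<^sup>+w. ennreal M * indicator (pball \<delta> z) w \<partial>lborel)"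
        unfolding area_integral_def
      proof (rule nn_integral_mono)
        fix w :: "complex ^ 'n"
        show "ennreal ((defect w ^ m * cmod (h w)) powr q * defect w powr (- (real CARD('n) + 1))) * indicator (pball \<delta> z) w
          \<le> ennreal M * indicator (pball \<delta> z) w"
        proof (cases "w \<in> pball \<delta> z")
          case True
          then have wb: "w \<in> ball 0 1" using pball_subset_ball by blast
          have B: "0 < defect w" using wb by (rule defect_pos)
          have "(defect w ^ m * cmod (h w)) powr q = defect w powr (real m * q) * cmod (h w) powr q"
            using B by (simp add: powr_mult powr_powr flip: powr_realpow)
          moreover have "s = real m * q + - (real CARD('n) + 1)" by (simp add: s_def n1_def)
          then have "defect w powr s = defect w powr (real m * q) * defect w powr (- (real CARD('n) + 1))"
            by (simp only: powr_add)
          ultimately have "(defect w ^ m * cmod (h w)) powr q * defect w powr (- (real CARD('n) + 1)) = defect w powr s * cmod (h w) powr q"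
            by (simp only: mult_ac)
          also have "\<dots> \<le> (K * defect z powr s) * Q powr (q / p)"
            using pball_powr_compare(2) [OF z True \<delta>, of s] bd [OF True] K
            by (intro mult_mono) (auto simp: K_def)
          finally show ?thesis using True by (simp add: M_def ennreal_leI)
        qed simp
      qed
      also have "\<dots> = ennreal M * emeasure lborel (pball \<delta> z)"
        by (rule nn_integral_cmult_indicator) (simp add: sets_pball)
      also have "\<dots> \<le> ennreal M * ennreal (V * defect z ^ (CARD('n) + 1))"
        by (intro mult_left_mono V z) auto
      also have "\<dots> = ennreal (M * (V * defect z ^ (CARD('n) + 1)))"
        using M V A by (simp add: ennreal_mult)
      also have "M * (V * defect z ^ (CARD('n) + 1)) = K * V * defect z powr (real m * q) * Q powr (q / p)"
      proof -
        have "defect z powr s = defect z powr (real m * q) / defect z ^ (CARD('n) + 1)"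
          using A by (simp only: s_def n1 powr_diff powr_realpow)
        then have "defect z powr s * defect z ^ (CARD('n) + 1) = defect z powr (real m * q)"
          using A by simp
        moreover have "M * (V * defect z ^ (CARD('n) + 1)) = K * V * (defect z powr s * defect z ^ (CARD('n) + 1)) * Q powr (q / p)"
          by (simp only: M_def mult_ac)
        ultimately show ?thesis by (simp only:)
      qed
      finally have "ennreal_powr (area_integral \<delta> q m h z) (p / q) \<le> ennreal_powr (ennreal (K * V * defect z powr (real m * q) * Q powr (q / p))) (p / q)"
        using p q by (intro ennreal_powr_mono) auto
      also have "\<dots> = ennreal ((K * V) powr (p / q) * defect z powr (real m * p) * Q)"
        using K V Q p q by (simp add: ennreal_powr_ennreal powr_mult powr_powr)
      also have "(K * V) powr (p / q) * defect z powr (real m * p) * Q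
        = (K * V) powr (p / q) * C * (defect z powr (real m * p - real (CARD('n) + 1)) * j)"
      proof -
        have "defect z powr (real m * p - real (CARD('n) + 1)) = defect z powr (real m * p) / defect z ^ (CARD('n) + 1)"
          using A by (simp only: powr_diff powr_realpow)
        then show ?thesis by (simp add: Q_def)
      qed
      also have "ennreal \<dots> = ennreal ((K * V) powr (p / q) * C) * (ennreal (defect z powr (real m * p - real (CARD('n) + 1))) * local_mass p \<delta>' h z)"
        unfolding S_def [symmetric] j(1) using C j by (simp add: ennreal_mult)
      finally show ?thesis .
    qed
  qed
qed

lemma area_energy:
  fixes p q \<gamma> \<alpha> :: real
  assumes p: "0 < p" and q: "0 < q" and \<gamma>: "0 < \<gamma>"
  obtains C :: real where "0 < C"
    "\<And>f :: complex ^ 'n::finite \<Rightarrow> complex. holomorphic_Cn f (ball 0 1) \<Longrightarrow>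
       area_fun \<gamma> q m f \<in> borel_measurable (weighted_measure \<alpha>) \<and>
       (\<integral>\<^sup>+z. ennreal_powr (area_fun \<gamma> q m f z) p \<partial>weighted_measure \<alpha>)
         \<le> ennreal C * weighted_energy (\<alpha> + p * real m) p ((radial_deriv ^^ m) f) \<and>
       weighted_energy (\<alpha> + p * real m) p ((radial_deriv ^^ m) f)
         \<le> ennreal C * (\<integral>\<^sup>+z. ennreal_powr (area_fun \<gamma> q m f z) p \<partial>weighted_measure \<alpha>)"
proof -
  obtain \<delta> \<kappa> where \<delta>: "0 < \<delta>" "\<delta> < 1" and \<kappa>: "0 < \<kappa>" and af:
    "\<And>(f :: complex ^ 'n \<Rightarrow> complex) m z. holomorphic_Cn f (ball 0 1) \<Longrightarrow> z \<in> ball 0 1 \<Longrightarrow>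
       area_fun \<gamma> q m f z = ennreal_powr (ennreal \<kappa> * area_integral \<delta> q m ((radial_deriv ^^ m) f) z) (1 / q)"
    using area_fun_eq [OF \<gamma>, where 'n='n and q=q] by blast
  obtain \<mu> where \<mu>: "0 < \<mu>" and wm: "\<And>F :: complex ^ 'n \<Rightarrow> ennreal. (\<lambda>z. F z * indicator (ball 0 1) z) \<in> borel_measurable borel \<Longrightarrow>
       (\<integral>\<^sup>+z. F z \<partial>weighted_measure \<alpha>) = ennreal \<mu> * (\<integral>\<^sup>+z\<in>ball 0 1. ennreal (defect z powr \<alpha>) * F z \<partial>lborel)"
    using nn_integral_weighted_measure [where 'n='n and \<alpha>=\<alpha>] by blast
  obtain C1 where C1: "0 < C1" and lo: "\<And>(h :: complex ^ 'n \<Rightarrow> complex) z. holomorphic_Cn h (ball 0 1) \<Longrightarrow> z \<in> ball 0 1 \<Longrightarrow>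
       ennreal ((defect z ^ m * cmod (h z)) powr q) \<le> ennreal C1 * area_integral \<delta> q m h z"
    using area_integral_lower [OF q \<delta>, where 'n='n and m=m] by blast
  obtain \<delta>' C2 where \<delta>': "0 < \<delta>'" and C2: "0 < C2" and up: "\<And>(h :: complex ^ 'n \<Rightarrow> complex) z. holomorphic_Cn h (ball 0 1) \<Longrightarrow> z \<in> ball 0 1 \<Longrightarrow>
       ennreal_powr (area_integral \<delta> q m h z) (p / q)
         \<le> ennreal C2 * (ennreal (defect z powr (real m * p - real (CARD('n) + 1))) * local_mass p \<delta>' h z)"
    using area_integral_upper [OF p q \<delta>(1), where 'n='n and m=m] by blast
  obtain C3 where C3: "0 < C3" and FE: "\<And>g :: complex ^ 'n \<Rightarrow> complex. holomorphic_Cn g (ball 0 1) \<Longrightarrow>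
       (\<integral>\<^sup>+z\<in>ball 0 1. ennreal (defect z powr (\<alpha> + p * real m - real (CARD('n) + 1))) * local_mass p \<delta>' g z \<partial>lborel)
       \<le> ennreal C3 * weighted_energy (\<alpha> + p * real m) p g"
    using fubini_pball_energy [OF \<delta>', where b="\<alpha> + p * real m" and p=p and 'n='n] by blast
  define U where "U = \<kappa> powr (p / q) * C2"
  define L where "L = (C1 / \<kappa>) powr (p / q)"
  have U: "0 < U" and L: "0 < L" using \<kappa> C1 C2 by (auto simp: U_def L_def)
  define C where "C = max (\<mu> * (U * C3)) (L / \<mu>)"
  have C: "0 < C" "\<mu> * (U * C3) \<le> C" "L / \<mu> \<le> C" using \<mu> L by (auto simp: C_def less_max_iff_disj)
  show ?thesis
  proof (rule that [OF C(1)])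
    fix f :: "complex ^ 'n \<Rightarrow> complex" assume f: "holomorphic_Cn f (ball 0 1)"
    define h where "h = (radial_deriv ^^ m) f"
    have h: "holomorphic_Cn h (ball 0 1)" unfolding h_def by (rule holomorphic_radial_deriv_iterate [OF f]) simp
    define E where "E = weighted_energy (\<alpha> + p * real m) p h"
    define a where "a = area_integral \<delta> q m h"
    have ma [measurable]: "a \<in> borel_measurable borel" unfolding a_def by (rule measurable_area_integral [OF h])
    have af': "area_fun \<gamma> q m f z = ennreal_powr (ennreal \<kappa> * a z) (1 / q)" if "z \<in> ball 0 1" for z
      using af [OF f that] by (simp add: a_def h_def)
    have "(\<lambda>z. ennreal_powr (ennreal \<kappa> * a z) (1 / q) * indicator (ball 0 1) z) \<in> borel_measurable borel"
      by measurable
    also have "(\<lambda>z. ennreal_powr (ennreal \<kappa> * a z) (1 / q) * indicator (ball 0 1) z) = (\<lambda>z. area_fun \<gamma> q m f z * indicator (ball 0 1) z)"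
      by (auto simp: fun_eq_iff indicator_def af')
    finally have mA: "area_fun \<gamma> q m f \<in> borel_measurable (weighted_measure \<alpha>)"
      by (simp only: borel_measurable_weighted_measure_iff)
    define G where "G = (\<lambda>z. ennreal_powr (a z) (p / q))"
    have mG [measurable]: "G \<in> borel_measurable borel" unfolding G_def by measurable
    have pw: "ennreal_powr (area_fun \<gamma> q m f z) p = ennreal (\<kappa> powr (p / q)) * G z" if "z \<in> ball 0 1" for z
      using \<kappa> by (simp add: af' [OF that] ennreal_powr_powr ennreal_powr_mult G_def powr_powr)
    define I where "I = (\<integral>\<^sup>+z. ennreal_powr (area_fun \<gamma> q m f z) p \<partial>weighted_measure \<alpha>)"
    have ind: "ennreal_powr (area_fun \<gamma> q m f z) p * indicator (ball 0 1) z = ennreal (\<kappa> powr (p / q)) * G z * indicator (ball 0 1) z" for z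
      using pw [of z] by (cases "z \<in> ball 0 1") auto
    have I: "I = ennreal \<mu> * (\<integral>\<^sup>+z\<in>ball 0 1. ennreal (defect z powr \<alpha>) * (ennreal (\<kappa> powr (p / q)) * G z) \<partial>lborel)"
    proof -
      have "I = ennreal \<mu> * (\<integral>\<^sup>+z\<in>ball 0 1. ennreal (defect z powr \<alpha>) * ennreal_powr (area_fun \<gamma> q m f z) p \<partial>lborel)"
        unfolding I_def by (rule wm) (unfold ind, measurable)
      then show ?thesis by (simp only: mult.assoc ind)
    qed
    have "I \<le> ennreal \<mu> * (\<integral>\<^sup>+z. ennreal U * (ennreal (defect z powr (\<alpha> + p * real m - real (CARD('n) + 1))) * local_mass p \<delta>' h z * indicator (ball 0 1) z) \<partial>lborel)"
      unfolding I
    proof (intro mult_left_mono nn_integral_mono)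
      fix z :: "complex ^ 'n"
      show "ennreal (defect z powr \<alpha>) * (ennreal (\<kappa> powr (p / q)) * G z) * indicator (ball 0 1) z
        \<le> ennreal U * (ennreal (defect z powr (\<alpha> + p * real m - real (CARD('n) + 1))) * local_mass p \<delta>' h z * indicator (ball 0 1) z)"
      proof (cases "z \<in> ball 0 1")
        case True
        have "ennreal (defect z powr \<alpha>) * (ennreal (\<kappa> powr (p / q)) * G z)
          \<le> ennreal (defect z powr \<alpha>) * (ennreal (\<kappa> powr (p / q)) * (ennreal C2 * (ennreal (defect z powr (real m * p - real (CARD('n) + 1))) * local_mass p \<delta>' h z)))"
          unfolding G_def a_def by (intro mult_left_mono up h True) auto
        also have "\<dots> = (ennreal (\<kappa> powr (p / q)) * ennreal C2) * ((ennreal (defect z powr \<alpha>) * ennreal (defect z powr (real m * p - real (CARD('n) + 1)))) * local_mass p \<delta>' h z)"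
          by (simp only: mult_ac)
        also have "ennreal (\<kappa> powr (p / q)) * ennreal C2 = ennreal U" using C2 by (simp add: U_def ennreal_mult)
        also have "ennreal (defect z powr \<alpha>) * ennreal (defect z powr (real m * p - real (CARD('n) + 1))) = ennreal (defect z powr (\<alpha> + p * real m - real (CARD('n) + 1)))"
          by (simp add: algebra_simps flip: ennreal_mult powr_add)
        finally show ?thesis using True by simp
      qed simp
    qed simp
    also have "\<dots> = ennreal \<mu> * (ennreal U * (\<integral>\<^sup>+z\<in>ball 0 1. ennreal (defect z powr (\<alpha> + p * real m - real (CARD('n) + 1))) * local_mass p \<delta>' h z \<partial>lborel))"
    proof -
      note [measurable] = measurable_local_mass [OF h, of p \<delta>']
      have "(\<lambda>z. ennreal (defect z powr (\<alpha> + p * real m - real (CARD('n) + 1))) * local_mass p \<delta>' h z * indicator (ball 0 1) z) \<in> borel_measurable lborel"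
        by measurable
      then show ?thesis by (simp only: nn_integral_cmult)
    qed
    also have "\<dots> \<le> ennreal \<mu> * (ennreal U * (ennreal C3 * E))"
      unfolding E_def by (intro mult_left_mono FE h) auto
    also have "\<dots> = ennreal (\<mu> * (U * C3)) * E"
      using \<mu> U C3 by (simp add: ennreal_mult mult.assoc)
    also have "\<dots> \<le> ennreal C * E" using C by (intro mult_right_mono ennreal_leI) auto
    finally have upper: "I \<le> ennreal C * E" .
    have "E \<le> (\<integral>\<^sup>+z. ennreal L * (ennreal (defect z powr \<alpha>) * (ennreal (\<kappa> powr (p / q)) * G z) * indicator (ball 0 1) z) \<partial>lborel)"
      unfolding E_def weighted_energy_def
    proof (rule nn_integral_mono)
      fix z :: "complex ^ 'n"
      show "ennreal (defect z powr (\<alpha> + p * real m) * cmod (h z) powr p) * indicator (ball 0 1) z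
        \<le> ennreal L * (ennreal (defect z powr \<alpha>) * (ennreal (\<kappa> powr (p / q)) * G z) * indicator (ball 0 1) z)"
      proof (cases "z \<in> ball 0 1")
        case True
        then have A: "0 < defect z" by (rule defect_pos)
        define y where "y = defect z ^ m * cmod (h z)"
        have y: "0 \<le> y" using A by (simp add: y_def)
        have yp: "y powr p = defect z powr (p * real m) * cmod (h z) powr p"
          using A by (simp add: y_def powr_mult powr_powr mult.commute flip: powr_realpow)
        have "ennreal (y powr p) = ennreal_powr (ennreal (y powr q)) (p / q)"
          using q y by (simp add: ennreal_powr_ennreal powr_powr)
        also have "\<dots> \<le> ennreal_powr (ennreal C1 * a z) (p / q)"
          unfolding y_def a_def using p q by (intro ennreal_powr_mono lo h True) auto
        also have "\<dots> = ennreal (C1 powr (p / q)) * G z" using C1 by (simp add: ennreal_powr_mult G_def)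
        also have "C1 powr (p / q) = L * \<kappa> powr (p / q)" using C1 \<kappa> by (simp add: L_def powr_divide)
        also have "ennreal (L * \<kappa> powr (p / q)) = ennreal L * ennreal (\<kappa> powr (p / q))" using L by (simp add: ennreal_mult)
        finally have 1: "ennreal (y powr p) \<le> ennreal L * (ennreal (\<kappa> powr (p / q)) * G z)" by (simp only: mult.assoc)
        have "ennreal (defect z powr (\<alpha> + p * real m) * cmod (h z) powr p) = ennreal (defect z powr \<alpha>) * ennreal (y powr p)"
          by (simp add: yp powr_add mult.assoc flip: ennreal_mult)
        also have "\<dots> \<le> ennreal (defect z powr \<alpha>) * (ennreal L * (ennreal (\<kappa> powr (p / q)) * G z))"
          by (intro mult_left_mono 1) auto
        finally show ?thesis using True by (simp add: mult_ac)
      qed simp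
    qed
    also have "\<dots> = ennreal L * (\<integral>\<^sup>+z\<in>ball 0 1. ennreal (defect z powr \<alpha>) * (ennreal (\<kappa> powr (p / q)) * G z) \<partial>lborel)"
      by (rule nn_integral_cmult) measurable
    also have "ennreal L = ennreal (L / \<mu>) * ennreal \<mu>" using L \<mu> by (simp flip: ennreal_mult)
    also have "ennreal (L / \<mu>) * ennreal \<mu> * (\<integral>\<^sup>+z\<in>ball 0 1. ennreal (defect z powr \<alpha>) * (ennreal (\<kappa> powr (p / q)) * G z) \<partial>lborel) = ennreal (L / \<mu>) * I"
      unfolding I by (simp only: mult.assoc)
    also have "\<dots> \<le> ennreal C * I" using C by (intro mult_right_mono ennreal_leI) auto
    finally have lower: "E \<le> ennreal C * I" .
    show "area_fun \<gamma> q m f \<in> borel_measurable (weighted_measure \<alpha>) \<and>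
       (\<integral>\<^sup>+z. ennreal_powr (area_fun \<gamma> q m f z) p \<partial>weighted_measure \<alpha>)
         \<le> ennreal C * weighted_energy (\<alpha> + p * real m) p ((radial_deriv ^^ m) f) \<and>
       weighted_energy (\<alpha> + p * real m) p ((radial_deriv ^^ m) f)
         \<le> ennreal C * (\<integral>\<^sup>+z. ennreal_powr (area_fun \<gamma> q m f z) p \<partial>weighted_measure \<alpha>)"
      using mA upper lower by (simp add: I_def E_def h_def)
  qed
qed

section \<open>Comparing derivatives of different order\<close>

text \<open>
  The order can be raised from \<open>N\<close> step by step since all radial derivatives vanish at the origin and
  all the weights involved are greater than \<open>-1\<close>.
\<close>

lemma energy_chain:
  fixes p \<alpha> :: real
  assumes p: "0 < p" and N: "-1 < p * real N + \<alpha>" and le: "N \<le> m"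
  shows "\<exists>C>0. \<forall>g :: complex ^ 'n::finite \<Rightarrow> complex. holomorphic_Cn g (ball 0 1) \<longrightarrow> g 0 = 0 \<longrightarrow>
     weighted_energy (\<alpha> + p * real m) p ((radial_deriv ^^ m) g)
       \<le> ennreal C * weighted_energy (\<alpha> + p * real N) p ((radial_deriv ^^ N) g) \<and>
     weighted_energy (\<alpha> + p * real N) p ((radial_deriv ^^ N) g)
       \<le> ennreal C * weighted_energy (\<alpha> + p * real m) p ((radial_deriv ^^ m) g)"
  using le
proof (induction m rule: dec_induct)
  case base
  show ?case by (rule exI [of _ 1]) simp
next
  case (step m)
  then obtain C where C: "0 < C" and IH: "\<And>g :: complex ^ 'n \<Rightarrow> complex. holomorphic_Cn g (ball 0 1) \<Longrightarrow> g 0 = 0 \<Longrightarrow>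
     weighted_energy (\<alpha> + p * real m) p ((radial_deriv ^^ m) g)
       \<le> ennreal C * weighted_energy (\<alpha> + p * real N) p ((radial_deriv ^^ N) g) \<and>
     weighted_energy (\<alpha> + p * real N) p ((radial_deriv ^^ N) g)
       \<le> ennreal C * weighted_energy (\<alpha> + p * real m) p ((radial_deriv ^^ m) g)"
    by blast
  define b where "b = \<alpha> + p * real m"
  have "p * real N \<le> p * real m" using p step.hyps by (intro mult_left_mono) auto
  then have b: "-1 < b" using N by (simp add: b_def)
  obtain C1 where C1: "0 < C1" and up: "\<And>g :: complex ^ 'n \<Rightarrow> complex. holomorphic_Cn g (ball 0 1) \<Longrightarrow>
       weighted_energy (b + p) p (radial_deriv g) \<le> ennreal C1 * weighted_energy b p g"
    using energy_radial_deriv_le [OF p, where b=b and 'n='n] by blast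
  obtain C2 where C2: "0 < C2" and lo: "\<And>g :: complex ^ 'n \<Rightarrow> complex. holomorphic_Cn g (ball 0 1) \<Longrightarrow> g 0 = 0 \<Longrightarrow>
       weighted_energy b p g \<le> ennreal C2 * weighted_energy (b + p) p (radial_deriv g)"
    using energy_le_radial_deriv [OF p b, where 'n='n] by blast
  define D where "D = max (C1 * C) (C * C2)"
  have D: "0 < D" "C1 * C \<le> D" "C * C2 \<le> D" using C C1 by (auto simp: D_def less_max_iff_disj)
  show ?case
  proof (intro exI [of _ D] conjI allI impI)
    show "0 < D" by (rule D)
    fix g :: "complex ^ 'n \<Rightarrow> complex" assume g: "holomorphic_Cn g (ball 0 1)" and g0: "g 0 = 0"
    define h where "h = (radial_deriv ^^ m) g"
    have h: "holomorphic_Cn h (ball 0 1)" unfolding h_def by (rule holomorphic_radial_deriv_iterate [OF g]) simp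
    have h0: "h 0 = 0" using g0 by (cases m) (simp_all add: h_def)
    have e: "\<alpha> + p * real (Suc m) = b + p" by (simp add: b_def algebra_simps)
    have "weighted_energy (b + p) p (radial_deriv h) \<le> ennreal C1 * (ennreal C * weighted_energy (\<alpha> + p * real N) p ((radial_deriv ^^ N) g))"
      using IH [OF g g0] by (intro order_trans [OF up [OF h]] mult_left_mono) (auto simp: b_def h_def)
    also have "\<dots> = ennreal (C1 * C) * weighted_energy (\<alpha> + p * real N) p ((radial_deriv ^^ N) g)"
      using C C1 by (simp add: ennreal_mult mult.assoc)
    also have "\<dots> \<le> ennreal D * weighted_energy (\<alpha> + p * real N) p ((radial_deriv ^^ N) g)"
      using D by (intro mult_right_mono ennreal_leI) auto
    finally show "weighted_energy (\<alpha> + p * real (Suc m)) p ((radial_deriv ^^ Suc m) g)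
       \<le> ennreal D * weighted_energy (\<alpha> + p * real N) p ((radial_deriv ^^ N) g)"
      unfolding e by (simp add: h_def)
    have "weighted_energy (\<alpha> + p * real N) p ((radial_deriv ^^ N) g) \<le> ennreal C * weighted_energy b p h"
      using IH [OF g g0] by (simp add: b_def h_def)
    also have "\<dots> \<le> ennreal C * (ennreal C2 * weighted_energy (b + p) p (radial_deriv h))"
      by (intro mult_left_mono lo h h0) auto
    also have "\<dots> = ennreal (C * C2) * weighted_energy (b + p) p (radial_deriv h)"
      using C C2 by (simp add: ennreal_mult mult.assoc)
    also have "\<dots> \<le> ennreal D * weighted_energy (b + p) p (radial_deriv h)"
      using D by (intro mult_right_mono ennreal_leI) auto
    finally show "weighted_energy (\<alpha> + p * real N) p ((radial_deriv ^^ N) g)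
       \<le> ennreal D * weighted_energy (\<alpha> + p * real (Suc m)) p ((radial_deriv ^^ Suc m) g)"
      unfolding e by (simp add: h_def)
  qed
qed

lemma radial_deriv_iterate_diff_const:
  "0 < m \<Longrightarrow> (radial_deriv ^^ m) (\<lambda>z. f z - c) = (radial_deriv ^^ m) f"
  by (cases m) (simp_all add: funpow_Suc_right radial_deriv_diff_const del: funpow.simps)

text \<open>
  Membership in the Bergman space concerns \<open>f\<close>, the comparison of norms concerns \<open>f - f 0\<close>. The two agree
  after differentiation; if no derivative is taken, constants have finite energy.
\<close>

lemma energy_diff_const_finite:
  fixes f :: "complex ^ 'n::finite \<Rightarrow> complex"
  assumes p: "0 < p" and b: "-1 < b" and f: "holomorphic_Cn f (ball 0 1)"
    and fin: "weighted_energy b p f < \<infinity>"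
  shows "weighted_energy b p (\<lambda>z. f z - c) < \<infinity>"
proof -
  define W where "W = (\<integral>\<^sup>+z\<in>ball (0 :: complex ^ 'n) 1. ennreal (defect z powr b) \<partial>lborel)"
  have W: "W < \<infinity>" unfolding W_def by (rule weight_integrable [OF b])
  note [measurable] = measurable_energy_integrand [OF f, of b p]
  have "weighted_energy b p (\<lambda>z. f z - c)
    \<le> (\<integral>\<^sup>+z. ennreal (2 powr p) * (ennreal (defect z powr b * cmod (f z) powr p) * indicator (ball 0 1) z
        + ennreal (cmod c powr p) * (ennreal (defect z powr b) * indicator (ball 0 1) z)) \<partial>lborel)"
    unfolding weighted_energy_def
  proof (rule nn_integral_mono)
    fix z :: "complex ^ 'n"
    have "defect z powr b * cmod (f z - c) powr p \<le> defect z powr b * (2 powr p * (cmod (f z) powr p + cmod c powr p))"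
      using norm_add_powr_le [OF p, of "f z" "- c"] by (intro mult_left_mono) auto
    also have "\<dots> = 2 powr p * (defect z powr b * cmod (f z) powr p + cmod c powr p * defect z powr b)"
      by (simp add: algebra_simps)
    finally have "ennreal (defect z powr b * cmod (f z - c) powr p)
      \<le> ennreal (2 powr p * (defect z powr b * cmod (f z) powr p + cmod c powr p * defect z powr b))"
      by (rule ennreal_leI)
    then show "ennreal (defect z powr b * cmod (f z - c) powr p) * indicator (ball 0 1) z
      \<le> ennreal (2 powr p) * (ennreal (defect z powr b * cmod (f z) powr p) * indicator (ball 0 1) z
        + ennreal (cmod c powr p) * (ennreal (defect z powr b) * indicator (ball 0 1) z))"
      by (cases "z \<in> ball 0 1") (simp_all add: ennreal_mult ennreal_plus)
  qed
  also have "\<dots> = ennreal (2 powr p) * (weighted_energy b p f + ennreal (cmod c powr p) * W)"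
    unfolding W_def weighted_energy_def
    by (subst nn_integral_cmult, measurable) (subst nn_integral_add, measurable, simp add: nn_integral_cmult)
  also have "\<dots> < \<infinity>" using fin W by (simp add: ennreal_mult_less_top)
  finally show ?thesis .
qed

lemma bergman_energy:
  "\<exists>\<kappa>>0. \<forall>f :: complex ^ 'n::finite \<Rightarrow> complex. holomorphic_Cn f (ball 0 1) \<longrightarrow>
     bergman_norm p \<alpha> f = ennreal (cmod (f 0)) +
       ennreal_powr (ennreal \<kappa> * weighted_energy (\<alpha> + p * real (bergman_order p \<alpha>)) p ((radial_deriv ^^ bergman_order p \<alpha>) f)) (1 / p) \<and>
     (f \<in> bergman_space p \<alpha> \<longleftrightarrow> weighted_energy (\<alpha> + p * real (bergman_order p \<alpha>)) p ((radial_deriv ^^ bergman_order p \<alpha>) f) < \<infinity>)"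
proof -
  define N where "N = bergman_order p \<alpha>"
  obtain \<kappa> where \<kappa>: "0 < \<kappa>" and wm: "\<And>F :: complex ^ 'n \<Rightarrow> ennreal. (\<lambda>z. F z * indicator (ball 0 1) z) \<in> borel_measurable borel \<Longrightarrow>
       (\<integral>\<^sup>+z. F z \<partial>weighted_measure \<alpha>) = ennreal \<kappa> * (\<integral>\<^sup>+z\<in>ball 0 1. ennreal (defect z powr \<alpha>) * F z \<partial>lborel)"
    using nn_integral_weighted_measure [where 'n='n and \<alpha>=\<alpha>] by blast
  have key: "(\<integral>\<^sup>+z. F z \<partial>weighted_measure \<alpha>) = ennreal \<kappa> * weighted_energy (\<alpha> + p * real N) p h"
    if h: "holomorphic_Cn h (ball 0 1)"
      and F: "\<And>z. z \<in> ball 0 1 \<Longrightarrow> F z = ennreal (defect z powr (p * real N) * cmod (h z) powr p)"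
    for F :: "complex ^ 'n \<Rightarrow> ennreal" and h
  proof -
    have eq: "F z * indicator (ball 0 1) z = ennreal (defect z powr (p * real N) * cmod (h z) powr p) * indicator (ball 0 1) z" for z
      using F [of z] by (cases "z \<in> ball 0 1") auto
    have "(\<lambda>z. F z * indicator (ball 0 1) z) \<in> borel_measurable borel"
      unfolding eq by (rule measurable_energy_integrand [OF h])
    from wm [OF this] have "(\<integral>\<^sup>+z. F z \<partial>weighted_measure \<alpha>) = ennreal \<kappa> * (\<integral>\<^sup>+z\<in>ball 0 1. ennreal (defect z powr \<alpha>) * F z \<partial>lborel)" .
    also have "(\<integral>\<^sup>+z\<in>ball 0 1. ennreal (defect z powr \<alpha>) * F z \<partial>lborel) = weighted_energy (\<alpha> + p * real N) p h"
      unfolding weighted_energy_def mult.assoc eq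
      by (intro nn_integral_cong) (simp add: powr_add ennreal_mult mult.assoc)
    finally show ?thesis .
  qed
  show ?thesis
  proof (intro exI [of _ \<kappa>] conjI allI impI)
    show "0 < \<kappa>" by (rule \<kappa>)
    fix f :: "complex ^ 'n \<Rightarrow> complex" assume f: "holomorphic_Cn f (ball 0 1)"
    define h where "h = (radial_deriv ^^ N) f"
    have h: "holomorphic_Cn h (ball 0 1)" unfolding h_def by (rule holomorphic_radial_deriv_iterate [OF f]) simp
    have "(\<integral>\<^sup>+z. ennreal ((1 - (norm z)\<^sup>2) powr (p * real N) * cmod (h z) powr p) \<partial>weighted_measure \<alpha>)
      = ennreal \<kappa> * weighted_energy (\<alpha> + p * real N) p h"
      by (rule key [OF h]) (simp add: defect_def)
    then show "bergman_norm p \<alpha> f = ennreal (cmod (f 0)) +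
         ennreal_powr (ennreal \<kappa> * weighted_energy (\<alpha> + p * real (bergman_order p \<alpha>)) p ((radial_deriv ^^ bergman_order p \<alpha>) f)) (1 / p)"
      by (simp add: bergman_norm_def N_def h_def)
    define G where "G = (\<lambda>z. of_real ((1 - (norm z)\<^sup>2) ^ N) * h z)"
    have cm: "cmod (G z) powr p = defect z powr (p * real N) * cmod (h z) powr p" if "z \<in> ball 0 1" for z
    proof -
      have A: "0 < defect z" using that by (rule defect_pos)
      then have "cmod (G z) = defect z powr real N * cmod (h z)"
        by (simp add: G_def norm_mult norm_power defect_def [symmetric] powr_realpow del: of_real_diff of_real_power)
      then show ?thesis by (simp add: powr_mult powr_powr mult.commute)
    qed
    have "(\<integral>\<^sup>+z. ennreal_powr (ennreal (cmod (G z))) p \<partial>weighted_measure \<alpha>) = ennreal \<kappa> * weighted_energy (\<alpha> + p * real N) p h"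
      by (rule key [OF h]) (simp add: ennreal_powr_ennreal cm)
    then have fin: "Lp_norm (weighted_measure \<alpha>) p (\<lambda>z. ennreal (cmod (G z))) < \<infinity> \<longleftrightarrow> weighted_energy (\<alpha> + p * real N) p h < \<infinity>"
      using \<kappa> by (auto simp: Lp_norm_def ennreal_powr_less_top ennreal_mult_less_top)
    have "continuous_on (ball 0 1) G"
      unfolding G_def by (intro continuous_intros holomorphic_Cn_continuous_on [OF h])
    then have "G \<in> borel_measurable (restrict_space borel (ball 0 1))"
      by (rule borel_measurable_continuous_on_restrict)
    moreover have "sets (weighted_measure \<alpha> :: (complex ^ 'n) measure) = sets (restrict_space borel (ball 0 1))"
      by (simp add: weighted_measure_def ball_measure_def cong: sets_restrict_space_cong)
    ultimately have "G \<in> borel_measurable (weighted_measure \<alpha>)"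
      using measurable_cong_sets by blast
    then show "f \<in> bergman_space p \<alpha> \<longleftrightarrow> weighted_energy (\<alpha> + p * real (bergman_order p \<alpha>)) p ((radial_deriv ^^ bergman_order p \<alpha>) f) < \<infinity>"
      using f fin by (simp add: bergman_space_def in_Lp_complex_def N_def h_def G_def)
  qed
qed

theorem corollary1p2:
  fixes q \<gamma> \<alpha> p :: real and k :: nat
  assumes "1 < q" and "0 < \<gamma>" and "0 < p"
    and "p * real k + \<alpha> > -1"
  shows "(\<forall>f :: complex ^ 'n::finite \<Rightarrow> complex. holomorphic_Cn f (ball 0 1) \<longrightarrow>
            (f \<in> bergman_space p \<alpha> \<longleftrightarrow> in_Lp (weighted_measure \<alpha>) p (area_fun \<gamma> q (k + 1) f)))
       \<and> (\<exists>C>0. \<forall>f :: complex ^ 'n \<Rightarrow> complex. holomorphic_Cn f (ball 0 1) \<longrightarrow>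
            ennreal (inverse C) * Lp_norm (weighted_measure \<alpha>) p (area_fun \<gamma> q (k + 1) f)
              \<le> bergman_norm p \<alpha> (\<lambda>z. f z - f 0)
            \<and> bergman_norm p \<alpha> (\<lambda>z. f z - f 0)
              \<le> ennreal C * Lp_norm (weighted_measure \<alpha>) p (area_fun \<gamma> q (k + 1) f))"
proof -
  define N where "N = bergman_order p \<alpha>"
  have N: "-1 < p * real N + \<alpha>"
    unfolding N_def bergman_order_def by (rule LeastI [of "\<lambda>N. -1 < p * real N + \<alpha>", OF assms(4)])
  have "N \<le> k" unfolding N_def bergman_order_def by (rule Least_le [of "\<lambda>N. -1 < p * real N + \<alpha>", OF assms(4)])
  then have Nk: "N \<le> k + 1" by simp
  have q: "0 < q" using assms(1) by simp
  note p = assms(3)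
  define m where "m = k + 1"
  obtain C1 where C1: "0 < C1" and AE: "\<And>f :: complex ^ 'n \<Rightarrow> complex. holomorphic_Cn f (ball 0 1) \<Longrightarrow>
       area_fun \<gamma> q m f \<in> borel_measurable (weighted_measure \<alpha>) \<and>
       (\<integral>\<^sup>+z. ennreal_powr (area_fun \<gamma> q m f z) p \<partial>weighted_measure \<alpha>)
         \<le> ennreal C1 * weighted_energy (\<alpha> + p * real m) p ((radial_deriv ^^ m) f) \<and>
       weighted_energy (\<alpha> + p * real m) p ((radial_deriv ^^ m) f)
         \<le> ennreal C1 * (\<integral>\<^sup>+z. ennreal_powr (area_fun \<gamma> q m f z) p \<partial>weighted_measure \<alpha>)"
    using area_energy [OF p q assms(2), where 'n='n and \<alpha>=\<alpha> and m=m] by blast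
  obtain C2 where C2: "0 < C2" and EC: "\<And>g :: complex ^ 'n \<Rightarrow> complex. holomorphic_Cn g (ball 0 1) \<Longrightarrow> g 0 = 0 \<Longrightarrow>
     weighted_energy (\<alpha> + p * real m) p ((radial_deriv ^^ m) g)
       \<le> ennreal C2 * weighted_energy (\<alpha> + p * real N) p ((radial_deriv ^^ N) g) \<and>
     weighted_energy (\<alpha> + p * real N) p ((radial_deriv ^^ N) g)
       \<le> ennreal C2 * weighted_energy (\<alpha> + p * real m) p ((radial_deriv ^^ m) g)"
    using energy_chain [OF p N Nk, where 'n='n] unfolding m_def by blast
  obtain \<kappa> where \<kappa>: "0 < \<kappa>"
    and BN: "\<And>f :: complex ^ 'n \<Rightarrow> complex. holomorphic_Cn f (ball 0 1) \<Longrightarrow>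
       bergman_norm p \<alpha> f = ennreal (cmod (f 0)) + ennreal_powr (ennreal \<kappa> * weighted_energy (\<alpha> + p * real N) p ((radial_deriv ^^ N) f)) (1 / p)"
    and BS: "\<And>f :: complex ^ 'n \<Rightarrow> complex. holomorphic_Cn f (ball 0 1) \<Longrightarrow>
       f \<in> bergman_space p \<alpha> \<longleftrightarrow> weighted_energy (\<alpha> + p * real N) p ((radial_deriv ^^ N) f) < \<infinity>"
    using bergman_energy [where 'n='n and p=p and \<alpha>=\<alpha>] unfolding N_def by blast
  define I where "I = (\<lambda>f :: complex ^ 'n \<Rightarrow> complex. \<integral>\<^sup>+z. ennreal_powr (area_fun \<gamma> q m f z) p \<partial>weighted_measure \<alpha>)"
  define E where "E = (\<lambda>f :: complex ^ 'n \<Rightarrow> complex. weighted_energy (\<alpha> + p * real N) p ((radial_deriv ^^ N) (\<lambda>z. f z - f 0)))"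
  define D where "D = C1 * C2"
  have D: "0 < D" using C1 C2 by (simp add: D_def)
  have cmp: "I f \<le> ennreal D * E f" "E f \<le> ennreal D * I f" if f: "holomorphic_Cn f (ball 0 1)" for f
  proof -
    have g: "holomorphic_Cn (\<lambda>z. f z - f 0) (ball 0 1)" using f by (rule holomorphic_Cn_diff_const)
    have eq: "(radial_deriv ^^ m) (\<lambda>z. f z - f 0) = (radial_deriv ^^ m) f"
      by (rule radial_deriv_iterate_diff_const) (simp add: m_def)
    note ec = EC [OF g, unfolded eq]
    have "I f \<le> ennreal C1 * (ennreal C2 * E f)"
      unfolding I_def E_def using AE [OF f] ec by (meson diff_self mult_left_mono order_trans zero_le)
    then show "I f \<le> ennreal D * E f" using C1 C2 by (simp add: D_def ennreal_mult mult.assoc)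
    have "E f \<le> ennreal C2 * (ennreal C1 * I f)"
      unfolding I_def E_def using AE [OF f] ec by (meson diff_self mult_left_mono order_trans zero_le)
    then show "E f \<le> ennreal D * I f" using C1 C2 by (simp add: D_def ennreal_mult mult_ac)
  qed
  have Lp: "Lp_norm (weighted_measure \<alpha>) p (area_fun \<gamma> q m f) = ennreal_powr (I f) (1 / p)" for f
    by (simp add: Lp_norm_def I_def)
  have norm: "bergman_norm p \<alpha> (\<lambda>z. f z - f 0) = ennreal_powr (ennreal \<kappa> * E f) (1 / p)"
    if f: "holomorphic_Cn f (ball 0 1)" for f
    using BN [OF holomorphic_Cn_diff_const [OF f, of "f 0"]] by (simp add: E_def)
  define C where "C = max ((\<kappa> * D) powr (1 / p)) ((D / \<kappa>) powr (1 / p))"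
  have C: "0 < C" "(\<kappa> * D) powr (1 / p) \<le> C" "(D / \<kappa>) powr (1 / p) \<le> C"
    using \<kappa> D by (auto simp: C_def less_max_iff_disj)
  show ?thesis
  proof (intro conjI allI impI exI [of _ C])
    fix f :: "complex ^ 'n \<Rightarrow> complex" assume f: "holomorphic_Cn f (ball 0 1)"
    have "f \<in> bergman_space p \<alpha> \<longleftrightarrow> E f < \<infinity>"
    \<comment> \<open>Only for \<open>N = 0\<close> does subtracting the value at the origin change the integrand of the norm.\<close>
    proof (cases "N = 0")
      case True
      then have b: "-1 < \<alpha>" using N by simp
      have "weighted_energy \<alpha> p f < \<infinity> \<longleftrightarrow> weighted_energy \<alpha> p (\<lambda>z. f z - f 0) < \<infinity>"
        using energy_diff_const_finite [OF p b f, of "f 0"]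
          energy_diff_const_finite [OF p b holomorphic_Cn_diff_const [OF f, of "f 0"], of "- f 0"] by auto
      then show ?thesis using BS [OF f] True by (simp add: E_def)
    next
      case False
      then show ?thesis using BS [OF f] by (simp add: E_def radial_deriv_iterate_diff_const)
    qed
    also have "\<dots> \<longleftrightarrow> I f < \<infinity>"
      using cmp [OF f] by (auto intro: le_less_trans simp: ennreal_mult_less_top)
    also have "\<dots> \<longleftrightarrow> in_Lp (weighted_measure \<alpha>) p (area_fun \<gamma> q m f)"
      using AE [OF f] by (simp add: in_Lp_def Lp ennreal_powr_less_top)
    finally show "f \<in> bergman_space p \<alpha> \<longleftrightarrow> in_Lp (weighted_measure \<alpha>) p (area_fun \<gamma> q (k + 1) f)"
      by (simp add: m_def)
  next
    show "0 < C" by (rule C)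
  next
    fix f :: "complex ^ 'n \<Rightarrow> complex" assume f: "holomorphic_Cn f (ball 0 1)"
    have "I f \<le> ennreal (D / \<kappa>) * (ennreal \<kappa> * E f)"
    proof -
      have "ennreal (D / \<kappa>) * (ennreal \<kappa> * E f) = ennreal (D / \<kappa> * \<kappa>) * E f"
        using D \<kappa> by (simp only: ennreal_mult' less_imp_le mult.assoc divide_nonneg_nonneg)
      then show ?thesis using cmp(1) [OF f] \<kappa> by simp
    qed
    then have "ennreal_powr (I f) (1 / p) \<le> ennreal_powr (ennreal (D / \<kappa>) * (ennreal \<kappa> * E f)) (1 / p)"
      using p by (intro ennreal_powr_mono) auto
    also have "\<dots> = ennreal ((D / \<kappa>) powr (1 / p)) * bergman_norm p \<alpha> (\<lambda>z. f z - f 0)"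
      using D \<kappa> by (subst ennreal_powr_mult) (simp_all add: norm [OF f])
    also have "\<dots> \<le> ennreal C * bergman_norm p \<alpha> (\<lambda>z. f z - f 0)"
      using C by (intro mult_right_mono ennreal_leI) auto
    finally have "ennreal (inverse C) * ennreal_powr (I f) (1 / p) \<le> ennreal (inverse C) * (ennreal C * bergman_norm p \<alpha> (\<lambda>z. f z - f 0))"
      by (intro mult_left_mono) auto
    also have "\<dots> = bergman_norm p \<alpha> (\<lambda>z. f z - f 0)"
      using C by (simp add: mult.assoc [symmetric] flip: ennreal_mult)
    finally show "ennreal (inverse C) * Lp_norm (weighted_measure \<alpha>) p (area_fun \<gamma> q (k + 1) f) \<le> bergman_norm p \<alpha> (\<lambda>z. f z - f 0)"
      unfolding m_def [symmetric] Lp .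
  next
    fix f :: "complex ^ 'n \<Rightarrow> complex" assume f: "holomorphic_Cn f (ball 0 1)"
    have "ennreal \<kappa> * E f \<le> ennreal \<kappa> * (ennreal D * I f)"
      by (intro mult_left_mono cmp f) auto
    also have "\<dots> = ennreal (\<kappa> * D) * I f" using \<kappa> D by (simp add: ennreal_mult mult.assoc)
    finally have "ennreal_powr (ennreal \<kappa> * E f) (1 / p) \<le> ennreal_powr (ennreal (\<kappa> * D) * I f) (1 / p)"
      using p by (intro ennreal_powr_mono) auto
    also have "\<dots> = ennreal ((\<kappa> * D) powr (1 / p)) * ennreal_powr (I f) (1 / p)"
      using \<kappa> D by (intro ennreal_powr_mult) simp
    also have "\<dots> \<le> ennreal C * ennreal_powr (I f) (1 / p)"
      using C by (intro mult_right_mono ennreal_leI) auto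
    finally show "bergman_norm p \<alpha> (\<lambda>z. f z - f 0) \<le> ennreal C * Lp_norm (weighted_measure \<alpha>) p (area_fun \<gamma> q (k + 1) f)"
      unfolding m_def [symmetric] Lp norm [OF f] .
  qed
qed

end
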